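(* Let $G$ be a critical graph of girth at least $5$. For every complete windmill $W$ in $G$, the closure $\overline{W}$ of $W$ contains, as an induced subgraph, a graph of the following form for some integer $k\ge 2$: a cycle of length $3k$ together with one additional center vertex which is adjacent to exactly $k$ vertices of the cycle (the anchors), such that any two consecutive anchors are at distance exactly $3$ along the cycle.
   Context: All graphs are finite and simple. A good edge-labeling of a graph $G$ is a map $\phi\colon E(G)\to\mathbb{R}$ such that for every ordered pair of vertices $u,v$ there is at most one path from $u$ to $v$ along which the edge labels are nondecreasing. A graph is critical if it has no good edge-labeling but every proper subgraph of it has one. A $k$-vertex is a vertex of degree $k$ (in $G$), a $4^+$-vertex is a vertex of degree at least $4$. An internally shortest 3-path is a path $P=x_0\dots x_\ell$ in $G$ with $\ell\ge1$ and $\deg_G(x_j)=3$ for $j\in\{1,\dots,\ell-1\}$ such that, with $e:=x_0x_1$, the subpath $x_1\dots x_\ell$ is a shortest path (between $x_1$ and $x_\ell$) in $G-e$. It starts in $x_0$ and ends in $x_\ell$. For an edge $x_0x_1$, a sail with tip $x_0x_1$ is an internally shortest 3-path $x_0x_1\dots x_\ell$ that starts in a 2-vertex $x_0$ and ends in a $4^+$-vertex $x_\ell$, and which has minimum length among all such internally shortest 3-paths (with first edge $x_0x_1$). Let $k\ge3$ and let $y$ be a vertex of degree $\max(4,k)$ or $k+1$. A $k$-windmill with axis $y$ in $G$ is an induced subgraph of $G$ spanned by the union of $k$ sails with $k$ distinct tips, each ending in $y$. A windmill is a $k$-windmill for some $k\ge 3$; it is complete if it is not a proper subgraph of another windmill.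 A flag of a complete windmill $W$ is a vertex of $G$ not in $W$ that has at least two neighbors in $W$. The closure $\overline W$ of $W$ is the subgraph of $G$ induced by the vertices of $W$ and all flags of $W$. *)

theory Defs
  imports Complex_Main "HOL-Library.Extended_Nat"
begin

record 'a sgraph =
  vertices :: "'a set"
  edges :: "'a set set"

definition simple_graph :: "'a sgraph \<Rightarrow> bool" where
  "simple_graph G \<longleftrightarrow> finite (vertices G) \<and>
     (\<forall>e\<in>edges G. \<exists>u v. e = {u, v} \<and> u \<noteq> v \<and> u \<in> vertices G \<and> v \<in> vertices G)"

definition subgraph :: "'a sgraph \<Rightarrow> 'a sgraph \<Rightarrow> bool" where
  "subgraph H G \<longleftrightarrow> simple_graph H \<and> vertices H \<subseteq> vertices G \<and> edges H \<subseteq> edges G"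

definition proper_subgraph :: "'a sgraph \<Rightarrow> 'a sgraph \<Rightarrow> bool" where
  "proper_subgraph H G \<longleftrightarrow> subgraph H G \<and> H \<noteq> G"

definition induce :: "'a sgraph \<Rightarrow> 'a set \<Rightarrow> 'a sgraph" where
  "induce G X = \<lparr>vertices = vertices G \<inter> X, edges = {e \<in> edges G. e \<subseteq> X}\<rparr>"

definition induced_subgraph :: "'a sgraph \<Rightarrow> 'a sgraph \<Rightarrow> bool" where
  "induced_subgraph H G \<longleftrightarrow> (\<exists>X \<subseteq> vertices G. H = induce G X)"

definition delete_edge :: "'a sgraph \<Rightarrow> 'a set \<Rightarrow> 'a sgraph" where
  "delete_edge G e = \<lparr>vertices = vertices G, edges = edges G - {e}\<rparr>"

definition neighbors :: "'a sgraph \<Rightarrow> 'a \<Rightarrow> 'a set" where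
  "neighbors G v = {u \<in> vertices G. {u, v} \<in> edges G}"

definition degree :: "'a sgraph \<Rightarrow> 'a \<Rightarrow> nat" where
  "degree G v = card {e \<in> edges G. v \<in> e}"

text \<open>
  Paths and cycles are given by their vertex sequences. The path \<open>[u]\<close> has length 0, and
  in general a path \<open>p\<close> has \<open>length p - 1\<close> edges. A cycle is written without
  repeating its first vertex, so a cycle \<open>c\<close> has \<open>length c\<close> edges.
\<close>

fun walk_edges :: "'a list \<Rightarrow> 'a set list" where
  "walk_edges (x # y # xs) = {x, y} # walk_edges (y # xs)"
| "walk_edges _ = []"

definition path :: "'a sgraph \<Rightarrow> 'a list \<Rightarrow> bool" where
  "path G p \<longleftrightarrow> p \<noteq> [] \<and> distinct p \<and> set p \<subseteq> vertices G \<and> set (walk_edges p) \<subseteq> edges G"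

definition path_between :: "'a sgraph \<Rightarrow> 'a \<Rightarrow> 'a \<Rightarrow> 'a list \<Rightarrow> bool" where
  "path_between G u v p \<longleftrightarrow> path G p \<and> hd p = u \<and> last p = v"

definition shortest_path :: "'a sgraph \<Rightarrow> 'a list \<Rightarrow> bool" where
  "shortest_path G p \<longleftrightarrow> path G p \<and>
     (\<forall>q. path_between G (hd p) (last p) q \<longrightarrow> length p \<le> length q)"

definition cycle_edges :: "'a list \<Rightarrow> 'a set set" where
  "cycle_edges c = set (walk_edges (c @ [hd c]))"

definition cycle :: "'a sgraph \<Rightarrow> 'a list \<Rightarrow> bool" where
  "cycle G c \<longleftrightarrow> length c \<ge> 3 \<and> distinct c \<and> set c \<subseteq> vertices G \<and> cycle_edges c \<subseteq> edges G"

text \<open>The girth of a forest is \<open>\<infinity>\<close>.\<close>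

definition girth :: "'a sgraph \<Rightarrow> enat" where
  "girth G = (INF c \<in> {c. cycle G c}. enat (length c))"

text \<open>Labelings are total functions; only their values on \<open>edges G\<close> matter.\<close>

definition nondecreasing_along :: "('a set \<Rightarrow> real) \<Rightarrow> 'a list \<Rightarrow> bool" where
  "nondecreasing_along \<phi> p \<longleftrightarrow> sorted (map \<phi> (walk_edges p))"

definition good_edge_labeling :: "'a sgraph \<Rightarrow> ('a set \<Rightarrow> real) \<Rightarrow> bool" where
  "good_edge_labeling G \<phi> \<longleftrightarrow>
     (\<forall>u\<in>vertices G. \<forall>v\<in>vertices G. \<forall>p q.
        path_between G u v p \<and> nondecreasing_along \<phi> p \<and>
        path_between G u v q \<and> nondecreasing_along \<phi> q \<longrightarrow> p = q)"

definition critical :: "'a sgraph \<Rightarrow> bool" where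
  "critical G \<longleftrightarrow> \<not> (\<exists>\<phi>. good_edge_labeling G \<phi>) \<and>
     (\<forall>H. proper_subgraph H G \<longrightarrow> (\<exists>\<phi>. good_edge_labeling H \<phi>))"

definition tip :: "'a list \<Rightarrow> 'a set" where
  "tip p = {p ! 0, p ! 1}"

definition internally_shortest_3_path :: "'a sgraph \<Rightarrow> 'a list \<Rightarrow> bool" where
  "internally_shortest_3_path G p \<longleftrightarrow>
     path G p \<and> length p \<ge> 2 \<and>
     (\<forall>j\<in>{1..<length p - 1}. degree G (p ! j) = 3) \<and>
     shortest_path (delete_edge G (tip p)) (tl p)"

definition presail :: "'a sgraph \<Rightarrow> 'a list \<Rightarrow> bool" where
  "presail G p \<longleftrightarrow> internally_shortest_3_path G p \<and> degree G (hd p) = 2 \<and> degree G (last p) \<ge> 4"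

text \<open>
  A tip is the unordered edge \<open>x\<^sub>0x\<^sub>1\<close>. This loses no information: \<open>x\<^sub>0\<close> is its
  only end of degree 2, since \<open>x\<^sub>1\<close> has degree 3 or is the end of the sail.
\<close>

definition sail :: "'a sgraph \<Rightarrow> 'a list \<Rightarrow> bool" where
  "sail G p \<longleftrightarrow> presail G p \<and> (\<forall>q. presail G q \<and> tip q = tip p \<longrightarrow> length p \<le> length q)"

definition k_windmill :: "'a sgraph \<Rightarrow> nat \<Rightarrow> 'a \<Rightarrow> 'a sgraph \<Rightarrow> bool" where
  "k_windmill G k y W \<longleftrightarrow>
     k \<ge> 3 \<and> y \<in> vertices G \<and> (degree G y = max 4 k \<or> degree G y = k + 1) \<and>
     (\<exists>S. finite S \<and> card S = k \<and> inj_on tip S \<and> (\<forall>p\<in>S. sail G p \<and> last p = y) \<and>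
        W = induce G (\<Union>p\<in>S. set p))"

definition windmill :: "'a sgraph \<Rightarrow> 'a sgraph \<Rightarrow> bool" where
  "windmill G W \<longleftrightarrow> (\<exists>k y. k_windmill G k y W)"

definition complete_windmill :: "'a sgraph \<Rightarrow> 'a sgraph \<Rightarrow> bool" where
  "complete_windmill G W \<longleftrightarrow> windmill G W \<and> \<not> (\<exists>W'. windmill G W' \<and> proper_subgraph W W')"

definition flag :: "'a sgraph \<Rightarrow> 'a sgraph \<Rightarrow> 'a \<Rightarrow> bool" where
  "flag G W v \<longleftrightarrow> v \<in> vertices G \<and> v \<notin> vertices W \<and> card (neighbors G v \<inter> vertices W) \<ge> 2"

definition windmill_closure :: "'a sgraph \<Rightarrow> 'a sgraph \<Rightarrow> 'a sgraph" where
  "windmill_closure G W = induce G (vertices W \<union> {v. flag G W v})"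

text \<open>
  For a cycle \<open>c\<close> with anchor set \<open>A\<close>: going around \<open>c\<close>, from the anchor at position \<open>i\<close>
  the next anchor is reached after exactly \<open>d\<close> steps.
\<close>

definition next_anchor :: "'a list \<Rightarrow> 'a set \<Rightarrow> nat \<Rightarrow> nat \<Rightarrow> bool" where
  "next_anchor c A i d \<longleftrightarrow> i < length c \<and> 0 < d \<and>
     c ! i \<in> A \<and> c ! ((i + d) mod length c) \<in> A \<and>
     (\<forall>j. 0 < j \<and> j < d \<longrightarrow> c ! ((i + j) mod length c) \<notin> A)"

definition anchored_cycle :: "nat \<Rightarrow> 'a sgraph \<Rightarrow> bool" where
  "anchored_cycle k H \<longleftrightarrow>
     (\<exists>c z A. length c = 3 * k \<and> distinct c \<and> z \<notin> set c \<and> A \<subseteq> set c \<and> card A = k \<and>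
        (\<forall>i d. next_anchor c A i d \<longrightarrow> d = 3) \<and>
        H = \<lparr>vertices = insert z (set c), edges = cycle_edges c \<union> {{z, a} | a. a \<in> A}\<rparr>)"

end

theory Submission
  imports Defs
begin

text \<open>
  Read the edges in increasing order of label as telephone calls, in which both callers learn
  everything the other one knows. The labeling is good iff no call repeats information. If the
  vertices of a set \<open>X\<close> have at most one edge each outside a set \<open>T\<close> of edges within \<open>X\<close>, one can
  call along \<open>T\<close>, along a good labeling of \<open>G - X\<close>, and finally along the remaining edges, provided
  that vertices of \<open>X\<close> that are linked by a remaining edge or through a vertex outside \<open>X\<close> share no
  information after the calls along \<open>T\<close>. In a critical graph this must fail.

  Applied to a shortest path of 3-vertices between two 2-vertices, this shows that such a path is at
  least as long as the distances from its two ends to the nearest vertices of degree at least 4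
  together. Hence the sails of a windmill are disjoint apart from their ends, and all links involve a
  2-vertex. Calling along the sails towards the axis \<open>y\<close> then only fails if there are flags
  \<open>f\<^sub>1, \<dots>, f\<^sub>n\<close> and sails \<open>x\<^sub>i a\<^sub>i y\<close> such that \<open>f\<^sub>i\<close> is adjacent to \<open>x\<^sub>i\<close> and \<open>a\<^sub>i\<^sub>+\<^sub>1\<close>
  cyclically. If no two of these flags are adjacent, they give an anchored cycle with center \<open>y\<close>; if
  \<open>f\<^sub>i\<close> and \<open>f\<^sub>j\<close> are adjacent, the cycle \<open>y a\<^sub>i x\<^sub>i f\<^sub>i f\<^sub>j a\<^sub>j\<^sub>+\<^sub>1\<close> with center \<open>a\<^sub>i\<^sub>+\<^sub>1\<close> is one.
\<close>

section \<open>Calls\<close>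

text \<open>A vertex of \<open>X\<close> with at most one edge outside \<open>T\<close> takes part
  in at most one late call, so the edges left for the end form stars, and whether they repeat
  anything depends only on what the vertices of \<open>X\<close> know by then. The obstacle is the
  axis: it gathers the information of all sails and passes it on to every anchor that calls later.
  In a sail with at least three edges the second edge avoids \<open>y\<close>; postponing it keeps
  the first two vertices unknown beyond the third one, and girth 5 forbids links from the start to
  the second or third vertex. A sail \<open>x a y\<close> leaves no such freedom: \<open>y\<close>
  learns \<open>x\<close>, and so does every anchor calling afterwards. Hence an anchor that shares
  a flag with \<open>x\<close> has to call before, and a suitable order of the short sails exists
  unless these demands are cyclic. Each demand contributes an anchor, a start and a flag, which is
  where the length 3k comes from.\<close>

definition call :: "('a \<Rightarrow> 'a set) \<Rightarrow> 'a set \<Rightarrow> 'a \<Rightarrow> 'a set" where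
  "call A e v = (if v \<in> e then \<Union>(A ` e) else A v)"

abbreviation calls :: "('a \<Rightarrow> 'a set) \<Rightarrow> 'a set list \<Rightarrow> 'a \<Rightarrow> 'a set" where
  "calls \<equiv> foldl call"

fun nodup :: "('a \<Rightarrow> 'a set) \<Rightarrow> 'a set list \<Rightarrow> bool" where
  "nodup A [] \<longleftrightarrow> True"
| "nodup A (e # es) \<longleftrightarrow> (\<forall>u\<in>e. \<forall>v\<in>e. u \<noteq> v \<longrightarrow> A u \<inter> A v = {}) \<and> nodup (call A e) es"

abbreviation (input) own :: "'a \<Rightarrow> 'a set" where
  "own \<equiv> \<lambda>v. {v}"

lemma nodup_append: "nodup A (xs @ ys) \<longleftrightarrow> nodup A xs \<and> nodup (calls A xs) ys"
  by (induction xs arbitrary: A) auto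

lemma call_mono: "A v \<subseteq> call A e v"
  by (auto simp: call_def)

lemma calls_untouched: "v \<notin> \<Union>(set es) \<Longrightarrow> calls A es v = A v"
  by (induction es arbitrary: A) (auto simp: call_def)

text \<open>No call crosses the border of \<open>K\<close>, so nothing from outside leaks in. Nearly
  every later bound on what a vertex knows is an instance with a suitable \<open>K\<close>.\<close>

lemma calls_subset:
  assumes "\<And>e. e \<in> set es \<Longrightarrow> e \<subseteq> K \<or> e \<inter> K = {}" and "\<And>v. v \<in> K \<Longrightarrow> A v \<subseteq> C" and "v \<in> K"
  shows "calls A es v \<subseteq> C"
  using assms
proof (induction es arbitrary: A)
  case (Cons e es)
  have "call A e u \<subseteq> C" if "u \<in> K" for u
  proof (cases "u \<in> e")
    case True
    then have "e \<subseteq> K" using Cons.prems(1)[of e] that by auto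
    then have "A w \<subseteq> C" if "w \<in> e" for w using Cons.prems(2) that by auto
    then show ?thesis using True by (auto simp: call_def)
  qed (use Cons.prems(2) that in \<open>simp add: call_def\<close>)
  then have "calls (call A e) es v \<subseteq> C"
    using Cons.prems by (intro Cons.IH) auto
  then show ?case by simp
qed auto

lemma nodup_cong:
  assumes "\<And>v. v \<in> \<Union>(set es) \<Longrightarrow> A v = B v"
  shows "nodup A es = nodup B es"
  using assms
proof (induction es arbitrary: A B)
  case (Cons e es)
  have "nodup (call A e) es = nodup (call B e) es"
    using Cons.prems by (intro Cons.IH) (auto simp: call_def)
  then show ?case using Cons.prems by simp
qed auto

text \<open>Knowledge only grows, so two vertices that share an item keep sharing it, and any later
  call between them would repeat it.\<close>

lemma nodup_not_mem:
  assumes "nodup A es" and "a \<noteq> b" and "A a \<inter> A b \<noteq> {}"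
  shows "{a, b} \<notin> set es"
  using assms
proof (induction es arbitrary: A)
  case (Cons e es)
  have "call A e a \<inter> call A e b \<noteq> {}"
    using Cons.prems(3) call_mono[of A a e] call_mono[of A b e] by blast
  then have "{a, b} \<notin> set es"
    using Cons.IH[of "call A e"] Cons.prems by auto
  moreover have "e \<noteq> {a, b}"
    using Cons.prems by auto
  ultimately show ?case by simp
qed auto

definition pairs :: "'a set set \<Rightarrow> bool" where
  "pairs E \<longleftrightarrow> (\<forall>e\<in>E. \<exists>a b. e = {a, b} \<and> a \<noteq> b)"

text \<open>After a call its two ends know the same nonempty set, so the same call cannot come
  again.\<close>

lemma nodup_distinct:
  assumes "nodup A es" and "pairs (set es)" and "\<And>v. A v \<noteq> {}"
  shows "distinct es"
  using assms
proof (induction es arbitrary: A)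
  case (Cons e es)
  obtain a b where e: "e = {a, b}" "a \<noteq> b" using Cons.prems(2) by (auto simp: pairs_def)
  have ne: "call A e v \<noteq> {}" for v
    using Cons.prems(3)[of v] call_mono[of A v e] by blast
  have "{a, b} \<notin> set es"
    by (rule nodup_not_mem[of "call A e"]) (use Cons.prems e in \<open>auto simp: call_def\<close>)
  moreover have "distinct es"
    using Cons.IH[of "call A e"] Cons.prems ne by (auto simp: pairs_def)
  ultimately show ?case using e by simp
qed auto

lemma walk_edges_snoc: "walk_edges (p @ [a, b]) = walk_edges (p @ [a]) @ [{a, b}]"
  by (induction p rule: walk_edges.induct) auto

lemma walk_edges_append:
  "walk_edges (p @ a # b # q) = walk_edges (p @ [a]) @ {a, b} # walk_edges (b # q)"
  by (induction p rule: walk_edges.induct) auto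

lemma walk_edges_subset: "e \<in> set (walk_edges p) \<Longrightarrow> e \<subseteq> set p"
  by (induction p rule: walk_edges.induct) auto

lemma walk_edges_distinct: "distinct p \<Longrightarrow> distinct (walk_edges p)"
proof (induction p rule: walk_edges.induct)
  case (1 x y xs)
  have "{x, y} \<notin> set (walk_edges (y # xs))"
    using walk_edges_subset[of "{x, y}" "y # xs"] 1(2) by auto
  then show ?case using 1 by simp
qed auto

text \<open>With increasing labels along \<open>es\<close>, the set \<open>calls own es v\<close> consists of the
  start vertices of the nondecreasing paths to \<open>v\<close>.\<close>

lemma nondecreasing_unique:
  assumes "nodup own es" and "pairs (set es)" and "sorted_wrt (<) (map \<phi> es)"
  defines "N \<equiv> \<lambda>p. p \<noteq> [] \<and> distinct p \<and> set (walk_edges p) \<subseteq> set es \<and> nondecreasing_along \<phi> p"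
  shows "(\<forall>p. N p \<longrightarrow> hd p \<in> calls own es (last p)) \<and>
    (\<forall>p q. N p \<and> N q \<and> hd p = hd q \<and> last p = last q \<longrightarrow> p = q)"
  using assms(1-3) unfolding N_def
proof (induction es rule: rev_induct)
  case Nil
  have "\<exists>x. p = [x]" if "p \<noteq> []" "set (walk_edges p) \<subseteq> {}" for p :: "'a list"
    using that by (cases p rule: walk_edges.cases) auto
  then show ?case by (metis (no_types, lifting) empty_set foldl_Nil insertI1 last_ConsL list.sel(1))
next
  case (snoc e es)
  let ?N = "\<lambda>es p. p \<noteq> [] \<and> distinct p \<and> set (walk_edges p) \<subseteq> set es \<and> nondecreasing_along \<phi> p"
  let ?A = "calls own es"
  have IH1: "hd p \<in> ?A (last p)" if "?N es p" for p
    using snoc that by (auto simp: nodup_append sorted_wrt_append pairs_def)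
  have IH2: "p = q" if "?N es p" "?N es q" "hd p = hd q" "last p = last q" for p q
    using snoc that by (auto simp: nodup_append sorted_wrt_append pairs_def)
  have disj: "?A u \<inter> ?A v = {}" if "u \<in> e" "v \<in> e" "u \<noteq> v" for u v
    using snoc.prems(1) that by (auto simp: nodup_append)
  have lab: "\<phi> e' < \<phi> e" if "e' \<in> set es" for e'
    using snoc.prems(3) that by (auto simp: sorted_wrt_append)
  \<comment> \<open>The last call \<open>e\<close> has the largest label, so a nondecreasing path
    that uses it must end with it.\<close>
  have split: "?N es p \<or> (\<exists>p' a b. p = p' @ [a, b] \<and> e = {a, b} \<and> ?N es (p' @ [a]))"
    if N: "?N (es @ [e]) p" for p
  proof (cases "e \<in> set (walk_edges p)")
    case False
    then show ?thesis using N by auto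
  next
    case True
    then obtain xs ys where xy: "walk_edges p = xs @ e # ys" by (auto dest: split_list)
    have "ys = []"
    proof (cases ys)
      case (Cons f zs)
      then have "\<phi> e \<le> \<phi> f" using N xy by (auto simp: nondecreasing_along_def sorted_append)
      moreover have "f \<noteq> e" using N walk_edges_distinct[of p] xy Cons by auto
      moreover have "f \<in> set (es @ [e])" using N xy Cons by auto
      ultimately show ?thesis using lab[of f] by auto
    qed auto
    obtain p' a b where p: "p = p' @ [a, b]"
      using True by (metis append.assoc append_Cons append_Nil empty_iff empty_set neq_Nil_conv
          rev_exhaust walk_edges.simps(2) walk_edges.simps(3))
    have we: "walk_edges (p' @ [a]) = xs" "{a, b} = e"
      using xy \<open>ys = []\<close> unfolding p walk_edges_snoc by auto
    have "distinct (xs @ [e])" using walk_edges_distinct[of p] N xy \<open>ys = []\<close> by auto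
    then have "?N es (p' @ [a])"
      using N xy \<open>ys = []\<close> we unfolding p by (auto simp: nondecreasing_along_def sorted_append)
    then show ?thesis using p we by blast
  qed
  have A1: "calls own (es @ [e]) v = (if v \<in> e then \<Union>(?A ` e) else ?A v)" for v
    by (simp add: call_def)
  have 1: "hd p \<in> calls own (es @ [e]) (last p)" if N: "?N (es @ [e]) p" for p
    using split[OF N]
  proof
    assume "?N es p"
    then show ?thesis using IH1 call_mono[of ?A "last p" e] by auto
  next
    assume "\<exists>p' a b. p = p' @ [a, b] \<and> e = {a, b} \<and> ?N es (p' @ [a])"
    then obtain p' a b where p: "p = p' @ [a, b]" "e = {a, b}" "?N es (p' @ [a])" by blast
    have "hd p \<in> ?A a" using IH1[OF p(3)] p(1) by (cases p') auto
    then show ?thesis using p unfolding A1 by auto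
  qed
  \<comment> \<open>A path to \<open>b\<close> without \<open>e\<close> and one that ends with
    \<open>e\<close> would make their common start known to both \<open>a\<close> and
    \<open>b\<close> before the call \<open>e\<close>.\<close>
  have mixed: False if "?N es p" "q = q' @ [a, b]" "e = {a, b}" "?N es (q' @ [a])"
      "hd p = hd q" "last p = last q" "distinct q" for p q q' a b
  proof -
    have "hd p \<in> ?A b" using IH1[OF that(1)] that by simp
    moreover have "hd p \<in> ?A a" using IH1[OF that(4)] that by (cases q') auto
    ultimately show False using disj[of a b] that by auto
  qed
  have 2: "p = q" if Np: "?N (es @ [e]) p" and Nq: "?N (es @ [e]) q"
      and eq: "hd p = hd q" "last p = last q" for p q
  proof (cases "?N es p")
    case True
    show ?thesis
    proof (cases "?N es q")
      case False
      then obtain q' a b where "q = q' @ [a, b]" "e = {a, b}" "?N es (q' @ [a])"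
        using split[OF Nq] by blast
      from mixed[OF True this eq] Nq show ?thesis by blast
    qed (use IH2[OF True _ eq] in blast)
  next
    case False
    then obtain p' a b where p: "p = p' @ [a, b]" "e = {a, b}" "?N es (p' @ [a])"
      using split[OF Np] by blast
    show ?thesis
    proof (cases "?N es q")
      case True
      from mixed[OF True p eq[symmetric]] Np show ?thesis by blast
    next
      case False
      then obtain q' c d where q: "q = q' @ [c, d]" "e = {c, d}" "?N es (q' @ [c])"
        using split[OF Nq] by blast
      have "b = d" using eq p q by simp
      moreover have "a = c" using p(2) q(2) \<open>b = d\<close> by (metis doubleton_eq_iff)
      moreover have "hd (p' @ [a]) = hd (q' @ [c])"
        using eq(1) p(1) q(1) \<open>a = c\<close> by (cases p'; cases q') auto
      ultimately show ?thesis using IH2[OF p(3) q(3)] p(1) q(1) by simp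
    qed
  qed
  show ?case using 1 2 by blast
qed

lemma nodup_imp_good:
  assumes "simple_graph G" and "nodup own es" and "set es = edges G"
  shows "\<exists>\<phi>. good_edge_labeling G \<phi>"
proof -
  have p: "pairs (set es)" using assms(1,3) unfolding simple_graph_def pairs_def by metis
  have d: "distinct es" using nodup_distinct[OF assms(2) p] by auto
  \<comment> \<open>The label of an edge is the time of its call.\<close>
  define \<phi> where "\<phi> e = real (the_elem {i. i < length es \<and> es ! i = e})" for e
  have "\<phi> (es ! i) = real i" if "i < length es" for i
  proof -
    have "{j. j < length es \<and> es ! j = es ! i} = {i}"
      using d that by (auto simp: nth_eq_iff_index_eq)
    then show ?thesis by (simp add: \<phi>_def)
  qed
  then have "map \<phi> es = map real [0..<length es]"
    by (intro nth_equalityI) auto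
  then have "sorted_wrt (<) (map \<phi> es)" by (simp add: sorted_wrt_iff_nth_less)
  from nondecreasing_unique[OF assms(2) p this] have u: "x = y"
    if "x \<noteq> []" "distinct x" "set (walk_edges x) \<subseteq> edges G" "nondecreasing_along \<phi> x"
       "y \<noteq> []" "distinct y" "set (walk_edges y) \<subseteq> edges G" "nondecreasing_along \<phi> y"
       "hd x = hd y" "last x = last y" for x y
    using that unfolding assms(3) by simp
  have "good_edge_labeling G \<phi>"
    unfolding good_edge_labeling_def path_between_def path_def
    by (intro ballI allI impI) (rule u, simp_all)
  then show "\<exists>\<phi>. good_edge_labeling G \<phi>" by (rule exI[where x = \<phi>])
qed

text \<open>Edges are called by increasing label, ties in any order. Every item of knowledge is
  realized by a nondecreasing path over earlier edges, so callers \<open>a\<close>, \<open>b\<close>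
  with a common item \<open>u\<close> would yield two nondecreasing paths from \<open>u\<close> to
  \<open>b\<close>, only one of them through the new edge.\<close>

lemma good_imp_nodup:
  assumes "simple_graph G" and "good_edge_labeling G \<phi>"
  shows "\<exists>es. nodup own es \<and> set es = edges G"
proof -
  have "e \<in> Pow (vertices G)" if "e \<in> edges G" for e
    using bspec[OF conjunct2[OF assms(1)[unfolded simple_graph_def]] that] by auto
  then have "edges G \<subseteq> Pow (vertices G)" by (rule subsetI)
  moreover have "finite (Pow (vertices G))" using assms(1) by (simp add: simple_graph_def)
  ultimately have "finite (edges G)" by (rule finite_subset)
  then obtain es0 where es0: "set es0 = edges G" "distinct es0" using finite_distinct_list by blast
  define es where "es = sort_key \<phi> es0"
  have es: "set es = edges G" "distinct es" "sorted (map \<phi> es)" using es0 by (auto simp: es_def)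
  let ?P = "\<lambda>es u v p. path_between G u v p \<and> nondecreasing_along \<phi> p \<and> set (walk_edges p) \<subseteq> set es"
  have uniq: "p = q" if "?P fs u v p" "?P gs u v q" for fs gs u v p q
  proof -
    have "u \<in> vertices G" "v \<in> vertices G"
      using that(1) hd_in_set[of p] last_in_set[of p] by (auto simp: path_between_def path_def)
    then show ?thesis using assms(2) that unfolding good_edge_labeling_def by blast
  qed
  have "nodup own fs \<and> (\<forall>u. \<forall>v\<in>vertices G. u \<in> calls own fs v \<longrightarrow> (\<exists>p. ?P fs u v p))"
    if "es = fs @ gs" for fs gs
    using that
  proof (induction fs arbitrary: gs rule: rev_induct)
    case Nil
    have "?P [] v v [v]" if "v \<in> vertices G" for v
      using that by (auto simp: path_between_def path_def nondecreasing_along_def)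
    then show ?case by force
  next
    case (snoc e fs)
    let ?A = "calls own fs"
    have IH: "nodup own fs" "\<And>u v. v \<in> vertices G \<Longrightarrow> u \<in> ?A v \<Longrightarrow> \<exists>p. ?P fs u v p"
      using snoc.IH[of "e # gs"] snoc.prems by auto
    have e: "e \<in> edges G" using es(1) snoc.prems by auto
    then obtain a b where ab: "e = {a, b}" "a \<noteq> b" "a \<in> vertices G" "b \<in> vertices G"
      using assms(1) by (auto simp: simple_graph_def)
    have enew: "e \<notin> set fs" using es(2) snoc.prems by auto
    have emax: "\<phi> f \<le> \<phi> e" if "f \<in> set fs" for f
      using es(3) snoc.prems that by (auto simp: sorted_append)
    have ext: "?P (fs @ [e]) u d (p @ [d]) \<and> {c, d} \<in> set (walk_edges (p @ [d]))"
      if p: "?P fs u c p" and cd: "e = {c, d}" "c \<noteq> d" "d \<in> vertices G" for u c d p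
    proof -
      have pne: "p \<noteq> []" and lp: "last p = c" using p by (auto simp: path_between_def path_def)
      then obtain p' where p': "p = p' @ [c]" by (metis append_butlast_last_id)
      have we: "walk_edges (p @ [d]) = walk_edges p @ [{c, d}]"
        unfolding p' using walk_edges_snoc[of p' c d] by simp
      \<comment> \<open>If \<open>d\<close> were on \<open>p\<close>, the part of \<open>p\<close>
        from \<open>d\<close> to \<open>c\<close> and the single edge would be two nondecreasing
        paths with the same ends. They would coincide, and \<open>e\<close> would have been called
        before.\<close>
      have "d \<notin> set p"
      proof
        assume "d \<in> set p"
        then obtain xs ys where xy: "p = xs @ d # ys" by (auto dest: split_list)
        have "ys \<noteq> []" using xy lp cd(2) by auto
        then obtain f zs where ys: "ys = f # zs" by (cases ys) auto
        have w: "walk_edges p = walk_edges (xs @ [d]) @ walk_edges (d # ys)"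
          unfolding xy ys walk_edges_append[of xs d f zs] by simp
        have "?P fs d c (d # ys)"
          using p w xy ys unfolding path_between_def path_def nondecreasing_along_def
          by (auto simp: sorted_append)
        moreover have "?P [e] d c [d, c]"
          using cd ab e by (auto simp: path_between_def path_def nondecreasing_along_def insert_commute)
        ultimately have "d # ys = [d, c]" by (rule uniq)
        then have "{c, d} \<in> set fs" using w p by (auto simp: insert_commute)
        then show False using enew cd by simp
      qed
      then show ?thesis
        using p cd e emax we pne unfolding path_between_def path_def nondecreasing_along_def
        by (auto simp: sorted_append)
    qed
    have dj: "?A a \<inter> ?A b = {}"
    proof (rule ccontr)
      assume "?A a \<inter> ?A b \<noteq> {}"
      then obtain u where "u \<in> ?A a" "u \<in> ?A b" by blast
      then obtain p q where pq: "?P fs u a p" "?P fs u b q" using IH(2) ab by meson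
      note x = ext[OF pq(1) ab(1,2,4)]
      have "p @ [b] = q" using x pq(2) uniq by blast
      then show False using x pq(2) enew ab by auto
    qed
    have "\<exists>p. ?P (fs @ [e]) u v p" if v: "v \<in> vertices G" and u: "u \<in> calls own (fs @ [e]) v" for u v
    proof (cases "u \<in> ?A v")
      case True
      then obtain p where "?P fs u v p" using IH(2) v by blast
      then have "?P (fs @ [e]) u v p" by auto
      then show ?thesis ..
    next
      case False
      then consider "v = b" "u \<in> ?A a" | "v = a" "u \<in> ?A b"
        using u ab by (auto simp: call_def split: if_splits)
      then show ?thesis
      proof cases
        case 1
        then obtain p where "?P fs u a p" using IH(2) ab by blast
        from ext[OF this ab(1,2,4)] show ?thesis using 1 by blast
      next
        case 2
        then obtain p where p: "?P fs u b p" using IH(2) ab by blast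
        have "e = {b, a}" using ab by auto
        from ext[OF p this] show ?thesis using 2 ab by blast
      qed
    qed
    moreover have "nodup own (fs @ [e])"
      using IH(1) dj ab by (auto simp: nodup_append)
    ultimately show ?case by blast
  qed
  from this[of es "[]"] show ?thesis using es by auto
qed

section \<open>Extending a labeling\<close>

text \<open>Each edge has an end in \<open>P\<close> and each vertex of \<open>P\<close> lies on one
  edge only, so the edges form stars with leaves in \<open>P\<close>. A leaf still has its initial
  knowledge when it calls, and the center has gained only that of earlier leaves. The order of the
  calls is therefore irrelevant.\<close>

lemma nodup_stars:
  assumes "\<And>e. e \<in> set ms \<Longrightarrow> \<exists>w h. e = {w, h} \<and> w \<noteq> h \<and> w \<in> P"
    and "\<And>e e' w. e \<in> set ms \<Longrightarrow> e' \<in> set ms \<Longrightarrow> w \<in> P \<Longrightarrow> w \<in> e \<Longrightarrow> w \<in> e' \<Longrightarrow> e = e'"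
    and "\<And>u v. {u, v} \<in> set ms \<Longrightarrow> u \<noteq> v \<Longrightarrow> A u \<inter> A v = {}"
    and "\<And>h u v. u \<noteq> v \<Longrightarrow> u \<in> P \<Longrightarrow> v \<in> P \<Longrightarrow> {u, h} \<in> set ms \<Longrightarrow> {v, h} \<in> set ms \<Longrightarrow> A u \<inter> A v = {}"
    and "distinct ms"
  shows "nodup A ms"
  using assms
proof (induction ms arbitrary: A)
  case (Cons e ms)
  obtain w h where e: "e = {w, h}" "w \<noteq> h" "w \<in> P" using Cons.prems(1)[of e] by auto
  have wnot: "w \<notin> f" if "f \<in> set ms" for f
    using Cons.prems(2)[of e f w] Cons.prems(5) e that by auto
  have same: "call A e v = A v" if "v \<in> f" "f \<in> set ms" "v \<in> P" for v f
    using Cons.prems(2)[of e f v] Cons.prems(5) that by (auto simp: call_def)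
  have "nodup (call A e) ms"
  proof (rule Cons.IH)
    fix u v assume uv: "{u, v} \<in> set ms" "u \<noteq> v"
    \<comment> \<open>The leaf \<open>x\<close> is unchanged. Its partner changes only if it is the
      center \<open>h\<close>, which has gained what the leaf \<open>w\<close> of the same star
      knew.\<close>
    have *: "call A e x \<inter> call A e y = {}" if xy: "{x, y} \<in> set ms" "x \<noteq> y" "x \<in> P" for x y
    proof -
      have x: "call A e x = A x" using same[of x] xy by blast
      have "A x \<inter> A y = {}" using Cons.prems(3)[of x y] xy by simp
      moreover have "A x \<inter> A w = {}" if "y = h"
        using Cons.prems(4)[of x w h] xy that e wnot by (auto simp: insert_commute)
      moreover have "y \<noteq> w" using wnot xy by blast
      ultimately show ?thesis using x e by (auto simp: call_def)
    qed
    obtain a b where "{u, v} = {a, b}" "a \<in> P" using Cons.prems(1)[of "{u, v}"] uv by auto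
    then have "u \<in> P \<or> v \<in> P" by (auto simp: doubleton_eq_iff)
    then show "call A e u \<inter> call A e v = {}"
      using *[of u v] *[of v u] uv by (metis Int_commute insert_commute)
  next
    fix h' u v assume *: "u \<noteq> v" "u \<in> P" "v \<in> P" "{u, h'} \<in> set ms" "{v, h'} \<in> set ms"
    have "call A e u = A u" "call A e v = A v" using same * by blast+
    then show "call A e u \<inter> call A e v = {}" using Cons.prems(4)[of u v h'] * by auto
  qed (use Cons.prems in auto)
  moreover have "A u \<inter> A v = {}" if "u \<in> e" "v \<in> e" "u \<noteq> v" for u v
    using Cons.prems(3)[of u v] Cons.prems(3)[of v u] that e by (auto simp: insert_commute)
  ultimately show ?case by auto
qed auto

text \<open>All that has been collected sits at the current vertex, the next one is still fresh, and
  the vertices left behind never call again.\<close>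

lemma nodup_walk:
  assumes "distinct q" and "\<And>u v. u \<in> set q \<Longrightarrow> v \<in> set q \<Longrightarrow> u \<noteq> v \<Longrightarrow> A u \<inter> A v = {}"
  shows "nodup A (walk_edges q)"
  using assms
proof (induction q arbitrary: A rule: walk_edges.induct)
  case (1 a b r)
  have "nodup (call A {a, b}) (walk_edges (b # r))"
  proof (rule "1.IH")
    fix u v assume uv: "u \<in> set (b # r)" "v \<in> set (b # r)" "u \<noteq> v"
    have *: "A a \<inter> A x = {}" if "x \<in> set (b # r)" for x using "1.prems" that by auto
    have "call A {a, b} x = A x" if "x \<in> set (b # r)" "x \<noteq> b" for x
      using that "1.prems"(1) by (auto simp: call_def)
    moreover have "call A {a, b} b = A a \<union> A b" by (auto simp: call_def)
    moreover have "A u \<inter> A v = {}" using "1.prems"(2)[of u v] uv by simp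
    ultimately show "call A {a, b} u \<inter> call A {a, b} v = {}"
      using *[OF uv(1)] *[OF uv(2)] uv by (cases "u = b"; cases "v = b") auto
  qed (use "1.prems" in auto)
  moreover have "A a \<inter> A b = {}" using "1.prems" by auto
  ultimately show ?case by (auto simp: insert_commute)
qed auto

lemma calls_walk:
  assumes "v \<in> set q" and "distinct q"
  shows "calls A (walk_edges q) v \<subseteq> (\<Union>u\<in>set q. A u)"
    and "v \<in> set (butlast (butlast q)) \<Longrightarrow> calls A (walk_edges q) v \<subseteq> (\<Union>u\<in>set (butlast q). A u)"
proof -
  show "calls A (walk_edges q) v \<subseteq> (\<Union>u\<in>set q. A u)"
    by (rule calls_subset[where K = "set q"], rule disjI1, erule walk_edges_subset) (use assms in auto)
  assume v: "v \<in> set (butlast (butlast q))"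
  then obtain r a b where q: "q = r @ [a, b]"
    by (metis append_butlast_last_id append_assoc append_Cons append_Nil butlast.simps(1) empty_iff empty_set)
  have "calls A (walk_edges q) v = calls A (walk_edges (r @ [a])) v"
    using v assms(2) unfolding q walk_edges_snoc by (auto simp: call_def butlast_append)
  also have "\<dots> \<subseteq> (\<Union>u\<in>set (r @ [a]). A u)"
    by (rule calls_subset[where K = "set (r @ [a])"], rule disjI1, erule walk_edges_subset)
      (use v q in \<open>auto simp: butlast_append\<close>)
  finally show "calls A (walk_edges q) v \<subseteq> (\<Union>u\<in>set (butlast q). A u)"
    unfolding q by (simp add: butlast_append)
qed

section \<open>Degrees, short cycles and the use of criticality\<close>

locale fin_graph =
  fixes G :: "'a sgraph"
  assumes simple: "simple_graph G"
begin

abbreviation adj :: "'a \<Rightarrow> 'a \<Rightarrow> bool" where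
  "adj u v \<equiv> {u, v} \<in> edges G"

lemma adj_sym: "adj u v \<Longrightarrow> adj v u"
  by (simp add: insert_commute)

lemma adjD: assumes "adj u v" shows "u \<noteq> v" "u \<in> vertices G" "v \<in> vertices G"
proof -
  obtain a b where "{u, v} = {a, b}" "a \<noteq> b" "a \<in> vertices G" "b \<in> vertices G"
    using bspec[OF conjunct2[OF simple[unfolded simple_graph_def]] assms] by blast
  then show "u \<noteq> v" "u \<in> vertices G" "v \<in> vertices G" by (auto simp: doubleton_eq_iff)
qed

lemma edgeE:
  assumes "e \<in> edges G"
  obtains u v where "e = {u, v}" "adj u v" "u \<noteq> v" "u \<in> vertices G" "v \<in> vertices G"
  using bspec[OF conjunct2[OF simple[unfolded simple_graph_def]] assms] assms by blast

lemma finite_vertices: "finite (vertices G)"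
  using simple by (simp add: simple_graph_def)

lemma finite_edges: "finite (edges G)"
proof (rule finite_subset)
  show "edges G \<subseteq> Pow (vertices G)" by (rule subsetI, erule edgeE) auto
qed (simp add: finite_vertices)

lemma finite_adj: "finite {u. adj v u}"
  by (rule finite_subset[OF _ finite_vertices]) (auto dest: adjD)

lemma degree_card: "degree G v = card {u. adj v u}"
proof -
  have "{e \<in> edges G. v \<in> e} = (\<lambda>u. {v, u}) ` {u. adj v u}"
  proof (intro equalityI subsetI)
    fix e assume "e \<in> {e \<in> edges G. v \<in> e}"
    then have e: "e \<in> edges G" "v \<in> e" by auto
    then obtain a b where "e = {a, b}" "adj a b" by (auto elim: edgeE)
    then show "e \<in> (\<lambda>u. {v, u}) ` {u. adj v u}" using e by (auto simp: insert_commute)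
  qed auto
  moreover have "inj_on (\<lambda>u. {v, u}) {u. adj v u}"
    by (auto simp: inj_on_def doubleton_eq_iff)
  ultimately show ?thesis by (simp add: degree_def card_image)
qed

lemma card_nbrs: "\<forall>u\<in>S. adj v u \<Longrightarrow> card S \<le> degree G v"
  unfolding degree_card by (intro card_mono finite_adj) auto

lemma deg_ge2: "adj v a \<Longrightarrow> adj v b \<Longrightarrow> a \<noteq> b \<Longrightarrow> 2 \<le> degree G v"
  using card_nbrs[of "{a, b}" v] by simp

lemma deg2_unique:
  assumes "degree G v = 2" "adj v a" "adj v c" "adj v d" "c \<noteq> a" "d \<noteq> a"
  shows "c = d"
proof (rule ccontr)
  assume "c \<noteq> d"
  then have "card {a, c, d} = 3" using assms by simp
  then show False using card_nbrs[of "{a, c, d}" v] assms by simp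
qed

lemma deg3_unique:
  assumes "degree G v = 3" "adj v a" "adj v b" "a \<noteq> b" "adj v c" "adj v d" "c \<notin> {a, b}" "d \<notin> {a, b}"
  shows "c = d"
proof (rule ccontr)
  assume "c \<noteq> d"
  then have "card {a, b, c, d} = 4" using assms by (auto simp: card_insert_if)
  then show False using card_nbrs[of "{a, b, c, d}" v] assms by simp
qed

lemma walk_edges_successively: "set (walk_edges p) \<subseteq> edges G \<longleftrightarrow> successively adj p"
  by (induction p rule: walk_edges.induct) auto

lemma set_subset_vertices: "successively adj p \<Longrightarrow> 2 \<le> length p \<Longrightarrow> set p \<subseteq> vertices G"
proof (induction p rule: walk_edges.induct)
  case (1 x y xs)
  then show ?case using adjD[of x y] by (cases xs) auto
qed auto

lemma successively_rev_adj: "successively adj (rev p) = successively adj p"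
  by (simp add: insert_commute)

end

locale girth5_graph = fin_graph +
  assumes girth: "girth G \<ge> 5"
begin

lemma cycle_length: "cycle G c \<Longrightarrow> 5 \<le> length c"
  using girth INF_lower[of c "{c. cycle G c}" "\<lambda>c. enat (length c)"]
  unfolding girth_def by (metis enat_ord_simps(1) mem_Collect_eq numeral_eq_enat order_trans)

lemma no_triangle: assumes "adj a b" "adj b c" "adj c a" shows False
proof -
  have "cycle G [a, b, c]"
    using assms adjD[OF assms(1)] adjD[OF assms(2)] adjD[OF assms(3)]
    by (auto simp: cycle_def cycle_edges_def)
  from cycle_length[OF this] show False by simp
qed

lemma no_square: assumes "adj a b" "adj b c" "adj c d" "adj d a" "a \<noteq> c" "b \<noteq> d" shows False
proof -
  have "cycle G [a, b, c, d]"
    using assms adjD[OF assms(1)] adjD[OF assms(2)] adjD[OF assms(3)] adjD[OF assms(4)]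
    by (auto simp: cycle_def cycle_edges_def)
  from cycle_length[OF this] show False by simp
qed

end

locale critical_graph = girth5_graph +
  assumes critical: "critical G"
begin

text \<open>Before the final calls \<open>ms\<close>, vertices of \<open>X\<close> know only
  vertices of \<open>X\<close>, and the others only vertices outside. So an edge leaving
  \<open>X\<close> never repeats anything by itself; trouble arises only between two ends in
  \<open>X\<close>, which is what \<open>chord\<close> and \<open>link\<close> exclude. By
  \<open>deg\<close> the edges \<open>ms\<close> are stars with leaves in \<open>X\<close>.\<close>

lemma extension:
  assumes XV: "X \<subseteq> vertices G" and Xne: "X \<noteq> {}"
    and nd: "nodup own es" and esE: "set es \<subseteq> edges G" and esX: "\<Union>(set es) \<subseteq> X"
    and deg: "\<And>v c d. v \<in> X \<Longrightarrow> adj v c \<Longrightarrow> adj v d \<Longrightarrow> {v, c} \<notin> set es \<Longrightarrow> {v, d} \<notin> set es \<Longrightarrow> c = d"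
    and chord: "\<And>u v. u \<in> X \<Longrightarrow> v \<in> X \<Longrightarrow> adj u v \<Longrightarrow> {u, v} \<notin> set es \<Longrightarrow>
      calls own es u \<inter> calls own es v = {}"
    and link: "\<And>u v w. u \<in> X \<Longrightarrow> v \<in> X \<Longrightarrow> u \<noteq> v \<Longrightarrow> w \<notin> X \<Longrightarrow> adj u w \<Longrightarrow> adj v w \<Longrightarrow>
      calls own es u \<inter> calls own es v = {}"
  shows False
proof -
  define R where "R = vertices G - X"
  let ?H = "induce G R"
  have sH: "simple_graph ?H"
    unfolding simple_graph_def
  proof (intro conjI ballI)
    fix e assume e: "e \<in> edges ?H"
    then have e: "e \<in> edges G" "e \<subseteq> R" by (simp_all add: induce_def)
    obtain u v where uv: "e = {u, v}" "u \<noteq> v" "u \<in> vertices G" "v \<in> vertices G"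
      using e(1) by (rule edgeE)
    then have "u \<in> vertices ?H" "v \<in> vertices ?H" using e(2) by (simp_all add: induce_def)
    then show "\<exists>u v. e = {u, v} \<and> u \<noteq> v \<and> u \<in> vertices ?H \<and> v \<in> vertices ?H"
      using uv(1,2) by metis
  qed (use finite_vertices in \<open>simp add: induce_def\<close>)
  have "vertices ?H \<noteq> vertices G" using XV Xne by (auto simp: induce_def R_def)
  then have "?H \<noteq> G" by metis
  moreover have "vertices ?H \<subseteq> vertices G" "edges ?H \<subseteq> edges G" by (auto simp: induce_def)
  ultimately have "proper_subgraph ?H G"
    using sH by (simp add: proper_subgraph_def subgraph_def)
  then obtain fs where fs: "nodup own fs" "set fs = edges ?H"
    using critical good_imp_nodup[OF sH] unfolding critical_def by blast
  have fsR: "\<Union>(set fs) \<subseteq> R" unfolding fs(2) by (auto simp: induce_def)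
  obtain ms where ms: "set ms = edges G - set es - set fs" "distinct ms"
    using finite_distinct_list[of "edges G - set es - set fs"] finite_edges by auto
  let ?A = "calls own es" and ?B = "calls own (es @ fs)"
  have BX: "?B v = ?A v" if "v \<in> X" for v
    using calls_untouched[of v fs "?A"] fsR that by (auto simp: R_def)
  have AX: "?A v \<subseteq> X" if "v \<in> X" for v
    by (rule calls_subset[where K = X]) (use esX that in auto)
  have AR: "?A v = {v}" if "v \<in> R" for v
    using calls_untouched[of v es own] esX that by (auto simp: R_def)
  have BR: "?B v \<subseteq> R" if "v \<in> R" for v
  proof -
    have "calls ?A fs v \<subseteq> R"
      by (rule calls_subset[where K = R]) (use fsR that AR in auto)
    then show ?thesis by simp
  qed
  have nd2: "nodup own (es @ fs)"
    unfolding nodup_append using nd nodup_cong[of fs "?A" own] AR fsR fs(1) by auto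
  have inX: "\<exists>w h. e = {w, h} \<and> w \<noteq> h \<and> w \<in> X" if e: "e \<in> set ms" for e
  proof -
    have e': "e \<in> edges G" "e \<notin> set fs" using e ms by auto
    obtain u v where uv: "e = {u, v}" "u \<noteq> v" "u \<in> vertices G" "v \<in> vertices G"
      using e'(1) by (rule edgeE)
    have "u \<in> X \<or> v \<in> X" using e' fs(2) uv by (auto simp: induce_def R_def)
    then show ?thesis using uv by blast
  qed
  have "nodup ?B ms"
  proof (rule nodup_stars[where P = X])
    fix e e' w assume a: "e \<in> set ms" "e' \<in> set ms" "w \<in> X" "w \<in> e" "w \<in> e'"
    then obtain c d where "e = {w, c}" "e' = {w, d}"
      using inX by (metis insert_commute insertE singletonD)
    then show "e = e'" using deg[of w c d] a ms by auto
  next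
    fix u v assume uv: "{u, v} \<in> set ms" "u \<noteq> v"
    have a: "adj u v" "{u, v} \<notin> set es" using uv ms by auto
    have *: "?B x \<inter> ?B y = {}" if "adj x y" "{x, y} \<notin> set es" "x \<in> X" for x y
    proof (cases "y \<in> X")
      case True
      then show ?thesis using chord[of x y] BX that by simp
    next
      case False
      then have "y \<in> R" using adjD that by (auto simp: R_def)
      then show ?thesis using BR[of y] BX[of x] AX[of x] that(3) by (auto simp: R_def)
    qed
    have "u \<in> X \<or> v \<in> X" using inX[OF uv(1)] by (auto simp: doubleton_eq_iff)
    then show "?B u \<inter> ?B v = {}"
      using *[of u v] *[of v u] a by (metis Int_commute insert_commute)
  next
    fix h u v assume a: "u \<noteq> v" "u \<in> X" "v \<in> X" "{u, h} \<in> set ms" "{v, h} \<in> set ms"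
    have b: "adj h u" "adj h v" "{h, u} \<notin> set es" "{h, v} \<notin> set es"
      using a(4,5) ms(1) by (auto simp: insert_commute)
    show "?B u \<inter> ?B v = {}"
    proof (cases "h \<in> X")
      case True
      then show ?thesis using deg[OF True b] a(1) by simp
    next
      case False
      then show ?thesis using link[of u v h] BX a b by (simp add: insert_commute)
    qed
  qed (use inX ms in auto)
  then have "nodup own ((es @ fs) @ ms)" using nd2 by (simp only: nodup_append simp_thms)
  moreover have "set ((es @ fs) @ ms) = edges G"
    using ms esE fs(2) by (auto simp: induce_def)
  ultimately show False
    using nodup_imp_good[OF simple] critical unfolding critical_def by blast
qed

end

section \<open>Paths of 3-vertices\<close>

lemma mem_walk_edges: "{a, b} \<in> set (walk_edges (P @ a # b # Q))"
  by (simp add: walk_edges_append)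

lemma walk_edges_rev: "set (walk_edges (rev p)) = set (walk_edges p)"
proof (induction p rule: walk_edges.induct)
  case (1 x y xs)
  have "walk_edges (rev (x # y # xs)) = walk_edges (rev (y # xs)) @ [{y, x}]"
    using walk_edges_snoc[of "rev xs" y x] by simp
  then show ?case using 1 by (auto simp: insert_commute)
qed auto

lemma split_two:
  assumes "u \<in> set xs" "v \<in> set xs" "u \<noteq> v"
  obtains p m q where "xs = p @ u # m @ v # q" | p m q where "xs = p @ v # m @ u # q"
proof -
  obtain p r where pr: "xs = p @ u # r" using assms(1) by (auto dest: split_list)
  show thesis
  proof (cases "v \<in> set r")
    case True
    then show ?thesis using that(1) pr by (auto dest: split_list)
  next
    case False
    then have "v \<in> set p" using pr assms by auto
    then obtain a b where "p = a @ v # b" by (auto dest: split_list)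
    then show ?thesis using that(2)[of a b r] pr by simp
  qed
qed

context fin_graph begin

text \<open>\<open>m\<close> is the length of some path with first edge \<open>z v\<close> to a
  vertex of degree at least 4. Bounding all such \<open>m\<close> from below replaces a distance
  that may be infinite; the fixed first edge matches the tip of a sail.\<close>

definition reach4 :: "'a \<Rightarrow> 'a \<Rightarrow> nat \<Rightarrow> bool" where
  "reach4 z v m \<longleftrightarrow> (\<exists>l. distinct l \<and> successively adj l \<and> 1 \<le> m \<and> length l = Suc m \<and>
     hd l = z \<and> hd (tl l) = v \<and> 4 \<le> degree G (last l))"

text \<open>Closed walks \<open>z = z'\<close> are allowed; they occur when two sails start in the same 2-vertex.\<close>

definition walk3 :: "'a \<Rightarrow> 'a list \<Rightarrow> 'a \<Rightarrow> bool" where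
  "walk3 z xs z' \<longleftrightarrow> degree G z = 2 \<and> degree G z' = 2 \<and> (\<forall>v\<in>set xs. degree G v = 3) \<and>
     distinct xs \<and> successively adj (z # xs @ [z']) \<and> (z = z' \<longrightarrow> hd xs \<noteq> last xs)"

text \<open>The path has fewer edges than the distances from its two ends, along its first and last edge,
  to the nearest vertices of degree at least 4 together.\<close>

definition near :: "'a \<Rightarrow> 'a list \<Rightarrow> 'a \<Rightarrow> bool" where
  "near z xs z' \<longleftrightarrow> (\<forall>m m'. reach4 z (hd (xs @ [z'])) m \<longrightarrow> reach4 z' (last (z # xs)) m' \<longrightarrow>
     length xs + 2 \<le> m + m')"

lemma reach4_ge1: "reach4 z v m \<Longrightarrow> 1 \<le> m"
  unfolding reach4_def by blast

lemma reach4_ge2: assumes "reach4 z v m" "degree G v < 4" shows "2 \<le> m"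
proof (rule ccontr)
  assume "\<not> 2 \<le> m"
  then have m: "m = 1" using reach4_ge1[OF assms(1)] by simp
  obtain l where l: "length l = Suc m" "hd (tl l) = v" "4 \<le> degree G (last l)"
    using assms(1) by (auto simp: reach4_def)
  then obtain a b where "l = [a, b]" using m by (auto simp: length_Suc_conv)
  then show False using l assms(2) by simp
qed

lemma walk3_rev: "walk3 z xs z' \<Longrightarrow> walk3 z' (rev xs) z"
  using successively_rev_adj[of "z # xs @ [z']"]
  by (auto simp: walk3_def hd_rev last_rev)

lemma walk3_ends: "walk3 z xs z' \<Longrightarrow> z \<notin> set xs \<and> z' \<notin> set xs"
  by (auto simp: walk3_def)

lemma walk3_closed_length: "walk3 z xs z \<Longrightarrow> 2 \<le> length xs"
  unfolding walk3_def using adjD(1)[of z z] by (cases xs rule: walk_edges.cases) auto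

lemma walk3_neighbours:
  assumes w: "walk3 z xs z'" and v: "v \<in> set xs"
  obtains a b where "a \<noteq> b" "adj v a" "adj v b" "{v, a} \<in> set (walk_edges (z # xs @ [z']))"
    "{v, b} \<in> set (walk_edges (z # xs @ [z']))"
proof -
  obtain p q where pq: "xs = p @ v # q" using v by (auto dest: split_list)
  obtain P a where P: "z # p = P @ [a]"
    using append_butlast_last_id[of "z # p"] by (metis list.distinct(1))
  obtain Q b where Q: "q @ [z'] = b # Q" by (cases q) auto
  have L: "z # xs @ [z'] = P @ a # v # b # Q" using P Q pq
    by (metis append.assoc append_Cons append_Nil)
  have T: "{v, a} \<in> set (walk_edges (z # xs @ [z']))" "{v, b} \<in> set (walk_edges (z # xs @ [z']))"
    using mem_walk_edges[of a v P "b # Q"] mem_walk_edges[of v b "P @ [a]" Q] L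
    by (simp_all add: insert_commute)
  have "adj v a" "adj v b"
    using T w unfolding walk3_def walk_edges_successively[symmetric] by auto
  \<comment> \<open>The two neighbours could coincide only for a single inner vertex between equal
    ends, which the last clause of \<open>walk3\<close> excludes.\<close>
  moreover have "a \<noteq> b"
  proof
    assume "a = b"
    have a: "a = z \<or> a \<in> set p" using P by (metis last_ConsL last_snoc last_ConsR last_in_set)
    have b: "b = z' \<or> b \<in> set q" using Q by (cases q) auto
    have "distinct (p @ v # q)" "z \<notin> set xs" "z' \<notin> set xs"
      using w walk3_ends[OF w] pq by (auto simp: walk3_def)
    then have e: "a = z" "b = z'" using a b \<open>a = b\<close> pq by auto
    then have "p = []" using P \<open>z \<notin> set xs\<close> pq
      by (metis append_is_Nil_conv last_ConsR last_in_set last_snoc list.distinct(1) Un_iff set_append)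
    moreover have "q = []" using Q e \<open>z' \<notin> set xs\<close> pq by (cases q) auto
    ultimately show False using w e \<open>a = b\<close> pq by (auto simp: walk3_def)
  qed
  ultimately show thesis using that T by blast
qed

text \<open>This is the hypothesis \<open>deg\<close> of \<open>extension\<close>: a 3-vertex has
  two edges on the walk, and an end of degree 2 has at least one.\<close>

lemma walk3_deg:
  assumes w: "walk3 z xs z'" and v: "v \<in> set (z # xs @ [z'])" and "adj v c" "adj v d"
    and "{v, c} \<notin> set (walk_edges (z # xs @ [z']))" "{v, d} \<notin> set (walk_edges (z # xs @ [z']))"
  shows "c = d"
proof (cases "v \<in> set xs")
  case True
  then obtain a b where "a \<noteq> b" "adj v a" "adj v b" "{v, a} \<in> set (walk_edges (z # xs @ [z']))"
    "{v, b} \<in> set (walk_edges (z # xs @ [z']))" using walk3_neighbours[OF w] by metis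
  then show ?thesis using deg3_unique[of v a b c d] assms True w by (auto simp: walk3_def)
next
  case False
  have "\<exists>a. {v, a} \<in> set (walk_edges (z # xs @ [z']))"
  proof (cases "v = z")
    case True
    then show ?thesis by (cases xs) auto
  next
    case v': False
    obtain P a where "z # xs = P @ [a]"
      using append_butlast_last_id[of "z # xs"] by (metis list.distinct(1))
    then have L: "z # xs @ [z'] = P @ [a, z']" by (metis append.assoc append_Cons append_Nil)
    have "{a, z'} \<in> set (walk_edges (z # xs @ [z']))" unfolding L by (rule mem_walk_edges)
    then show ?thesis using v v' False by (auto simp: insert_commute)
  qed
  then obtain a where a: "{v, a} \<in> set (walk_edges (z # xs @ [z']))" ..
  moreover have "adj v a" using a w unfolding walk3_def walk_edges_successively[symmetric] by auto
  moreover have "degree G v = 2" using w v False by (auto simp: walk3_def)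
  ultimately show ?thesis using deg2_unique[of v a c d] assms by auto
qed

end

section \<open>Induced closed and open walks of 3-vertices\<close>

context critical_graph begin

text \<open>Both edges of the 2-vertex \<open>z\<close> lie on the cycle and no other two vertices
  are linked, so any order of the cycle edges without repetition contradicts
  \<open>extension\<close>.\<close>

lemma no_closed_walk3:
  assumes w: "walk3 z xs z"
    and chord: "\<And>u v. u \<in> set xs \<Longrightarrow> v \<in> set xs \<Longrightarrow> adj u v \<Longrightarrow> {u, v} \<in> set (walk_edges (z # xs @ [z]))"
    and link: "\<And>u v w. u \<in> set xs \<Longrightarrow> v \<in> set xs \<Longrightarrow> u \<noteq> v \<Longrightarrow> w \<notin> set (z # xs) \<Longrightarrow>
      adj u w \<Longrightarrow> adj v w \<Longrightarrow> False"
  shows False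
proof -
  let ?L = "z # xs @ [z]"
  have zx: "z \<notin> set xs" using walk3_ends[OF w] by simp
  have d: "distinct (z # xs)" using zx w by (simp add: walk3_def)
  have sub: "set (walk_edges ?L) \<subseteq> edges G" "set ?L \<subseteq> vertices G"
    using w set_subset_vertices[of ?L] unfolding walk3_def walk_edges_successively by auto
  have "cycle G (z # xs)"
    using d sub walk3_closed_length[OF w] unfolding cycle_def cycle_edges_def by auto
  then have len: "5 \<le> length (z # xs)" by (rule cycle_length)
  then obtain a b c r where xs: "xs = a # b # c # r" "r \<noteq> []"
    by (cases xs rule: remdups_adj.cases; cases "tl (tl xs)"; cases "tl (tl (tl xs))") auto
  define e where "e = last (c # r)"
  have ex: "e \<in> set r" using xs by (simp add: e_def)
  \<comment> \<open>Calling straight round the cycle would repeat information in the closing call.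
    Here \<open>c\<close> calls \<open>b\<close> before \<open>b\<close> calls \<open>a\<close>, so
    the names \<open>z\<close> and \<open>a\<close> never get past \<open>b\<close>, and the last
    vertex \<open>e\<close> can safely call \<open>z\<close>.\<close>
  let ?E0 = "[{z, a}, {b, c}, {a, b}]"
  define es where "es = ?E0 @ walk_edges (c # r) @ [{e, z}]"
  have setes: "set es = set (walk_edges ?L)"
  proof -
    obtain r' where r': "c # r = r' @ [e]" unfolding e_def by (metis append_butlast_last_id list.distinct(1))
    then have "walk_edges (c # r @ [z]) = walk_edges (c # r) @ [{e, z}]"
      using walk_edges_snoc[of r' e z] by (metis append.assoc append_Cons append_Nil)
    then show ?thesis unfolding es_def xs by auto
  qed
  let ?S = "calls own ?E0"
  have S: "?S z = {z, a}" "?S c = {b, c}" "\<And>v. v \<in> set r \<Longrightarrow> ?S v = {v}"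
    using d xs by (auto simp: call_def)
  have 1: "nodup own ?E0" using d xs by (auto simp: call_def)
  have 2: "nodup ?S (walk_edges (c # r))"
  proof (rule nodup_walk)
    fix u v assume uv: "u \<in> set (c # r)" "v \<in> set (c # r)" "u \<noteq> v"
    have "?S x \<subseteq> (if x = c then {b, c} else {x})" if "x \<in> set (c # r)" for x using that S by auto
    then have "?S u \<subseteq> (if u = c then {b, c} else {u})" "?S v \<subseteq> (if v = c then {b, c} else {v})"
      using uv by blast+
    then show "?S u \<inter> ?S v = {}" using uv d xs(1) by (auto split: if_splits)
  qed (use d xs in auto)
  let ?T = "calls ?S (walk_edges (c # r))"
  have "?T e \<subseteq> (\<Union>u\<in>set (c # r). ?S u)"
    by (rule calls_walk(1)) (use d xs ex in auto)
  also have "\<dots> \<subseteq> {b, c} \<union> set r" using S by auto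
  finally have Te: "?T e \<subseteq> {b, c} \<union> set r" .
  have Tz: "?T z = {z, a}"
    using calls_untouched[of z "walk_edges (c # r)" ?S] S(1) walk_edges_subset[of _ "c # r"] zx xs by fastforce
  have "?T e \<inter> ?T z = {}" using Te Tz d xs by auto
  then have 3: "nodup ?T [{e, z}]" by auto
  have nd: "nodup own es" unfolding es_def nodup_append using 1 2 3 by simp
  have nz: "{z, x} \<in> set es" if "adj z x" for x
  proof (rule ccontr)
    assume "{z, x} \<notin> set es"
    moreover have T: "{z, a} \<in> set es" "{z, e} \<in> set es" by (auto simp: es_def insert_commute)
    moreover have "adj z a" "adj z e" using T sub setes by auto
    moreover have "a \<noteq> e" using d xs ex by auto
    moreover have "degree G z = 2" using w by (simp add: walk3_def)
    ultimately show False using deg2_unique[of z a e x] that by auto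
  qed
  have XL: "set (z # xs) = set ?L" by auto
  show False
  proof (rule extension[of "set (z # xs)" es])
    show "\<Union>(set es) \<subseteq> set (z # xs)"
      unfolding setes using walk_edges_subset[of _ ?L] XL by blast
    show "x = y" if "v \<in> set (z # xs)" "adj v x" "adj v y" "{v, x} \<notin> set es" "{v, y} \<notin> set es" for v x y
      using walk3_deg[OF w, of v x y] that setes XL by auto
    show "calls own es u \<inter> calls own es v = {}"
      if "u \<in> set (z # xs)" "v \<in> set (z # xs)" "adj u v" "{u, v} \<notin> set es" for u v
    proof -
      have "u \<noteq> z" "v \<noteq> z" using nz[of u] nz[of v] that by (auto simp: insert_commute)
      then show ?thesis using chord[of u v] that setes by auto
    qed
    show "calls own es u \<inter> calls own es v = {}"
      if "u \<in> set (z # xs)" "v \<in> set (z # xs)" "u \<noteq> v" "w \<notin> set (z # xs)" "adj u w" "adj v w" for u v w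
    proof -
      have "{z, w} \<notin> set es" using that(4) walk_edges_subset[of "{z, w}" ?L] XL setes by auto
      then have "u \<noteq> z" "v \<noteq> z" using nz[of w] that by auto
      then show ?thesis using link[of u v w] that by auto
    qed
  qed (use nd sub setes in auto)
qed

end

context critical_graph begin

text \<open>Only links at the ends \<open>z\<close>, \<open>z'\<close> remain, and girth 5 excludes
  them within distance 2 along the path. So each end must share nothing with the vertices at
  distance at least 3 from it to which it may be linked.\<close>

lemma no_open_walk3:
  assumes w: "walk3 z xs z'" and ne: "z \<noteq> z'"
    and chord: "\<And>u v. u \<in> set xs \<Longrightarrow> v \<in> set xs \<Longrightarrow> adj u v \<Longrightarrow> {u, v} \<in> set (walk_edges (z # xs @ [z']))"
    and link: "\<And>u v w. u \<in> set xs \<Longrightarrow> v \<in> set xs \<Longrightarrow> u \<noteq> v \<Longrightarrow> w \<notin> set (z # xs @ [z']) \<Longrightarrow>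
      adj u w \<Longrightarrow> adj v w \<Longrightarrow> False"
    and tip: "\<And>w. length xs = 3 \<Longrightarrow> w \<notin> set (z # xs @ [z']) \<Longrightarrow> adj z w \<Longrightarrow> adj (last xs) w \<Longrightarrow> False"
  shows False
proof -
  let ?L = "z # xs @ [z']"
  have d: "distinct ?L" using walk3_ends[OF w] ne w by (simp add: walk3_def)
  have sub: "set (walk_edges ?L) \<subseteq> edges G" "set ?L \<subseteq> vertices G"
    using w set_subset_vertices[of ?L] unfolding walk3_def walk_edges_successively by auto
  define rel where "rel u v \<longleftrightarrow> (adj u v \<and> {u, v} \<notin> set (walk_edges ?L)) \<or>
    (\<exists>w. w \<notin> set ?L \<and> adj u w \<and> adj v w)" for u v
  have rel_sym: "rel u v = rel v u" for u v by (auto simp: rel_def insert_commute)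
  have rel_inner: "\<not> rel u v" if "u \<in> set xs" "v \<in> set xs" "u \<noteq> v" for u v
    using chord[of u v] link[of u v] that by (auto simp: rel_def)
  have rel_edge: "\<not> rel u v" if "{u, v} \<in> set (walk_edges ?L)" for u v
    using no_triangle[of u v] that sub by (auto simp: rel_def insert_commute)
  have rel_two: "\<not> rel u v" if "{u, x} \<in> set (walk_edges ?L)" "{x, v} \<in> set (walk_edges ?L)" "u \<noteq> v" for u v x
  proof -
    have a: "adj u x" "adj x v" using that sub by auto
    have x: "x \<in> set ?L" using walk_edges_subset[OF that(1)] by blast
    show ?thesis
      unfolding rel_def using no_triangle[of u x v] no_square[of u x v] a x that(3)
      by (metis insert_commute)
  qed
  have key: False if nd: "nodup own es" and es: "set es = set (walk_edges ?L)"
    and dj: "\<And>u v. u \<in> {z, z'} \<Longrightarrow> v \<in> set ?L \<Longrightarrow> u \<noteq> v \<Longrightarrow> rel u v \<Longrightarrow>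
      calls own es u \<inter> calls own es v = {}" for es
  proof -
    have dj': "calls own es u \<inter> calls own es v = {}" if "u \<in> set ?L" "v \<in> set ?L" "u \<noteq> v" "rel u v" for u v
      using dj[of u v] dj[of v u] rel_inner[of u v] that rel_sym[of u v] by auto
    show False
    proof (rule extension[of "set ?L" es])
      show "\<Union>(set es) \<subseteq> set ?L" unfolding es using walk_edges_subset[of _ ?L] by blast
      show "x = y" if "v \<in> set ?L" "adj v x" "adj v y" "{v, x} \<notin> set es" "{v, y} \<notin> set es" for v x y
        using walk3_deg[OF w, of v x y] that es by auto
      show "calls own es u \<inter> calls own es v = {}" if "u \<in> set ?L" "v \<in> set ?L" "adj u v" "{u, v} \<notin> set es" for u v
      proof (rule dj')
        show "u \<noteq> v" using adjD[OF that(3)] by simp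
        show "rel u v" using that es by (simp add: rel_def)
      qed (use that in simp_all)
      show "calls own es u \<inter> calls own es v = {}"
        if "u \<in> set ?L" "v \<in> set ?L" "u \<noteq> v" "w \<notin> set ?L" "adj u w" "adj v w" for u v w
        using dj'[of u v] that by (auto simp: rel_def)
    qed (use nd sub es in auto)
  qed
  show False
  proof (cases "length xs < 2")
    case True
    have "nodup own (walk_edges ?L)" by (rule nodup_walk) (use d in auto)
    then show False
    proof (rule key)
      fix u v assume uv: "u \<in> {z, z'}" "v \<in> set ?L" "u \<noteq> v" "rel u v"
      consider "xs = []" | x where "xs = [x]" using True by (cases xs) auto
      then have "\<not> rel u v"
      proof cases
        case 1
        then show ?thesis using uv rel_edge[of u v] by (auto simp: insert_commute)
      next
        case 2
        then show ?thesis
          using uv rel_edge[of u v] rel_two[of z x z'] rel_two[of z' x z] by (auto simp: insert_commute)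
      qed
      then show "calls own (walk_edges ?L) u \<inter> calls own (walk_edges ?L) v = {}" using uv by simp
    qed simp
  next
    case False
    define x m y where "x = hd xs" and "m = butlast (tl xs)" and "y = last xs"
    have xs: "xs = x # m @ [y]" using False unfolding x_def m_def y_def
      by (cases xs; cases "tl xs") auto
    let ?E0 = "[{z, x}, {y, z'}]"
    let ?S = "calls own ?E0"
    have nd0: "nodup own ?E0" using d xs by (auto simp: call_def)
    have S: "?S z = {z, x}" "?S x = {z, x}" "?S y = {y, z'}" "?S z' = {y, z'}" "\<And>v. v \<in> set m \<Longrightarrow> ?S v = {v}"
      using d xs by (auto simp: call_def)
    show False
    proof (cases "m = []")
      case True
      have "nodup own (?E0 @ [{x, y}])"
        unfolding nodup_append using nd0 S d xs by (auto simp: insert_commute)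
      then show False
      proof (rule key)
        show "set (?E0 @ [{x, y}]) = set (walk_edges ?L)" using xs True by auto
        fix u v assume uv: "u \<in> {z, z'}" "v \<in> set ?L" "u \<noteq> v" "rel u v"
        have "\<not> rel z x" "\<not> rel z y" "\<not> rel z' x" "\<not> rel z' y"
          using rel_edge[of z x] rel_edge[of z' y] rel_two[of z x y] rel_two[of z' y x] d xs True
          by (auto simp: insert_commute)
        then have "{u, v} = {z, z'}" using uv xs True by auto
        then show "calls own (?E0 @ [{x, y}]) u \<inter> calls own (?E0 @ [{x, y}]) v = {}"
          using d xs uv(3) by (auto simp: call_def doubleton_eq_iff)
      qed
    next
      case m: False
      define g h where "g = hd m" and "h = last m"
      have gh: "g \<in> set m" "h \<in> set m" using m by (simp_all add: g_def h_def)
      obtain m1 where m1: "m = g # m1" using m by (cases m) (auto simp: g_def)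
      obtain m2 where m2: "m = m2 @ [h]" using m unfolding h_def by (metis append_butlast_last_id)
      \<comment> \<open>With the end edges first and their neighbours last, the names
        \<open>z\<close>, \<open>x\<close> travel on only to \<open>g\<close>, and \<open>y\<close>,
        \<open>z'\<close> only to \<open>h\<close>. For \<open>g = h\<close> the last call also
        brings \<open>z\<close>, \<open>x\<close> to \<open>y\<close>; this is the case that the
        hypothesis \<open>tip\<close> takes care of.\<close>
      define es where "es = ?E0 @ walk_edges m @ [{x, g}, {h, y}]"
      have we: "walk_edges ?L = {z, x} # {x, g} # walk_edges m @ [{h, y}, {y, z'}]"
      proof -
        have "walk_edges (m2 @ h # y # [z']) = walk_edges (m2 @ [h]) @ {h, y} # walk_edges [y, z']"
          by (rule walk_edges_append)
        then have "walk_edges (m @ [y, z']) = walk_edges m @ [{h, y}, {y, z'}]" using m2 by simp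
        then show ?thesis using xs m1 by auto
      qed
      let ?T = "calls ?S (walk_edges m)"
      have ndm: "nodup ?S (walk_edges m)" by (rule nodup_walk) (use d xs S in auto)
      have Tm: "?T v \<subseteq> set m" if "v \<in> set m" for v
      proof -
        have "?T v \<subseteq> (\<Union>u\<in>set m. ?S u)" by (rule calls_walk(1)) (use d xs that in auto)
        then show ?thesis using S by auto
      qed
      have To: "?T v = ?S v" if "v \<notin> set m" for v
        using calls_untouched[of v "walk_edges m" ?S] walk_edges_subset[of _ m] that by blast
      have nm: "z \<notin> set m" "x \<notin> set m" "y \<notin> set m" "z' \<notin> set m" "x \<noteq> y" "x \<noteq> z" "y \<noteq> z" "x \<noteq> z'" "y \<noteq> z'"
        using d xs by auto
      have T: "?T z = {z, x}" "?T x = {z, x}" "?T y = {y, z'}" "?T z' = {y, z'}"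
        using To S nm by metis+
      have "?T g \<inter> ?T x = {}" using Tm[OF gh(1)] T nm by auto
      moreover have "call ?T {x, g} h \<subseteq> {z, x} \<union> set m" using Tm gh T by (auto simp: call_def)
      moreover have "call ?T {x, g} y = {y, z'}" using T nm gh by (auto simp: call_def)
      ultimately have "nodup ?T [{x, g}, {h, y}]" using d xs by auto
      then have nd: "nodup own es" unfolding es_def nodup_append using nd0 ndm by simp
      let ?C = "calls own es"
      have C: "?C v = call (call ?T {x, g}) {h, y} v" for v by (simp add: es_def)
      have Cz: "?C z = {z, x}" "?C z' = {y, z'}"
        unfolding C using T nm gh by (auto simp: call_def)
      have "?C x = {z, x} \<union> ?T g" unfolding C using T nm gh by (auto simp: call_def)
      then have Cx: "?C x \<subseteq> {z, x} \<union> set m" using Tm[OF gh(1)] by blast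
      have Cv: "?C v \<subseteq> ?T v \<union> (if v = g then {z, x} else {}) \<union> (if v = h then ?C y else {})"
        if "v \<in> set m" for v
        unfolding C using T nm that by (auto simp: call_def)
      have "?C y = (if g = h then {z, x} else {}) \<union> ?T h \<union> {y, z'}"
        unfolding C using T nm gh by (auto simp: call_def)
      then have Cy: "?C y \<subseteq> set m \<union> {y, z'}" if "g \<noteq> h" using Tm[OF gh(2)] that by auto
      have Cm1: "?C v \<subseteq> set m \<union> {y, z'}" if "v \<in> set m" "v \<noteq> g" for v
        using Cv[OF that(1)] Tm[OF that(1)] Cy that(2) by (cases "v = h") auto
      have Cm2: "?C v \<subseteq> {z, x} \<union> set m" if "v \<in> set m" "v \<noteq> h" for v
        using Cv[OF that(1)] Tm[OF that(1)] that(2) by (cases "v = g") auto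
      have W: "{z, x} \<in> set (walk_edges ?L)" "{x, g} \<in> set (walk_edges ?L)"
        "{z', y} \<in> set (walk_edges ?L)" "{y, h} \<in> set (walk_edges ?L)"
        unfolding we by (auto simp: insert_commute)
      have nr: "\<not> rel z x" "\<not> rel z' y" using rel_edge W by blast+
      have nr2: "\<not> rel z g" "\<not> rel z' h"
        using rel_two[OF W(1,2)] rel_two[OF W(3,4)] nm gh by blast+
      have nr3: "\<not> rel z y" if "g = h"
      proof
        assume "rel z y"
        moreover have "\<not> adj z y"
        proof
          assume "adj z y"
          moreover have "adj z x" "adj x g" "adj g y" using W that sub by (auto simp: insert_commute)
          ultimately show False using no_square[of z x g y] nm gh by (auto simp: insert_commute)
        qed
        moreover have "m2 = []"
          using that m1 m2 d xs by (cases m2) auto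
        ultimately show False using tip xs m2 unfolding rel_def by auto
      qed
      show False
      proof (rule key[OF nd])
        show "set es = set (walk_edges ?L)" unfolding we es_def by auto
        fix u v assume uv: "u \<in> {z, z'}" "v \<in> set ?L" "u \<noteq> v" "rel u v"
        have v: "v \<in> {z, x, y, z'} \<or> v \<in> set m" using uv(2) xs by auto
        show "?C u \<inter> ?C v = {}"
        proof (cases "u = z")
          case True
          then have "v \<noteq> x" "v \<noteq> z" "v \<noteq> g" "v = y \<longrightarrow> g \<noteq> h" using uv nr nr2 nr3 by auto
          then have "?C v \<subseteq> set m \<union> {y, z'}" using v Cm1 Cy Cz by auto
          then show ?thesis using True Cz nm ne by auto
        next
          case False
          then have u: "u = z'" using uv by auto
          then have "v \<noteq> y" "v \<noteq> z'" "v \<noteq> h" using uv nr nr2 by auto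
          then have "?C v \<subseteq> {z, x} \<union> set m" using v Cm2 Cx Cz by auto
          then show ?thesis using u Cz nm ne by auto
        qed
      qed
    qed
  qed
qed

end

lemma successively_split:
  "successively P (xs @ u # ys) \<longleftrightarrow> successively P (xs @ [u]) \<and> successively P (u # ys)"
  by (induction xs rule: walk_edges.induct) auto

context fin_graph begin

lemma reach4_list:
  assumes "distinct l" "successively adj l" "2 \<le> length l" "4 \<le> degree G (last l)"
  shows "reach4 (hd l) (hd (tl l)) (length l - 1)"
  unfolding reach4_def using assms by (intro exI[of _ l]) auto

lemma walk3_replace:
  assumes "walk3 z (p @ u # m @ v # q) z'" "successively adj (u # m' @ [v])" "distinct m'"
    "set m' \<inter> set (p @ u # m @ v # q) = {}" "\<forall>w\<in>set m'. degree G w = 3"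
  shows "walk3 z (p @ u # m' @ v # q) z'"
proof -
  have h: "hd (p @ u # m' @ v # q) = hd (p @ u # m @ v # q)"
    "last (p @ u # m' @ v # q) = last (p @ u # m @ v # q)"
    by (cases p; simp) simp
  have split: "successively adj (z # (p @ u # k @ v # q) @ [z']) \<longleftrightarrow>
      successively adj (z # p @ [u]) \<and> successively adj (u # k @ [v]) \<and> successively adj (v # q @ [z'])" for k
    using successively_split[of adj "z # p" u "k @ v # q @ [z']"] successively_split[of adj "u # k" v "q @ [z']"]
    by simp
  have "successively adj (z # (p @ u # m' @ v # q) @ [z'])"
    using assms(1,2) unfolding walk3_def split by simp
  then show ?thesis using assms h by (auto simp: walk3_def)
qed

text \<open>The first and last edges of the walk stay in place, so the distances to compare with are
  the same.\<close>

lemma near_replace: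
  assumes "near z (p @ u # m @ v # q) z'" "length m' \<le> length m"
  shows "near z (p @ u # m' @ v # q) z'"
proof -
  have h: "hd ((p @ u # m' @ v # q) @ [z']) = hd ((p @ u # m @ v # q) @ [z'])"
    "last (z # p @ u # m' @ v # q) = last (z # p @ u # m @ v # q)"
    by (cases p; simp) simp
  show ?thesis
    unfolding near_def h
  proof (intro allI impI)
    fix k k' assume "reach4 z (hd ((p @ u # m @ v # q) @ [z'])) k"
      "reach4 z' (last (z # p @ u # m @ v # q)) k'"
    then have "length (p @ u # m @ v # q) + 2 \<le> k + k'" using assms(1) by (simp add: near_def)
    then show "length (p @ u # m' @ v # q) + 2 \<le> k + k'" using assms(2) by simp
  qed
qed

end

section \<open>Paths of 3-vertices between 2-vertices are long\<close>

context critical_graph begin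

text \<open>If \<open>w\<close> had degree 2 or 3, then \<open>z w\<close> or
  \<open>z w y z'\<close> would be a walk with fewer than three inner vertices. Both are near,
  because the distances at their ends are at least 1 and at least 2, respectively.\<close>

lemma far_tip:
  assumes IH: "\<And>a ys b. length ys < 3 \<Longrightarrow> walk3 a ys b \<Longrightarrow> near a ys b \<Longrightarrow> False"
    and w3: "walk3 z [x, t, y] z'" and ne: "z \<noteq> z'"
    and w: "w \<notin> {z, x, t, y, z'}" "adj z w" "adj y w"
  shows "reach4 z' y 2"
proof -
  have dg: "degree G z = 2" "degree G z' = 2" "degree G y = 3" and a: "adj y z'"
    using w3 by (auto simp: walk3_def)
  have dis: "distinct [z, x, t, y, z']" using walk3_ends[OF w3] w3 ne by (auto simp: walk3_def)
  have zy: "z \<noteq> y" using dg by auto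
  have "2 \<le> degree G w" using deg_ge2[of w z y] w zy by (simp add: insert_commute)
  moreover have "degree G w \<noteq> 2"
  proof
    assume "degree G w = 2"
    then have "walk3 z [] w" using w dg by (auto simp: walk3_def)
    moreover have "near z [] w" unfolding near_def
      using reach4_ge1 by (metis One_nat_def add_mono add_0 list.size(3) one_add_one)
    ultimately show False using IH[of "[]"] by simp
  qed
  moreover have "degree G w \<noteq> 3"
  proof
    assume d: "degree G w = 3"
    then have "walk3 z [w, y] z'" using w dg a ne by (auto simp: walk3_def insert_commute)
    moreover have "near z [w, y] z'" unfolding near_def
      using reach4_ge2[of z w] reach4_ge2[of z' y] d dg by fastforce
    ultimately show False using IH[of "[w, y]"] by simp
  qed
  ultimately have "4 \<le> degree G w" by linarith
  then show ?thesis using reach4_list[of "[z', y, w]"] w a dis by (auto simp: insert_commute numeral_2_eq_2)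
qed

text \<open>A shortest counterexample is an induced path or cycle. An outside vertex with two neighbours
  inside yields a shorter counterexample if its degree is 2 or 3, and violates \<open>near\<close> if its degree
  is at least 4; the only exceptions involve the ends.\<close>

lemma far:
  assumes "walk3 z xs z'" and "near z xs z'"
  shows False
  using assms
proof (induction "length xs" arbitrary: z xs z' rule: less_induct)
  case less
  note w3 = less.prems(1) and nr = less.prems(2)
  have IH: False if "length ys < length xs" "walk3 a ys b" "near a ys b" for a ys b
    using less.hyps that by blast
  have ends: "z \<notin> set xs" "z' \<notin> set xs" using walk3_ends[OF w3] by auto
  have dx: "distinct xs" and suc: "successively adj (z # xs @ [z'])"
    and dg: "degree G z = 2" "degree G z' = 2" "\<And>v. v \<in> set xs \<Longrightarrow> degree G v = 3"
    using w3 by (auto simp: walk3_def)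
  have chord1: "{u, v} \<in> set (walk_edges (z # xs @ [z']))" if xs: "xs = p @ u # m @ v # q" and a: "adj u v" for p u m v q
  proof (cases "m = []")
    case True
    then show ?thesis using mem_walk_edges[of u v "z # p" "q @ [z']"] xs by simp
  next
    case False
    have "walk3 z (p @ u # [] @ v # q) z'" by (rule walk3_replace[where m = m]) (use w3 xs a in auto)
    moreover have "near z (p @ u # [] @ v # q) z'" by (rule near_replace[where m = m]) (use nr xs in auto)
    ultimately show ?thesis using IH[of "p @ u # [] @ v # q" z z'] False xs by simp
  qed
  have chord: "{u, v} \<in> set (walk_edges (z # xs @ [z']))" if "u \<in> set xs" "v \<in> set xs" "adj u v" for u v
  proof -
    have "u \<noteq> v" using adjD that by blast
    from split_two[OF that(1,2) this] show ?thesis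
      using chord1[of _ u _ v] chord1[of _ v _ u] that(3) by (metis insert_commute)
  qed
  have link1: False
    if xs: "xs = p @ u # m @ v # q" and w: "w \<notin> set (z # xs @ [z'])" "adj u w" "adj v w" for p u m v q w
  proof -
    have uv: "u \<noteq> v" using dx xs by auto
    have sp: "successively adj (z # p @ [u])" "successively adj (u # m @ [v])" "successively adj (v # q @ [z'])"
      using suc successively_split[of adj "z # p" u "m @ v # q @ [z']"]
        successively_split[of adj "u # m" v "q @ [z']"] xs by simp_all
    have srq: "successively adj (z' # rev q @ [v])"
      using successively_rev_adj[of "v # q @ [z']"] sp(3) by simp
    have spw: "successively adj (z # p @ [u, w])" "successively adj (z' # rev q @ [v, w])"
      using successively_split[of adj "z # p" u "[w]"] successively_split[of adj "z' # rev q" v "[w]"]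
        sp(1) srq w by simp_all
    have m2: "2 \<le> length m"
    proof (rule ccontr)
      assume "\<not> 2 \<le> length m"
      then consider "m = []" | t where "m = [t]" by (cases m; cases "tl m") auto
      then show False
      proof cases
        case 1
        then show False using sp(2) w no_triangle[of u v w] by (simp add: insert_commute)
      next
        case 2
        then show False using sp(2) w no_square[of u t v w] uv xs by (auto simp: insert_commute)
      qed
    qed
    have hdl: "hd (xs @ [z']) = hd (p @ [u])" "last (z # xs) = hd (rev q @ [v])"
      using xs by (cases p; simp) (use xs in \<open>cases q rule: rev_cases; simp\<close>)
    have "2 \<le> degree G w" using deg_ge2[of w u v] w uv by (simp add: insert_commute)
    moreover have "degree G w \<noteq> 2"
    proof
      assume d: "degree G w = 2"
      have A: "walk3 z (p @ [u]) w"
        unfolding walk3_def using d dg dx xs w spw(1) by auto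
      have B: "walk3 z' (rev q @ [v]) w"
        unfolding walk3_def using d dg dx xs w spw(2) by auto
      \<comment> \<open>The walk splits at \<open>w\<close> into two shorter ones. If neither were
        near, adding the two failures and using that the distances from \<open>w\<close> are at
        least 1 would contradict the bound for \<open>xs\<close>, since \<open>m\<close> has at
        least two vertices.\<close>
      have "near z (p @ [u]) w \<or> near z' (rev q @ [v]) w"
      proof (rule ccontr)
        assume "\<not> ?thesis"
        then obtain k1 k2 k3 k4 where k: "reach4 z (hd (p @ [u])) k1" "reach4 w u k2"
            "k1 + k2 < length p + 3" "reach4 z' (hd (rev q @ [v])) k3" "reach4 w v k4" "k3 + k4 < length q + 3"
          unfolding near_def
          by (auto simp: not_le hd_append split: if_splits)
        have "length xs + 2 \<le> k1 + k3"
          using nr k(1,4) unfolding near_def hdl by blast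
        then show False using k(3,6) reach4_ge1[OF k(2)] reach4_ge1[OF k(5)] m2 xs by simp
      qed
      then show False
        using IH[OF _ A] IH[OF _ B] m2 xs by auto
    qed
    moreover have "degree G w \<noteq> 3"
    proof
      assume d: "degree G w = 3"
      have "walk3 z (p @ u # [w] @ v # q) z'"
        by (rule walk3_replace[where m = m]) (use w3 xs w d in \<open>auto simp: insert_commute\<close>)
      moreover have "near z (p @ u # [w] @ v # q) z'" by (rule near_replace[where m = m]) (use nr xs m2 in auto)
      ultimately show False using IH[of "p @ u # [w] @ v # q" z z'] m2 xs by simp
    qed
    ultimately have d4: "4 \<le> degree G w" by linarith
    have "reach4 z (hd (p @ [u])) (length p + 2)"
      using reach4_list[of "z # p @ [u, w]"] spw(1) d4 w dx xs ends
      by (auto simp: hd_append split: if_splits)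
    moreover have "reach4 z' (hd (rev q @ [v])) (length q + 2)"
      using reach4_list[of "z' # rev q @ [v, w]"] spw(2) d4 w dx xs ends
      by (auto simp: hd_append split: if_splits)
    ultimately have "length xs + 2 \<le> (length p + 2) + (length q + 2)"
      using nr unfolding near_def hdl by blast
    then show False using m2 xs by simp
  qed
  have link: False if "u \<in> set xs" "v \<in> set xs" "u \<noteq> v" "w \<notin> set (z # xs @ [z'])" "adj u w" "adj v w" for u v w
    using split_two[OF that(1-3)] link1[of _ u _ v _ w] link1[of _ v _ u _ w] that(4-6) by metis
  show False
  proof (cases "z = z'")
    case True
    have "walk3 z xs z" using w3 True by simp
    then show False
    proof (rule no_closed_walk3)
      show "{u, v} \<in> set (walk_edges (z # xs @ [z]))" if "u \<in> set xs" "v \<in> set xs" "adj u v" for u v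
        using chord[OF that] True by simp
      show False if "u \<in> set xs" "v \<in> set xs" "u \<noteq> v" "w \<notin> set (z # xs)" "adj u w" "adj v w" for u v w
        using link[OF that(1-3) _ that(5,6)] that(4) True by simp
    qed
  next
    case False
    show False
    \<comment> \<open>The asymmetric hypothesis \<open>tip\<close> of \<open>no_open_walk3\<close>
      may fail for the walk or for its reversal. If it failed for both, \<open>far_tip\<close> would
      give two distances at most 2, whereas \<open>near\<close> demands a sum of at least 5.\<close>
    proof (cases "\<exists>w. length xs = 3 \<and> w \<notin> set (z # xs @ [z']) \<and> adj z w \<and> adj (last xs) w")
      case no: False
      show False
        by (rule no_open_walk3[OF w3 False chord link], assumption+) (use no in blast)
    next
      case yes: True
      then obtain x t y where xs: "xs = [x, t, y]" by (auto simp: length_Suc_conv numeral_3_eq_3)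
      obtain w where w: "w \<notin> {z, x, t, y, z'}" "adj z w" "adj y w" using yes xs by auto
      have IH3: False if "length ys < 3" "walk3 a ys b" "near a ys b" for a ys b
        by (rule IH[of ys a b]) (use that xs in simp_all)
      have r: "reach4 z' y 2" using far_tip[OF IH3 _ False w] w3 xs by simp
      have w3r: "walk3 z' (rev xs) z" by (rule walk3_rev[OF w3])
      show False
      proof (cases "\<exists>w. w \<notin> {z, x, t, y, z'} \<and> adj z' w \<and> adj x w")
        case True
        then obtain w' where "w' \<notin> {z', y, t, x, z}" "adj z' w'" "adj x w'" by auto
        then have "reach4 z x 2" using far_tip[OF IH3, where z = z' and x = y and t = t and y = x and z' = z and w = w'] w3r xs False by simp
        then have "length xs + 2 \<le> 2 + 2" using nr r xs unfolding near_def by force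
        then show False using xs by simp
      next
        case no: False
        have we: "set (walk_edges (z' # rev xs @ [z])) = set (walk_edges (z # xs @ [z']))"
          using walk_edges_rev[of "z # xs @ [z']"] by simp
        show False
        proof (rule no_open_walk3[OF w3r])
          show "{u, v} \<in> set (walk_edges (z' # rev xs @ [z]))"
            if "u \<in> set (rev xs)" "v \<in> set (rev xs)" "adj u v" for u v
            using chord[of u v] that we by simp
          show False
            if "u \<in> set (rev xs)" "v \<in> set (rev xs)" "u \<noteq> v" "w \<notin> set (z' # rev xs @ [z])" "adj u w" "adj v w"
            for u v w
            using link[of u v w] that by auto
          show False if "w \<notin> set (z' # rev xs @ [z])" "adj z' w" "adj (last (rev xs)) w" for w
            using no that xs by auto
        qed (use False in simp)
      qed
    qed
  qed
qed

end

section \<open>Sails\<close>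

context fin_graph begin

text \<open>A leg is shortest among all paths from its tip to vertices of degree at least 4, not
  only among those through 3-vertices as a sail is.\<close>

definition leg :: "'a \<Rightarrow> 'a list \<Rightarrow> 'a \<Rightarrow> bool" where
  "leg x xs y \<longleftrightarrow> degree G x = 2 \<and> 4 \<le> degree G y \<and> (\<forall>v\<in>set xs. degree G v = 3) \<and>
     distinct (x # xs @ [y]) \<and> successively adj (x # xs @ [y]) \<and>
     (\<forall>m. reach4 x (hd (xs @ [y])) m \<longrightarrow> length xs + 1 \<le> m)"

lemma legD:
  assumes "leg x xs y"
  shows "degree G x = 2" "4 \<le> degree G y" "\<And>v. v \<in> set xs \<Longrightarrow> degree G v = 3"
    "distinct (x # xs @ [y])" "successively adj (x # xs @ [y])"
    "\<And>m. reach4 x (hd (xs @ [y])) m \<Longrightarrow> length xs + 1 \<le> m"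
  using assms unfolding leg_def by blast+

text \<open>Leaving the leg at \<open>u\<close> along \<open>cs\<close> gives a competitor with
  \<open>length p + 1 + length cs\<close> edges, against the \<open>length xs + 1\<close> edges of
  the leg.\<close>

lemma leg_reach:
  assumes l: "leg x xs y" and L: "xs @ [y] = p @ u # q"
    and c: "distinct (x # p @ u # cs)" "successively adj (u # cs)" "4 \<le> degree G (last cs)"
    and ne: "cs \<noteq> []"
  shows "length xs \<le> length p + length cs"
proof -
  have "successively adj ((x # p) @ u # q)" using legD(5)[OF l] L by simp
  then have "successively adj ((x # p) @ u # cs)"
    using successively_split[of adj "x # p" u q] successively_split[of adj "x # p" u cs] c(2) by simp
  then have "reach4 x (hd (p @ u # cs)) (length (p @ u # cs))"
    using reach4_list[of "x # p @ u # cs"] c ne by simp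
  moreover have "hd (p @ u # cs) = hd (xs @ [y])" unfolding L by (cases p) auto
  ultimately show ?thesis using legD(6)[OF l, of "length (p @ u # cs)"] by simp
qed

end

context critical_graph begin

text \<open>A shortest path from the tip to a vertex of degree at least 4 has inner vertices of
  degree 2 or 3. The first one of degree 2 would end a walk forbidden by \<open>far\<close>, so all
  have degree 3. The path is then itself a candidate for the sail, which therefore is no longer than
  it.\<close>

lemma sail_leg:
  assumes s: "sail G p"
  obtains x xs y where "p = x # xs @ [y]" "leg x xs y"
proof -
  have ps: "presail G p" and smin: "\<And>q. presail G q \<Longrightarrow> tip q = tip p \<Longrightarrow> length p \<le> length q"
    using s by (auto simp: sail_def)
  have pp: "path G p" "2 \<le> length p" "\<And>j. j \<in> {1..<length p - 1} \<Longrightarrow> degree G (p ! j) = 3"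
    and dd: "degree G (hd p) = 2" "4 \<le> degree G (last p)"
    using ps by (auto simp: presail_def internally_shortest_3_path_def)
  obtain x p' where "p = x # p'" "p' \<noteq> []" using pp(2) by (cases p rule: walk_edges.cases) auto
  then obtain xs y where p: "p = x # xs @ [y]" by (metis rev_exhaust)
  have dx: "degree G v = 3" if v: "v \<in> set xs" for v
  proof -
    obtain i where i: "i < length xs" "xs ! i = v" using v unfolding in_set_conv_nth by blast
    then have "p ! Suc i = v" using p by (simp add: nth_append)
    then show ?thesis using pp(3)[of "Suc i"] i p by simp
  qed
  have dis: "distinct p" and suc: "successively adj p"
    using pp(1) unfolding path_def walk_edges_successively by auto
  define v where "v = hd (xs @ [y])"
  have tipp: "tip p = {x, v}" using p by (cases xs) (auto simp: tip_def v_def)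
  have vx: "adj x v" using suc p by (cases xs) (auto simp: v_def)
  have degx: "degree G x = 2" using dd p by simp
  have "length xs + 1 \<le> m" if r: "reach4 x v m" for m
  proof -
    define m0 where "m0 = (LEAST m. reach4 x v m)"
    have r0: "reach4 x v m0" unfolding m0_def using r by (rule LeastI)
    have min: "m0 \<le> k" if "reach4 x v k" for k unfolding m0_def using that by (rule Least_le)
    obtain l where l: "distinct l" "successively adj l" "1 \<le> m0" "length l = Suc m0" "hd l = x"
      "hd (tl l) = v" "4 \<le> degree G (last l)"
      using r0 unfolding reach4_def by blast
    obtain l' where "l = x # l'" "l' \<noteq> []" using l(3-5) by (cases l rule: walk_edges.cases) auto
    then obtain ls t where lt: "l = x # ls @ [t]" by (metis rev_exhaust)
    have hv: "hd (ls @ [t]) = v" using l(6) lt by simp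
    have m0: "m0 = Suc (length ls)" using l(4) lt by simp
    have deg_ge: "2 \<le> degree G w \<and> degree G w < 4" if w: "w \<in> set ls" for w
    proof
      obtain P Q where PQ: "ls = P @ w # Q" using w by (auto dest: split_list)
      obtain P' a where P': "x # P = P' @ [a]"
        using append_butlast_last_id[of "x # P"] by (metis list.distinct(1))
      obtain b Q' where Q': "Q @ [t] = b # Q'" by (cases Q) auto
      have L: "l = P' @ a # w # b # Q'" using lt PQ P' Q' by (metis append.assoc append_Cons append_Nil)
      have "adj w a" "adj w b" "a \<noteq> b"
        using l(1,2) unfolding L by (auto simp: successively_append_iff insert_commute)
      then show "2 \<le> degree G w" by (rule deg_ge2)
      show "degree G w < 4"
      proof (rule ccontr)
        assume "\<not> degree G w < 4"
        have "successively adj ((x # P) @ w # (Q @ [t]))" using l(2) lt PQ by simp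
        then have "successively adj (x # P @ [w])"
          using successively_split[of adj "x # P" w "Q @ [t]"] by simp
        then have "reach4 x (hd (P @ [w])) (length P + 1)"
          using reach4_list[of "x # P @ [w]"] \<open>\<not> degree G w < 4\<close> l(1) lt PQ by auto
        moreover have "hd (P @ [w]) = v" using hv PQ by (cases P) auto
        ultimately have "m0 \<le> length P + 1" using min by simp
        then show False using m0 PQ by simp
      qed
    qed
    have no2: "degree G w \<noteq> 2" if w: "w \<in> set ls" for w
    proof
      assume "degree G w = 2"
      then have "\<exists>w\<in>set ls. degree G w = 2" using w by blast
      then obtain P c Q where PQ: "ls = P @ c # Q" "degree G c = 2" "\<forall>w\<in>set P. degree G w \<noteq> 2"
        using split_list_first_propE[where P = "\<lambda>w. degree G w = 2"] by blast
      have "degree G u = 3" if "u \<in> set P" for u using deg_ge[of u] PQ that by force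
      moreover have "successively adj ((x # P) @ c # (Q @ [t]))" using l(2) lt PQ by simp
      then have "successively adj (x # P @ [c])"
        using successively_split[of adj "x # P" c "Q @ [t]"] by simp
      ultimately have "walk3 x P c" using l(1) lt PQ degx by (auto simp: walk3_def)
      \<comment> \<open>The walk ends inside \<open>l\<close>, so it has fewer than
        \<open>m0\<close> edges, and \<open>m0\<close> alone already bounds the distance at
        \<open>x\<close>.\<close>
      moreover have "near x P c" unfolding near_def
      proof (intro allI impI)
        fix k k' assume k: "reach4 x (hd (P @ [c])) k" "reach4 c (last (x # P)) k'"
        have "hd (P @ [c]) = v" using hv PQ by (cases P) auto
        then have "m0 \<le> k" using k(1) min by simp
        then show "length P + 2 \<le> k + k'" using reach4_ge1[OF k(2)] m0 PQ by simp
      qed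
      ultimately show False by (rule far)
    qed
    have d3: "degree G w = 3" if "w \<in> set ls" for w using deg_ge[OF that] no2[OF that] by simp
    have tipl: "tip l = {x, v}" using lt hv by (cases ls) (auto simp: tip_def)
    have subl: "set l \<subseteq> vertices G" using set_subset_vertices l(2-4) by simp
    have sub: "set (walk_edges l) \<subseteq> edges G" using l(2) walk_edges_successively by simp
    have tll: "tl l = ls @ [t]" using lt by simp
    let ?D = "delete_edge G {x, v}"
    have "shortest_path ?D (tl l)" unfolding shortest_path_def
    proof (intro conjI allI impI)
      have wl: "walk_edges l = {x, v} # walk_edges (tl l)"
        using lt hv by (cases ls) auto
      have "{x, v} \<notin> set (walk_edges (tl l))"
        using walk_edges_distinct[OF l(1)] wl by simp
      then show "path ?D (tl l)"
        using sub wl subl l(1) tll lt unfolding path_def delete_edge_def by auto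
      fix q assume q: "path_between ?D (hd (tl l)) (last (tl l)) q"
      have q': "q \<noteq> []" "distinct q" "hd q = v" "last q = t" "set (walk_edges q) \<subseteq> edges G - {{x, v}}"
        using q l(6) tll unfolding path_between_def path_def delete_edge_def by auto
      have sq: "successively adj q" using q'(5) walk_edges_successively[of q] by blast
      \<comment> \<open>\<open>x\<close> is no end of \<open>q\<close>, so \<open>q\<close> would
        have to use both edges of this 2-vertex, one of which has been deleted.\<close>
      have "x \<notin> set q"
      proof
        assume "x \<in> set q"
        then obtain A B where AB: "q = A @ x # B" by (auto dest: split_list)
        have "t \<noteq> x" using l(7) degx lt by auto
        then have "B \<noteq> []" using AB q'(4) by auto
        moreover have "v \<noteq> x" using adjD[OF vx] by simp
        then have "A \<noteq> []" using AB q'(3) by auto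
        ultimately obtain A' a b B' where "A = A' @ [a]" "B = b # B'"
          by (metis neq_Nil_conv rev_exhaust)
        then have Q: "q = A' @ a # x # b # B'" using AB by simp
        have E: "{a, x} \<in> set (walk_edges q)" "{x, b} \<in> set (walk_edges q)"
          using mem_walk_edges[of a x A' "b # B'"] mem_walk_edges[of x b "A' @ [a]" B'] Q by simp_all
        then have "a \<noteq> v" "b \<noteq> v" "adj x a" "adj x b" using q'(5) by (auto simp: insert_commute)
        then have "a = b" using deg2_unique[of x v a b] degx vx by simp
        then show False using q'(2) Q by simp
      qed
      then have "reach4 x v (length q)"
        using reach4_list[of "x # q"] q' sq vx l(7) lt by (cases q) auto
      then show "length (tl l) \<le> length q" using min m0 tll by fastforce
    qed
    moreover have "degree G (l ! j) = 3" if j: "j \<in> {1..<length l - 1}" for j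
    proof -
      have "j - 1 < length ls" "l ! j = ls ! (j - 1)" using j lt by (cases j; auto simp: nth_append)+
      then show ?thesis using d3[of "ls ! (j - 1)"] nth_mem[of "j - 1" ls] by simp
    qed
    ultimately have "presail G l"
      using subl sub l lt degx tipl unfolding presail_def internally_shortest_3_path_def path_def by auto
    then have "length p \<le> length l" using smin[of l] tipl tipp by simp
    then show ?thesis using min[OF r] m0 p lt by simp
  qed
  then have "leg x xs y"
    using dd dx dis suc p v_def by (auto simp: leg_def)
  then show thesis using that p by blast
qed

lemma no_adj_deg2: "degree G z = 2 \<Longrightarrow> degree G w = 2 \<Longrightarrow> adj z w \<Longrightarrow> False"
proof -
  assume "degree G z = 2" "degree G w = 2" "adj z w"
  then have "walk3 z [] w" using adjD(1)[of z w] by (auto simp: walk3_def)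
  moreover have "near z [] w"
    unfolding near_def using reach4_ge1 by (metis One_nat_def add_mono add_0 list.size(3) one_add_one)
  ultimately show False by (rule far)
qed

lemma leg_prefix:
  assumes l: "leg x xs y" and xs: "xs = p @ u # q"
  shows "successively adj (x # p @ [u])" "hd (p @ [u]) = hd (xs @ [y])"
    "\<And>v. v \<in> insert u (set p) \<Longrightarrow> degree G v = 3" "distinct (p @ [u])" "x \<notin> insert u (set p)"
proof -
  have "successively adj ((x # p) @ u # (q @ [y]))" using legD(5)[OF l] xs by simp
  then show "successively adj (x # p @ [u])"
    using successively_split[of adj "x # p" u "q @ [y]"] by simp
  show "hd (p @ [u]) = hd (xs @ [y])" using xs by (cases p) auto
qed (use legD[OF l] xs in auto)

text \<open>Run from \<open>x\<close> to \<open>u\<close>, along \<open>cs\<close>, and from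
  \<open>u'\<close> back to \<open>x'\<close>. Each end is as far from degree 4 as its own leg is
  long, so \<open>len\<close> is exactly the condition that this walk is near.\<close>

lemma legs_connect:
  assumes l: "leg x xs y" and l': "leg x' xs' y'"
    and xs: "xs = p @ u # q" and xs': "xs' = p' @ u' # q'"
    and cs: "\<And>w. w \<in> set cs \<Longrightarrow> degree G w = 3" "successively adj (u # cs @ [u'])"
    and dis: "distinct (p @ u # cs @ u' # rev p')"
    and tip: "x = x' \<Longrightarrow> hd (xs @ [y]) \<noteq> hd (xs' @ [y'])"
    and len: "length cs \<le> length q + length q'"
  shows False
proof -
  let ?m = "p @ u # cs @ u' # rev p'"
  note a = leg_prefix[OF l xs] and b = leg_prefix[OF l' xs']
  have "successively adj (u' # rev p' @ [x'])"
    using b(1) successively_rev_adj[of "x' # p' @ [u']"] by simp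
  then have s: "successively adj (x # ?m @ [x'])"
    using a(1) cs(2) successively_split[of adj "x # p" u "cs @ u' # rev p' @ [x']"]
      successively_split[of adj "u # cs" u' "rev p' @ [x']"] by simp
  have h: "hd ?m = hd (xs @ [y])" "last ?m = hd (xs' @ [y'])"
    using a(2) b(2) by (cases p; simp) (use b(2) in \<open>cases p'; simp\<close>)
  have "walk3 x ?m x'"
    unfolding walk3_def
    using legD(1)[OF l] legD(1)[OF l'] a(3) b(3) cs(1) s dis h tip by auto
  moreover have "near x ?m x'"
    unfolding near_def
  proof (intro allI impI)
    fix k k' assume k: "reach4 x (hd (?m @ [x'])) k" "reach4 x' (last (x # ?m)) k'"
    have "hd (?m @ [x']) = hd ?m" "last (x # ?m) = last ?m" by (cases p; simp) simp
    then have e: "hd (?m @ [x']) = hd (xs @ [y])" "last (x # ?m) = hd (xs' @ [y'])"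
      using h by metis+
    have "length xs + 1 \<le> k" "length xs' + 1 \<le> k'"
      using legD(6)[OF l] legD(6)[OF l'] k unfolding e by blast+
    then show "length ?m + 2 \<le> k + k'" using len xs xs' by simp
  qed
  ultimately show False by (rule far)
qed

text \<open>The shared vertex makes the joined walk shorter than the two legs together, so it is
  near whatever is left of the legs beyond \<open>u\<close>.\<close>

lemma legs_meet:
  assumes l: "leg x xs y" and l': "leg x' xs' y'"
    and xs: "xs = p @ u # q" and xs': "xs' = p' @ u # q'"
    and dis: "distinct (p @ u # rev p')"
    and tip: "x = x' \<Longrightarrow> hd (xs @ [y]) \<noteq> hd (xs' @ [y'])"
  shows False
proof -
  let ?m = "p @ u # rev p'"
  note a = leg_prefix[OF l xs] and b = leg_prefix[OF l' xs']
  have "successively adj (u # rev p' @ [x'])"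
    using b(1) successively_rev_adj[of "x' # p' @ [u]"] by simp
  then have s: "successively adj (x # ?m @ [x'])"
    using a(1) successively_split[of adj "x # p" u "rev p' @ [x']"] by simp
  have h: "hd ?m = hd (xs @ [y])" "last ?m = hd (xs' @ [y'])"
    using a(2) b(2) by (cases p; simp) (use b(2) in \<open>cases p'; simp\<close>)
  have "walk3 x ?m x'"
    unfolding walk3_def
    using legD(1)[OF l] legD(1)[OF l'] a(3) b(3) s dis h tip by auto
  moreover have "near x ?m x'"
    unfolding near_def
  proof (intro allI impI)
    fix k k' assume k: "reach4 x (hd (?m @ [x'])) k" "reach4 x' (last (x # ?m)) k'"
    have "hd (?m @ [x']) = hd ?m" "last (x # ?m) = last ?m" by (cases p; simp) simp
    then have e: "hd (?m @ [x']) = hd (xs @ [y])" "last (x # ?m) = hd (xs' @ [y'])"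
      using h by metis+
    have "length xs + 1 \<le> k" "length xs' + 1 \<le> k'"
      using legD(6)[OF l] legD(6)[OF l'] k unfolding e by blast+
    then show "length ?m + 2 \<le> k + k'" using xs xs' by simp
  qed
  ultimately show False by (rule far)
qed

lemma leg_no_deg2:
  assumes l: "leg x xs y" and xs: "u \<in> set xs" and w: "degree G w = 2" "w \<noteq> x" "adj u w"
  shows False
proof -
  obtain p q where pq: "xs = p @ u # q" using xs by (auto dest: split_list)
  note a = leg_prefix[OF l pq]
  have "successively adj (x # p @ [u, w])"
    using a(1) w successively_split[of adj "x # p" u "[w]"] by simp
  then have "walk3 x (p @ [u]) w" using a legD(1)[OF l] w by (auto simp: walk3_def)
  moreover have "near x (p @ [u]) w"
    unfolding near_def
  proof (intro allI impI)
    fix k k' assume k: "reach4 x (hd ((p @ [u]) @ [w])) k" "reach4 w (last (x # p @ [u])) k'"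
    have "hd ((p @ [u]) @ [w]) = hd (xs @ [y])" using pq by (cases p) auto
    then have "length xs + 1 \<le> k" using legD(6)[OF l] k(1) by simp
    then show "length (p @ [u]) + 2 \<le> k + k'" using reach4_ge1[OF k(2)] pq by simp
  qed
  ultimately show False by (rule far)
qed

text \<open>Compared with \<open>leg_no_deg2\<close> the walk has one more vertex; this is paid for
  by \<open>w\<close> having degree 3, which puts the vertices of degree at least 4 at distance at
  least 2 from \<open>z\<close> along this edge.\<close>

lemma leg_no_deg3:
  assumes l: "leg x xs y" and xs: "u \<in> set xs" and w: "degree G w = 3" "w \<notin> set xs" "adj u w"
    and z: "degree G z = 2" "z \<noteq> x" "adj w z"
  shows False
proof -
  obtain p q where pq: "xs = p @ u # q" using xs by (auto dest: split_list)
  note a = leg_prefix[OF l pq]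
  have "successively adj (x # p @ [u, w, z])"
    using a(1) w z successively_split[of adj "x # p" u "[w, z]"] by simp
  then have "walk3 x (p @ [u, w]) z" using a legD(1)[OF l] w z pq by (auto simp: walk3_def)
  moreover have "near x (p @ [u, w]) z"
    unfolding near_def
  proof (intro allI impI)
    fix k k' assume k: "reach4 x (hd ((p @ [u, w]) @ [z])) k" "reach4 z (last (x # p @ [u, w])) k'"
    have "hd ((p @ [u, w]) @ [z]) = hd (xs @ [y])" using pq by (cases p) auto
    then have "length xs + 1 \<le> k" using legD(6)[OF l] k(1) by simp
    moreover have "2 \<le> k'" using reach4_ge2[of z w k'] k(2) w by simp
    ultimately show "length (p @ [u, w]) + 2 \<le> k + k'" using pq by simp
  qed
  ultimately show False by (rule far)
qed

end

section \<open>Windmills\<close>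

text \<open>Both degrees allowed for the axis of a windmill satisfy \<open>deg_y\<close>, because
  max(4, k) is at most k + 1 for k at least 3. As the anchors are distinct, it leaves
  \<open>y\<close> at most one edge outside the sails.\<close>

locale sails = critical_graph +
  fixes y :: 'a and S :: "'a list set"
  assumes finS: "finite S" and S_ne: "S \<noteq> {}" and inj_tip: "inj_on tip S"
    and S_sail: "\<And>p. p \<in> S \<Longrightarrow> sail G p" and S_last: "\<And>p. p \<in> S \<Longrightarrow> last p = y"
    and deg_y: "degree G y \<le> card S + 1"
begin

definition interior :: "'a list \<Rightarrow> 'a list" where "interior p = butlast (tl p)"

text \<open>This is the neighbour of the axis on the sail; it is the 2-vertex itself if the sail is
  a single edge.\<close>

definition anchor :: "'a list \<Rightarrow> 'a" where "anchor p = last (butlast p)"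

definition X :: "'a set" where "X = (\<Union>p\<in>S. set p)"

definition T :: "'a set set" where "T = (\<Union>p\<in>S. set (walk_edges p))"

text \<open>\<open>X\<close> and \<open>T\<close> are the vertices and edges of the sails. Linked vertices must not share information after the calls along \<open>T\<close>.\<close>

definition rel :: "'a \<Rightarrow> 'a \<Rightarrow> bool" where
  "rel u v \<longleftrightarrow> (adj u v \<and> {u, v} \<notin> T) \<or> (\<exists>w. w \<notin> X \<and> adj u w \<and> adj v w)"

text \<open>In this case the call along the last edge of \<open>q\<close> has to come before the calls along \<open>p\<close>.\<close>

definition must_precede :: "'a list \<Rightarrow> 'a list \<Rightarrow> bool" where
  "must_precede q p \<longleftrightarrow> q \<noteq> p \<and> length p = 3 \<and> (\<exists>w. w \<notin> X \<and> adj (hd p) w \<and> adj (anchor q) w)"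

lemma sail_form: assumes "p \<in> S" shows "p = hd p # interior p @ [y]" "leg (hd p) (interior p) y"
proof -
  obtain x xs z where p: "p = x # xs @ [z]" "leg x xs z" by (rule sail_leg[OF S_sail[OF assms]])
  moreover have "z = y" using S_last[OF assms] p by simp
  ultimately show "p = hd p # interior p @ [y]" "leg (hd p) (interior p) y" by (simp_all add: interior_def)
qed

lemma anchor_eq: "p \<in> S \<Longrightarrow> anchor p = last (hd p # interior p)"
  using sail_form(1)[of p] unfolding anchor_def by (metis butlast.simps(2) butlast_append butlast_snoc append_Cons snoc_eq_iff_butlast)

lemma length_inn: "p \<in> S \<Longrightarrow> length p = length (interior p) + 2"
  using arg_cong[OF sail_form(1), of p length] by simp

lemma degs: assumes "p \<in> S" shows "degree G (hd p) = 2" "\<And>v. v \<in> set (interior p) \<Longrightarrow> degree G v = 3"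
    and "4 \<le> degree G y"
  using legD[OF sail_form(2)[OF assms]] by blast+

lemma deg_y4: "4 \<le> degree G y"
  using S_ne degs(3) by blast

lemma set_sail: "p \<in> S \<Longrightarrow> set p = insert (hd p) (insert y (set (interior p)))"
  using arg_cong[OF sail_form(1), of p set] by auto

lemma mem_X: "v \<in> X \<longleftrightarrow> v = y \<or> (\<exists>p\<in>S. v = hd p \<or> v \<in> set (interior p))"
  using S_ne set_sail by (auto simp: X_def)

lemma in_X: "p \<in> S \<Longrightarrow> hd p \<in> X" "p \<in> S \<Longrightarrow> v \<in> set (interior p) \<Longrightarrow> v \<in> X" "y \<in> X" "p \<in> S \<Longrightarrow> v \<in> set p \<Longrightarrow> v \<in> X"
  using S_ne set_sail by (auto simp: X_def)

lemma distinct_sail: "p \<in> S \<Longrightarrow> distinct p"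
  using legD(4)[OF sail_form(2)] sail_form(1) by metis

lemma succ_sail: "p \<in> S \<Longrightarrow> successively adj p"
  using legD(5)[OF sail_form(2)] sail_form(1) by metis

lemma T_edges: "T \<subseteq> edges G"
  using succ_sail walk_edges_successively unfolding T_def by blast

lemma T_X: "e \<in> T \<Longrightarrow> e \<subseteq> X"
  unfolding T_def X_def using walk_edges_subset by blast

lemma XV: "X \<subseteq> vertices G"
proof -
  have "set p \<subseteq> vertices G" if "p \<in> S" for p
    using set_subset_vertices[OF succ_sail[OF that]] length_inn[OF that] by simp
  then show ?thesis unfolding X_def by blast
qed

definition nxt :: "'a list \<Rightarrow> 'a" where "nxt p = hd (interior p @ [y])"

lemma tip_edge: assumes "p \<in> S" shows "{hd p, nxt p} \<in> T" "adj (hd p) (nxt p)" "tip p = {hd p, nxt p}"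
proof -
  obtain b q where q: "interior p @ [y] = b # q" by (cases "interior p") auto
  have p: "p = hd p # b # q" using sail_form(1)[OF assms] q by simp
  have b: "b = nxt p" using q by (simp add: nxt_def)
  have "{hd p, b} \<in> set (walk_edges p)" by (subst p) simp
  then show t: "{hd p, nxt p} \<in> T" using assms b by (auto simp: T_def)
  then show "adj (hd p) (nxt p)" using T_edges by blast
  have "tip p = tip (hd p # b # q)" by (rule arg_cong[OF p])
  then show "tip p = {hd p, nxt p}" by (simp add: tip_def b)
qed

text \<open>Here the tips being distinct enters: sails with a common 2-vertex leave it along
  different edges.\<close>

lemma nxt_neq: "p \<in> S \<Longrightarrow> q \<in> S \<Longrightarrow> p \<noteq> q \<Longrightarrow> hd p = hd q \<Longrightarrow> nxt p \<noteq> nxt q"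
proof
  assume *: "p \<in> S" "q \<in> S" "p \<noteq> q" "hd p = hd q" "nxt p = nxt q"
  have "tip p = tip q" unfolding tip_edge(3)[OF *(1)] tip_edge(3)[OF *(2)] *(4,5) ..
  then show False using inj_onD[OF inj_tip _ *(1,2)] *(3) by simp
qed

text \<open>At the first interior vertex of \<open>p\<close> that lies on \<open>q\<close>, the two
  beginnings join to a walk without repeated inner vertices, which \<open>legs_meet\<close>
  forbids.\<close>

lemma interior_disjoint: assumes "p \<in> S" "q \<in> S" "p \<noteq> q" shows "set (interior p) \<inter> set (interior q) = {}"
proof (rule ccontr)
  assume "\<not> ?thesis"
  then have "\<exists>u\<in>set (interior p). u \<in> set (interior q)" by blast
  then obtain P u R where P: "interior p = P @ u # R" "u \<in> set (interior q)" "\<forall>v\<in>set P. v \<notin> set (interior q)"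
    using split_list_first_propE[where P = "\<lambda>u. u \<in> set (interior q)"] by blast
  obtain P' R' where P': "interior q = P' @ u # R'" using P(2) by (auto dest: split_list)
  show False
  proof (rule legs_meet[OF sail_form(2)[OF assms(1)] sail_form(2)[OF assms(2)] P(1) P'])
    have "distinct (P @ u # R)" "distinct (P' @ u # R')"
      using legD(4)[OF sail_form(2)[OF assms(1)]] legD(4)[OF sail_form(2)[OF assms(2)]] P(1) P' by simp_all
    moreover have "set P \<inter> set P' = {}" using P(3) P' by auto
    ultimately show "distinct (P @ u # rev P')" by auto
  qed (use nxt_neq[OF assms] in \<open>simp add: nxt_def\<close>)
qed

text \<open>An end that is not the anchor leaves a nonempty rest of its sail, which pays for the one
  vertex of \<open>cs\<close> in \<open>legs_connect\<close>.\<close>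

lemma legs_apart:
  assumes p: "p \<in> S" "u \<in> set (interior p)" and q: "q \<in> S" "v \<in> set (interior q)" and "p \<noteq> q"
    and cs: "\<And>w. w \<in> set cs \<Longrightarrow> degree G w = 3" "successively adj (u # cs @ [v])" "distinct cs" "set cs \<inter> X = {}"
    and len: "cs = [] \<or> length cs = 1 \<and> \<not> (u = anchor p \<and> v = anchor q)"
  shows False
proof -
  obtain P R where P: "interior p = P @ u # R" using p(2) by (auto dest: split_list)
  obtain P' R' where P': "interior q = P' @ v # R'" using q(2) by (auto dest: split_list)
  have d: "distinct (interior p)" "distinct (interior q)"
    using legD(4)[OF sail_form(2)[OF p(1)]] legD(4)[OF sail_form(2)[OF q(1)]] by simp_all
  have i: "set (interior p) \<inter> set (interior q) = {}" by (rule interior_disjoint) (use assms in auto)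
  have x: "set (interior p) \<inter> set cs = {}" "set (interior q) \<inter> set cs = {}"
    using cs(4) in_X(2)[OF p(1)] in_X(2)[OF q(1)] by blast+
  show False
  proof (rule legs_connect[OF sail_form(2)[OF p(1)] sail_form(2)[OF q(1)] P P' cs(1,2)])
    show "distinct (P @ u # cs @ v # rev P')"
      using d i x cs(3) unfolding P P' by auto
    show "hd (interior p @ [y]) \<noteq> hd (interior q @ [y])" if "hd p = hd q"
      using nxt_neq[OF p(1) q(1) \<open>p \<noteq> q\<close> that] by (simp add: nxt_def)
    have "u = anchor p" if "R = []" using that P anchor_eq[OF p(1)] by simp
    moreover have "v = anchor q" if "R' = []" using that P' anchor_eq[OF q(1)] by simp
    ultimately show "length cs \<le> length R + length R'" using len by (cases R; cases R') auto
  qed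
qed

text \<open>From any earlier vertex, stepping to \<open>w\<close> would reach degree 4 sooner than
  the sail does.\<close>

lemma leg_end_big:
  assumes p: "p \<in> S" "u \<in> set (interior p)" and w: "w \<notin> X" "adj u w" "4 \<le> degree G w"
  shows "u = anchor p"
proof -
  obtain P R where P: "interior p = P @ u # R" using p(2) by (auto dest: split_list)
  note l = sail_form(2)[OF p(1)]
  have "length (interior p) \<le> length P + length [w]"
  proof (rule leg_reach[OF l, where q = "R @ [y]"])
    have "w \<noteq> hd p" "w \<notin> set (interior p)" using w(1) in_X p(1) by blast+
    then show "distinct (hd p # P @ u # [w])" using legD(4)[OF l] P by auto
  qed (use P w in auto)
  then show ?thesis using P anchor_eq[OF p(1)] by simp
qed

text \<open>A chord, or a detour through an outside vertex that skips at least two vertices, would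
  lead from the tip to \<open>y\<close> too early. A detour skipping at most one vertex closes a
  triangle or a square.\<close>

lemma same_leg:
  assumes p: "p \<in> S" and uv: "u \<in> set (interior p @ [y])" "v \<in> set (interior p @ [y])" "u \<noteq> v"
  shows "\<not> rel u v"
proof -
  note l = sail_form(2)[OF p]
  have *: "\<not> rel u v" if L: "interior p @ [y] = P @ u # m @ v # R" for P u m v R
  proof
    assume r: "rel u v"
    have d: "distinct (hd p # P @ u # m @ v # R)" using legD(4)[OF l] L by simp
    have "successively adj (hd p # P @ u # m @ v # R)" using legD(5)[OF l] L by simp
    then have s: "successively adj (v # R)" "successively adj (u # m @ [v])"
      using successively_split[of adj "hd p # P" u "m @ v # R"] successively_split[of adj "u # m" v R] by simp_all
    have y: "last (v # R) = y" using arg_cong[OF L, of last] by simp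
    have len: "length (interior p) + 1 = length P + 2 + length m + length R"
      using arg_cong[OF L, of length] by simp
    have pe: "p = (hd p # P) @ u # m @ v # R" using sail_form(1)[OF p] L by simp
    show False
    proof (cases "adj u v \<and> {u, v} \<notin> T")
      case True
      have "m \<noteq> []"
      proof
        assume "m = []"
        then have "{u, v} \<in> set (walk_edges p)" using mem_walk_edges[of u v "hd p # P" R] pe by simp
        then show False using True p by (auto simp: T_def)
      qed
      moreover have "length (interior p) \<le> length P + length (v # R)"
        by (rule leg_reach[OF l L]) (use d s y True deg_y4 in auto)
      ultimately show False using len by (cases m) auto
    next
      case False
      then obtain w where w: "w \<notin> X" "adj u w" "adj v w" using r by (auto simp: rel_def)
      have "w \<notin> set p" using w(1) in_X(4)[OF p] by blast
      then have wn: "w \<notin> set ((hd p # P) @ u # m @ v # R)" using pe by metis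
      have "length (interior p) \<le> length P + length (w # v # R)"
        by (rule leg_reach[OF l L]) (use d s y w wn deg_y4 in \<open>auto simp: insert_commute\<close>)
      then have "length m \<le> 1" using len by simp
      then consider "m = []" | t where "m = [t]" by (cases m; cases "tl m") auto
      then show False
      proof cases
        case 1
        then show False using no_triangle[of u v w] s w by (simp add: insert_commute)
      next
        case 2
        then show False using no_square[of u t v w] s w d wn by (auto simp: insert_commute)
      qed
    qed
  qed
  have sym: "rel u v = rel v u" by (auto simp: rel_def insert_commute)
  from split_two[OF uv] show ?thesis using * sym by metis
qed

text \<open>A common neighbour \<open>w\<close> of degree 2 would be adjacent to the 2-vertex
  \<open>z\<close>, and one of degree 3 would extend the beginning of the sail to a forbidden walk
  to \<open>z\<close>. So \<open>w\<close> has degree at least 4, and \<open>leg_end_big\<close>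
  applies.\<close>

lemma hd_inn_link:
  assumes p: "p \<in> S" "u \<in> set (interior p)" and z: "degree G z = 2" "z \<noteq> hd p"
  shows "\<not> adj u z" and "w \<notin> X \<Longrightarrow> adj u w \<Longrightarrow> adj z w \<Longrightarrow> u = anchor p"
proof -
  show "\<not> adj u z" using leg_no_deg2[OF sail_form(2)[OF p(1)] p(2) z] by blast
  assume w: "w \<notin> X" "adj u w" "adj z w"
  have "u \<noteq> z" using degs(2)[OF p] z by auto
  then have "2 \<le> degree G w" using deg_ge2[of w u z] w by (simp add: insert_commute)
  moreover have "degree G w \<noteq> 2" using no_adj_deg2[of z w] z w by auto
  moreover have "degree G w \<noteq> 3"
    using leg_no_deg3[OF sail_form(2)[OF p(1)] p(2) _ _ w(2) z] w in_X(2)[OF p(1)]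
    by (auto simp: insert_commute)
  ultimately have "4 \<le> degree G w" by linarith
  then show "u = anchor p" using leg_end_big[OF p w(1,2)] by blast
qed

lemma anchor_y: assumes "p \<in> S" shows "adj (anchor p) y" "anchor p \<in> set p" "{anchor p, y} \<in> set (walk_edges p)"
proof -
  obtain P where P: "hd p # interior p = P @ [anchor p]"
    using append_butlast_last_id[of "hd p # interior p"] anchor_eq[OF assms] by (metis list.distinct(1))
  then have p: "p = P @ anchor p # y # []" using sail_form(1)[OF assms] by (metis append_Cons append_assoc append_Nil)
  show "{anchor p, y} \<in> set (walk_edges p)" by (subst p) (rule mem_walk_edges)
  then show "adj (anchor p) y" using T_edges assms by (auto simp: T_def)
  show "anchor p \<in> set p" by (subst p) simp
qed

lemma anchor_cases: assumes "p \<in> S" shows "anchor p \<in> set (interior p) \<or> interior p = [] \<and> anchor p = hd p"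
  using anchor_eq[OF assms] by (cases "interior p") auto

lemma anchor_inj: assumes "p \<in> S" "q \<in> S" "anchor p = anchor q" shows "p = q"
proof (rule ccontr)
  assume "p \<noteq> q"
  have "anchor p \<in> set (interior p) \<longleftrightarrow> degree G (anchor p) = 3" "anchor q \<in> set (interior q) \<longleftrightarrow> degree G (anchor q) = 3"
    using anchor_cases[OF assms(1)] anchor_cases[OF assms(2)] degs[OF assms(1)] degs[OF assms(2)] by auto
  then consider "anchor p \<in> set (interior p)" "anchor q \<in> set (interior q)" | "interior p = []" "interior q = []" "hd p = hd q"
    using anchor_cases[OF assms(1)] anchor_cases[OF assms(2)] assms(3) by metis
  then show False
  proof cases
    case 1
    then show False using interior_disjoint[OF assms(1,2) \<open>p \<noteq> q\<close>] assms(3) by auto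
  next
    case 2
    then show False using nxt_neq[OF assms(1,2) \<open>p \<noteq> q\<close>] by (simp add: nxt_def)
  qed
qed

lemma rel_sym: "rel u v = rel v u"
  by (auto simp: rel_def insert_commute)

lemma rel_T: "{u, v} \<in> T \<Longrightarrow> \<not> rel u v"
  using no_triangle[of u v] T_edges by (auto simp: rel_def insert_commute)

lemma rel_TT: assumes "{u, x} \<in> T" "{x, v} \<in> T" "u \<noteq> v" shows "\<not> rel u v"
proof -
  have a: "adj u x" "adj x v" "x \<in> X" using assms T_edges T_X by blast+
  show ?thesis
    unfolding rel_def using no_triangle[of u x v] no_square[of u x v] a assms(3)
    by (metis insert_commute)
qed

text \<open>Two anchors with a common outside neighbour close a square through \<open>y\<close>. In
  all other cases, degrees 2 and 3 of that neighbour give forbidden walks, while degree at least 4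
  would force both vertices to be anchors.\<close>

lemma rel_inn: assumes "p \<in> S" "u \<in> set (interior p)" "q \<in> S" "v \<in> set (interior q)" "u \<noteq> v"
  shows "\<not> rel u v"
proof (cases "p = q")
  case True
  then show ?thesis using same_leg[of p u v] assms by simp
next
  case False
  have "\<not> adj u v"
    using legs_apart[OF assms(1-4) False, of "[]"] by auto
  moreover have False if w: "w \<notin> X" "adj u w" "adj v w" for w
  proof -
    have sq: "\<not> (u = anchor p \<and> v = anchor q)"
    proof
      assume "u = anchor p \<and> v = anchor q"
      then show False
        using no_square[of u w v y] w anchor_y(1)[OF assms(1)] anchor_y(1)[OF assms(3)] assms(5) in_X(3)
        by (auto simp: insert_commute)
    qed
    have "2 \<le> degree G w" using deg_ge2[of w u v] w assms(5) by (simp add: insert_commute)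
    moreover have "degree G w \<noteq> 2"
    proof
      assume "degree G w = 2"
      moreover have "w \<noteq> hd p" using w in_X(1)[OF assms(1)] by auto
      ultimately show False using hd_inn_link(1)[OF assms(1,2)] w by blast
    qed
    moreover have "degree G w \<noteq> 3"
      using legs_apart[OF assms(1-4) False, of "[w]"] w sq by (auto simp: insert_commute)
    ultimately have "4 \<le> degree G w" by linarith
    then show False
      using leg_end_big[OF assms(1,2) w(1,2)] leg_end_big[OF assms(3,4) w(1,3)] sq by blast
  qed
  ultimately show ?thesis by (auto simp: rel_def)
qed

lemma rel_hd: assumes "u \<in> X" "v \<in> X" "u \<noteq> v" "rel u v"
  shows "(\<exists>p\<in>S. u = hd p) \<or> (\<exists>p\<in>S. v = hd p)"
proof (rule ccontr)
  assume n: "\<not> ?thesis"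
  then have "u = y \<or> (\<exists>p\<in>S. u \<in> set (interior p))" "v = y \<or> (\<exists>p\<in>S. v \<in> set (interior p))"
    using assms(1,2) unfolding mem_X by blast+
  then consider "u = y" "v = y" | p where "u = y" "p \<in> S" "v \<in> set (interior p)"
    | p where "v = y" "p \<in> S" "u \<in> set (interior p)"
    | p q where "p \<in> S" "u \<in> set (interior p)" "q \<in> S" "v \<in> set (interior q)" by blast
  then show False
  proof cases
    case 4
    then show False using rel_inn assms(3,4) by blast
  qed (use same_leg assms(3,4) in auto)
qed

text \<open>A link uses an edge outside \<open>T\<close>, so only one of the two edges at this
  2-vertex can be a tip.\<close>

lemma unshared: assumes "p \<in> S" "rel (hd p) v" "q \<in> S" "hd q = hd p" shows "q = p"
proof (rule ccontr)
  assume "q \<noteq> p"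
  obtain c where c: "adj (hd p) c" "{hd p, c} \<notin> T"
    using assms(2) T_X unfolding rel_def by blast
  have n: "nxt q \<noteq> nxt p" using nxt_neq[OF assms(3,1) \<open>q \<noteq> p\<close> assms(4)] .
  note P = tip_edge[OF assms(1)] and Q = tip_edge[OF assms(3), unfolded assms(4)]
  have "c \<noteq> nxt p" "c \<noteq> nxt q" using c P Q by auto
  then show False using deg2_unique[OF degs(1)[OF assms(1)] P(2) Q(2) c(1)] n by auto
qed

text \<open>By \<open>hd_inn_link\<close>, the partner of a short start is another start or the
  anchor of another sail. The four alternatives match the four arguments that later keep the
  knowledge of such a pair apart; in the last one the single-edge sail \<open>p\<close> plays the
  part of the anchor.\<close>

lemma rel_short:
  assumes p: "p \<in> S" "length p < 4" and v: "v \<in> X" "v \<noteq> hd p" and r: "rel (hd p) v"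
  shows "\<exists>q\<in>S. q \<noteq> p \<and> (v = hd q \<and> 4 \<le> length q \<or> v = hd q \<and> length q = 3 \<and> length p = 3 \<or>
    v = anchor q \<and> must_precede q p \<or> v = hd q \<and> hd p = anchor p \<and> must_precede p q)"
proof -
  let ?u = "hd p"
  have du: "degree G ?u = 2" by (rule degs(1)[OF p(1)])
  have lp: "interior p = [] \<or> (\<exists>a. interior p = [a])" using p(2) length_inn[OF p(1)]
    by (cases "interior p"; cases "tl (interior p)") auto
  have nl: "length p = 3 \<longleftrightarrow> interior p \<noteq> []" using lp length_inn[OF p(1)] by auto
  have own: "\<not> rel ?u (anchor p)" if ne: "interior p \<noteq> []"
  proof -
    obtain a where "interior p = [a]" using lp ne by auto
    then have "anchor p = nxt p" using anchor_eq[OF p(1)] by (simp add: nxt_def)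
    then show ?thesis using rel_T tip_edge(1)[OF p(1)] by metis
  qed
  have y: "\<not> rel ?u y"
  proof (cases "interior p = []")
    case True
    then show ?thesis using rel_T[of ?u y] tip_edge(1)[OF p(1)] by (simp add: nxt_def)
  next
    case False
    then obtain a where a: "interior p = [a]" using lp by auto
    have "{?u, a} \<in> T" "{a, y} \<in> T"
      using tip_edge(1)[OF p(1)] anchor_y(3)[OF p(1)] anchor_eq[OF p(1)] a p(1) by (auto simp: nxt_def T_def)
    moreover have "?u \<noteq> y" using du deg_y4 by auto
    ultimately show ?thesis by (rule rel_TT)
  qed
  have empty_anc: "interior q = [] \<Longrightarrow> anchor q = hd q" if "q \<in> S" for q using anchor_eq[OF that] by simp
  have len2: False if "interior p = []" "w \<notin> X" "adj ?u w" "q \<in> S" "v = anchor q" "adj v w" for q w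
  proof -
    have "adj ?u y" using anchor_y(1)[OF p(1)] empty_anc[OF p(1)] that(1) by simp
    then show False using no_square[of ?u w v y] that anchor_y(1)[OF that(4)] v(2) in_X(3)
      by (auto simp: insert_commute)
  qed
  obtain q where q: "q \<in> S" "v = hd q \<or> v \<in> set (interior q)" using v(1) r y unfolding mem_X by blast
  show ?thesis
  proof (cases "v = hd q")
    case True
    then have qp: "q \<noteq> p" using v by auto
    have "\<not> adj ?u v" using no_adj_deg2[OF du degs(1)[OF q(1)]] unfolding True by iprover
    then obtain w where w: "w \<notin> X" "adj ?u w" "adj v w" using r by (auto simp: rel_def)
    consider "4 \<le> length q" | "interior q = []" | a where "interior q = [a]"
      using length_inn[OF q(1)] by (cases "interior q"; cases "tl (interior q)") auto
    then show ?thesis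
    proof cases
      case 2
      then have va: "v = anchor q" using empty_anc[OF q(1)] True by simp
      then have "interior p \<noteq> []" using len2 w q(1) by blast
      then have "must_precede q p" unfolding must_precede_def using qp nl w va by (auto simp: insert_commute)
      then show ?thesis by (intro bexI[OF _ q(1)]) (simp add: va[symmetric] qp)
    next
      case 3
      then have lq: "length q = 3" using length_inn[OF q(1)] by simp
      show ?thesis
      proof (cases "interior p = []")
        case True
        then have "must_precede p q" unfolding must_precede_def
          using qp lq w empty_anc[OF p(1)] \<open>v = hd q\<close> by (auto simp: insert_commute)
        then show ?thesis by (intro bexI[OF _ q(1)]) (simp add: \<open>v = hd q\<close> empty_anc[OF p(1) True] qp)
      next
        case False
        then show ?thesis by (intro bexI[OF _ q(1)]) (use lq nl \<open>v = hd q\<close> qp in simp)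
      qed
    qed (intro bexI[OF _ q(1)], simp add: True qp)
  next
    case False
    then have vi: "v \<in> set (interior q)" using q(2) by simp
    show ?thesis
    proof (cases "q = p")
      case True
      then obtain a where a: "interior p = [a]" using vi lp by auto
      then have "v = anchor p" using vi True anchor_eq[OF p(1)] by simp
      then show ?thesis using own a r by simp
    next
      case qp: False
      have uq: "?u \<noteq> hd q" using unshared[OF p(1) r q(1)] qp by auto
      have na: "\<not> adj v ?u" using hd_inn_link(1)[OF q(1) vi du uq] .
      then obtain w where w: "w \<notin> X" "adj ?u w" "adj v w" using r by (auto simp: rel_def insert_commute)
      have va: "v = anchor q" using hd_inn_link(2)[OF q(1) vi du uq w(1,3,2)] .
      then have "interior p \<noteq> []" using len2 w q(1) by blast
      then have "must_precede q p" unfolding must_precede_def using qp nl w va by auto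
      then show ?thesis by (intro bexI[OF _ q(1)]) (simp add: va[symmetric] qp)
    qed
  qed
qed

end

text \<open>Only \<open>y\<close> can carry information from one walk to the next; all other
  vertices of the later walks are still untouched, so pairwise disjointness persists.\<close>

lemma nodup_spider:
  assumes "\<And>q. q \<in> set qs \<Longrightarrow> distinct q"
    and "sorted_wrt (\<lambda>q q'. set q \<inter> set q' \<subseteq> {y}) qs"
    and "\<And>u v. u \<in> (\<Union>q\<in>set qs. set q) \<Longrightarrow> v \<in> (\<Union>q\<in>set qs. set q) \<Longrightarrow> u \<noteq> v \<Longrightarrow> A u \<inter> A v = {}"
  shows "nodup A (concat (map walk_edges qs))"
  using assms
proof (induction qs arbitrary: A)
  case (Cons q qs)
  let ?B = "calls A (walk_edges q)"
  let ?U = "\<Union>q\<in>set qs. set q"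
  have 1: "nodup A (walk_edges q)"
    by (rule nodup_walk) (use Cons.prems in auto)
  have out: "?B v = A v" if "v \<notin> set q" for v
    using calls_untouched[of v "walk_edges q" A] walk_edges_subset[of _ q] that by blast
  have inq: "?B v \<subseteq> (\<Union>u\<in>set q. A u)" if "v \<in> set q" for v
    by (rule calls_walk(1)) (use Cons.prems(1) that in auto)
  have y: "v = y" if "v \<in> set q" "v \<in> ?U" for v
    using Cons.prems(2) that by auto
  have "nodup ?B (concat (map walk_edges qs))"
  proof (rule Cons.IH)
    fix u v assume uv: "u \<in> ?U" "v \<in> ?U" "u \<noteq> v"
    have *: "?B u \<inter> ?B v = {}" if uv: "u \<in> ?U" "v \<in> ?U" "u \<noteq> v" and v: "v \<notin> set q" for u v
    proof (cases "u \<in> set q")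
      case True
      have "A w \<inter> A v = {}" if "w \<in> set q" for w
        using Cons.prems(3)[of w v] uv that v by auto
      then show ?thesis using inq[OF True] out[OF v] by blast
    next
      case False
      then show ?thesis using Cons.prems(3)[of u v] uv out v by auto
    qed
    show "?B u \<inter> ?B v = {}"
      using *[of u v] *[of v u] uv y[of u] y[of v] by (metis Int_commute)
  qed (use Cons.prems in auto)
  then show ?case using 1 by (simp add: nodup_append)
qed simp

text \<open>Elements without a predecessor are put first, one at a time. Where this gets stuck, the
  remaining set \<open>B\<close> contains a predecessor of each of its elements, and following
  predecessors will lead round a cycle.\<close>

lemma list_order:
  assumes "finite A"
  shows "(\<exists>xs. distinct xs \<and> set xs = A \<and> (\<forall>us q vs. xs = us @ q # vs \<longrightarrow> (\<forall>p\<in>set us. \<not> R q p))) \<or>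
    (\<exists>B\<subseteq>A. B \<noteq> {} \<and> (\<forall>p\<in>B. \<exists>q\<in>B. R q p))"
  using assms
proof (induction A rule: finite_psubset_induct)
  case (psubset A)
  show ?case
  proof (cases "\<exists>p\<in>A. \<forall>q\<in>A. \<not> R q p")
    case True
    then obtain p where p: "p \<in> A" "\<forall>q\<in>A. \<not> R q p" by blast
    have "A - {p} \<subset> A" using p by blast
    from psubset.IH[OF this] show ?thesis
    proof
      assume "\<exists>xs. distinct xs \<and> set xs = A - {p} \<and> (\<forall>us q vs. xs = us @ q # vs \<longrightarrow> (\<forall>p\<in>set us. \<not> R q p))"
      then obtain xs where xs: "distinct xs" "set xs = A - {p}"
        "\<And>us q vs. xs = us @ q # vs \<Longrightarrow> \<forall>p\<in>set us. \<not> R q p" by blast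
      have "\<forall>x\<in>set us. \<not> R q x" if "p # xs = us @ q # vs" for us q vs
      proof (cases us)
        case (Cons a us')
        then have "a = p" "xs = us' @ q # vs" using that by auto
        moreover have "q \<in> A" using \<open>xs = us' @ q # vs\<close> xs(2) by (metis DiffD1 in_set_conv_decomp)
        ultimately show ?thesis using xs(3)[of us' q vs] p(2) Cons by auto
      qed simp
      moreover have "distinct (p # xs)" "set (p # xs) = A" using xs p by auto
      ultimately show ?thesis by blast
    next
      assume "\<exists>B\<subseteq>A - {p}. B \<noteq> {} \<and> (\<forall>p\<in>B. \<exists>q\<in>B. R q p)"
      then show ?thesis by blast
    qed
  next
    case False
    show ?thesis
    proof (cases "A = {}")
      case True
      show ?thesis by (intro disjI1 exI[of _ "[]"]) (simp add: True)
    next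
      case ne: False
      show ?thesis by (intro disjI2 exI[of _ A]) (use ne False in simp)
    qed
  qed
qed

context sails begin

lemma long_sail:
  assumes "p \<in> S" "4 \<le> length p"
  obtains r where "p = hd p # p ! 1 # p ! 2 # r" "r \<noteq> []" "nxt p = p ! 1" "p ! 1 \<in> set (interior p)" "p ! 2 \<in> set (interior p)"
proof -
  obtain a b s where i: "interior p = a # b # s"
    using length_inn[OF assms(1)] assms(2) by (cases "interior p" rule: walk_edges.cases) auto
  have p: "p = hd p # a # b # s @ [y]" using sail_form(1)[OF assms(1)] i by simp
  have n: "p ! 1 = a" "p ! 2 = b" by (subst p, simp)+
  show thesis
  proof (rule that[of "s @ [y]"])
    show "p = hd p # p ! 1 # p ! 2 # (s @ [y])" unfolding n by (rule p)
  qed (use i n in \<open>simp_all add: nxt_def\<close>)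
qed

lemma drop_sail: assumes "p \<in> S" "4 \<le> length p"
  shows "set (drop 2 p) \<subseteq> insert y (set (interior p))" "hd p \<notin> set (drop 2 p)" "p ! 1 \<notin> set (drop 2 p)"
    "p ! 2 \<in> set (drop 2 p)" "walk_edges p = {hd p, p ! 1} # {p ! 1, p ! 2} # walk_edges (drop 2 p)"
    "p ! 1 \<noteq> p ! 2" "distinct (drop 2 p)"
proof -
  obtain r where p: "p = hd p # p ! 1 # p ! 2 # r" and "r \<noteq> []"
    by (rule long_sail[OF assms])
  have d: "drop 2 p = p ! 2 # r" by (subst p) simp
  have dis: "distinct (hd p # p ! 1 # p ! 2 # r)" using distinct_sail[OF assms(1)] p by simp
  then show "hd p \<notin> set (drop 2 p)" "p ! 1 \<notin> set (drop 2 p)" "p ! 2 \<in> set (drop 2 p)" "p ! 1 \<noteq> p ! 2"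
    "distinct (drop 2 p)" unfolding d by auto
  show "walk_edges p = {hd p, p ! 1} # {p ! 1, p ! 2} # walk_edges (drop 2 p)" unfolding d by (subst p) simp
  have "set (drop 2 p) \<subseteq> set p" by (rule set_drop_subset)
  then show "set (drop 2 p) \<subseteq> insert y (set (interior p))"
    using set_sail[OF assms(1)] \<open>hd p \<notin> set (drop 2 p)\<close> by auto
qed

lemma hd_not_inn: "p \<in> S \<Longrightarrow> q \<in> S \<Longrightarrow> hd p \<notin> set (interior q)"
  using degs(1)[of p] degs(2)[of q "hd p"] by auto

lemma y_not_inn: "q \<in> S \<Longrightarrow> y \<notin> set (interior q)"
  using deg_y4 degs(2)[of q y] by auto

lemma hd_not_y: "q \<in> S \<Longrightarrow> hd q \<noteq> y"
  using deg_y4 degs(1)[of q] by auto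

lemma interior_eq: "p \<in> S \<Longrightarrow> q \<in> S \<Longrightarrow> v \<in> set (interior p) \<Longrightarrow> v \<in> set (interior q) \<Longrightarrow> p = q"
  using interior_disjoint[of p q] by auto

text \<open>Two sails with at most two edges each from one 2-vertex to \<open>y\<close> would close
  a triangle or a square.\<close>

lemma short_hd: assumes "p \<in> S" "q \<in> S" "p \<noteq> q" "length p < 4" "length q < 4" shows "hd p \<noteq> hd q"
proof
  assume e: "hd p = hd q"
  have n: "nxt p \<noteq> nxt q" by (rule nxt_neq) (use assms e in auto)
  have *: "nxt r = y \<or> adj (nxt r) y \<and> nxt r \<noteq> y" if r: "r \<in> S" "length r < 4" for r
  proof -
    consider "interior r = []" | a where "interior r = [a]"
      using length_inn[OF r(1)] r(2) by (cases "interior r"; cases "tl (interior r)") auto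
    then show ?thesis
    proof cases
      case 2
      then have "adj a y" using anchor_y(1)[OF r(1)] anchor_eq[OF r(1)] by simp
      then show ?thesis using 2 adjD(1)[of a y] by (auto simp: nxt_def)
    qed (simp add: nxt_def)
  qed
  have a: "adj (hd p) (nxt p)" "adj (hd p) (nxt q)"
    using tip_edge(2)[OF assms(1)] tip_edge(2)[OF assms(2)] e by simp_all
  have "hd p \<noteq> y" by (rule hd_not_y[OF assms(1)])
  then show False
    using *[OF assms(1,4)] *[OF assms(2,5)] n a no_square[of "hd p" "nxt p" y "nxt q"]
      no_triangle[of "hd p" "nxt p" y] no_triangle[of "hd p" "nxt q" y]
    by (auto simp: insert_commute)
qed

text \<open>This is the hypothesis \<open>deg\<close> of \<open>extension\<close>. At
  \<open>y\<close>, two edges outside \<open>T\<close> together with the \<open>card S\<close>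
  distinct anchors would exceed \<open>deg_y\<close>.\<close>

lemma T_deg:
  assumes v: "v \<in> X" and a: "adj v c" "adj v d" and n: "{v, c} \<notin> T" "{v, d} \<notin> T"
  shows "c = d"
proof -
  consider "v = y" | p where "p \<in> S" "v = hd p" | p where "p \<in> S" "v \<in> set (interior p)"
    using v unfolding mem_X by blast
  then show ?thesis
  proof cases
    case 1
    show ?thesis
    proof (rule ccontr)
      assume "c \<noteq> d"
      have t: "{y, anchor p} \<in> T" "adj y (anchor p)" if "p \<in> S" for p
        using anchor_y[OF that] that by (auto simp: T_def insert_commute)
      then have "c \<notin> anchor ` S" "d \<notin> anchor ` S" using n 1 by auto
      moreover have "card (anchor ` S) = card S" by (rule card_image) (use anchor_inj in \<open>auto intro: inj_onI\<close>)
      ultimately have "card ({c, d} \<union> anchor ` S) = card S + 2"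
        using \<open>c \<noteq> d\<close> finS by simp
      moreover have "card ({c, d} \<union> anchor ` S) \<le> degree G y"
        by (rule card_nbrs) (use t a 1 in auto)
      ultimately show False using deg_y by simp
    qed
  next
    case 2
    have "c \<noteq> nxt p" "d \<noteq> nxt p" using n 2 tip_edge(1)[OF 2(1)] by auto
    then show ?thesis
      using deg2_unique[OF degs(1)[OF 2(1)] tip_edge(2)[OF 2(1)]] a 2(2) by simp
  next
    case 3
    obtain P Q where PQ: "interior p = P @ v # Q" using 3(2) by (auto dest: split_list)
    obtain P' a' where P': "hd p # P = P' @ [a']"
      using append_butlast_last_id[of "hd p # P"] by (metis list.distinct(1))
    obtain b' Q' where Q': "Q @ [y] = b' # Q'" by (cases Q) auto
    have "hd p # interior p @ [y] = P' @ a' # v # b' # Q'"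
      using PQ P' Q' by (metis append.assoc append_Cons append_Nil)
    then have p: "p = P' @ a' # v # b' # Q'" using sail_form(1)[OF 3(1)] by simp
    have "{a', v} \<in> set (walk_edges p)" by (subst p) (rule mem_walk_edges)
    moreover have "{v, b'} \<in> set (walk_edges p)" using mem_walk_edges[of v b' "P' @ [a']" Q'] p by simp
    ultimately have t: "{v, a'} \<in> T" "{v, b'} \<in> T" using 3(1) by (auto simp: T_def insert_commute)
    have "a' \<noteq> b'" using distinct_sail[OF 3(1)] p by (metis distinct.simps(2) distinct_append list.set_intros(1,2))
    moreover have "c \<notin> {a', b'}" "d \<notin> {a', b'}" using n t by auto
    moreover have "adj v a'" "adj v b'" using t T_edges by auto
    ultimately show ?thesis using deg3_unique[OF degs(2)[OF 3]] a by blast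
  qed
qed

end

section \<open>Ordering the edges of a windmill\<close>

lemma sorted_wrt_distinct:
  assumes "distinct xs" and "\<And>x y. x \<in> set xs \<Longrightarrow> y \<in> set xs \<Longrightarrow> x \<noteq> y \<Longrightarrow> R x y"
  shows "sorted_wrt R xs"
  using assms by (induction xs) auto

context sails begin

text \<open>The order of calls sought here would contradict \<open>extension\<close>. By
  \<open>rel_hd\<close> only pairs with the start of a sail have to be compared, and
  \<open>ord\<close> serves those pairs whose information would otherwise meet through
  \<open>y\<close>.\<close>

lemma no_good_order:
  assumes Ss: "distinct Ss" "set Ss = {p \<in> S. length p < 4}"
    and ord: "\<And>us q vs p. Ss = us @ q # vs \<Longrightarrow> p \<in> set us \<Longrightarrow> \<not> must_precede q p"
  shows False
proof -
  obtain Ls where Ls: "distinct Ls" "set Ls = {p \<in> S. 4 \<le> length p}"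
    using finite_distinct_list[of "{p \<in> S. 4 \<le> length p}"] finS by auto
  have L: "p \<in> S" "4 \<le> length p" if "p \<in> set Ls" for p using that Ls by auto
  have Sh: "p \<in> S" "length p < 4" if "p \<in> set Ss" for p using that Ss by auto
  have SLS: "p \<in> set Ls \<or> p \<in> set Ss" if "p \<in> S" for p using that Ls Ss by auto
  have i1: "p ! 1 \<in> set (interior p)" and i2: "p ! 2 \<in> set (interior p)" if "p \<in> set Ls" for p
    using long_sail[OF L[OF that]] by blast+
  have eq1: "p = q" if "p \<in> set Ls" "q \<in> S" "p ! 1 \<in> set (interior q)" for p q
    using interior_eq[OF L(1)[OF that(1)] that(2) i1[OF that(1)] that(3)] .
  have eq2: "p = q" if "p \<in> set Ls" "q \<in> S" "p ! 2 \<in> set (interior q)" for p q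
    using interior_eq[OF L(1)[OF that(1)] that(2) i2[OF that(1)] that(3)] .
  have eq11: "p = q" if "p \<in> set Ls" "q \<in> set Ls" "p ! 1 = q ! 1" for p q
    using eq1[OF that(1) L(1)[OF that(2)]] i1[OF that(2)] that(3) by simp
  have eq22: "p = q" if "p \<in> set Ls" "q \<in> set Ls" "p ! 2 = q ! 2" for p q
    using eq2[OF that(1) L(1)[OF that(2)]] i2[OF that(2)] that(3) by simp
  have neq12: "p ! 1 \<noteq> q ! 2" if "p \<in> set Ls" "q \<in> set Ls" for p q
    using eq1[OF that(1) L(1)[OF that(2)]] i2[OF that(2)] drop_sail(6)[OF L[OF that(1)]] by auto
  have hd1: "hd p \<noteq> q ! 1" if "p \<in> S" "q \<in> set Ls" for p q
    using hd_not_inn[OF that(1) L(1)[OF that(2)]] i1[OF that(2)] by auto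
  have hd2: "hd p \<noteq> q ! 2" if "p \<in> S" "q \<in> set Ls" for p q
    using hd_not_inn[OF that(1) L(1)[OF that(2)]] i2[OF that(2)] by auto
  have y12: "y \<noteq> q ! 1" "y \<noteq> q ! 2" if "q \<in> set Ls" for q
    using y_not_inn[OF L(1)[OF that]] i1[OF that] i2[OF that] by auto
  have dr: "set (drop 2 p) \<subseteq> insert y (set (interior p))" if "p \<in> set Ls" for p
    using drop_sail(1)[OF L[OF that]] .
  have dr_hd: "hd p \<notin> set (drop 2 q)" if "p \<in> S" "q \<in> set Ls" for p q
    using dr[OF that(2)] hd_not_inn[OF that(1) L(1)[OF that(2)]] hd_not_y[OF that(1)] by auto
  have dr_1: "p ! 1 \<notin> set (drop 2 q)" if "p \<in> set Ls" "q \<in> set Ls" for p q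
    using dr[OF that(2)] eq1[OF that(1) L(1)[OF that(2)]] y12[OF that(1)] drop_sail(3)[OF L[OF that(1)]] by auto
  (* The second edges of the long sails come after their other edges, so that no information about their first two
     vertices reaches y; in the short sails this cannot be avoided. *)
  let ?E1 = "map (\<lambda>p. {hd p, p ! 1}) Ls" and ?E2 = "concat (map (\<lambda>p. walk_edges (drop 2 p)) Ls)"
    and ?E3 = "map (\<lambda>p. {p ! 1, p ! 2}) Ls" and ?E4 = "concat (map walk_edges Ss)"
  \<comment> \<open>\<open>P1\<close> holds the second vertices of the long sails, \<open>K2\<close>
    their vertices from the third one up to \<open>y\<close>, and \<open>K4\<close> the vertices of
    the short sails.\<close>
  define P1 where "P1 = (\<lambda>p. p ! 1) ` set Ls"
  define K2 where "K2 = (\<Union>p\<in>set Ls. set (drop 2 p))"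
  define K4 where "K4 = (\<Union>p\<in>set Ss. set p)"
  have E2K: "e \<subseteq> K2" if "e \<in> set ?E2" for e
    using that walk_edges_subset unfolding K2_def by fastforce
  have E4K: "e \<subseteq> K4" if "e \<in> set ?E4" for e
    using that walk_edges_subset unfolding K4_def by fastforce
  have hdK2: "hd p \<notin> K2" if "p \<in> S" for p using dr_hd[OF that] by (auto simp: K2_def)
  have P1K2: "p ! 1 \<notin> K2" if "p \<in> set Ls" for p using dr_1[OF that] by (auto simp: K2_def)
  have innK2: "v \<notin> K2" if "p \<in> set Ss" "v \<in> set (interior p)" for p v
  proof
    assume "v \<in> K2"
    then obtain q where q: "q \<in> set Ls" "v \<in> set (drop 2 q)" by (auto simp: K2_def)
    have "v \<noteq> y" using y_not_inn[OF Sh(1)[OF that(1)]] that(2) by auto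
    then have "v \<in> set (interior q)" using dr[OF q(1)] q(2) by auto
    then have "p = q" using interior_eq[OF Sh(1)[OF that(1)] L(1)[OF q(1)] that(2)] by simp
    then show False using L(2)[OF q(1)] Sh(2)[OF that(1)] by simp
  qed
  have K4cases: "v = y \<or> (\<exists>p\<in>set Ss. v = hd p \<or> v \<in> set (interior p))" if "v \<in> K4" for v
    using that set_sail[OF Sh(1)] unfolding K4_def by blast
  have innL: "v \<notin> K4" if m: "q \<in> set Ls" "v \<in> set (interior q)" for q v
  proof
    assume "v \<in> K4"
    then obtain p where p: "p \<in> set Ss" "v = hd p \<or> v \<in> set (interior p)"
      using K4cases[of v] y_not_inn[OF L(1)[OF m(1)]] m(2) by auto
    then have "v \<in> set (interior p)" using hd_not_inn[OF Sh(1)[OF p(1)] L(1)[OF m(1)]] m(2) by auto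
    then have "p = q" using interior_eq[OF Sh(1)[OF p(1)] L(1)[OF m(1)] _ m(2)] by simp
    then show False using L(2)[OF m(1)] Sh(2)[OF p(1)] by simp
  qed

  \<comment> \<open>Calls along the first edges of the long sails\<close>
  have nd1: "nodup own ?E1"
  \<comment> \<open>Several long sails may share their start, so the first edges form stars centered
    at the starts.\<close>
  proof (rule nodup_stars[where P = P1])
    show "\<exists>w h. e = {w, h} \<and> w \<noteq> h \<and> w \<in> P1" if e: "e \<in> set ?E1" for e
    proof -
      obtain p where p: "p \<in> set Ls" "e = {p ! 1, hd p}" using e by auto
      then have "p ! 1 \<noteq> hd p" "p ! 1 \<in> P1" using hd1[OF L(1)[OF p(1)] p(1)] by (simp_all add: P1_def)
      then show ?thesis using p(2) by blast
    qed
    show "e = e'" if e: "e \<in> set ?E1" "e' \<in> set ?E1" "w \<in> P1" "w \<in> e" "w \<in> e'" for e e' w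
    proof -
      obtain p q r where "p \<in> set Ls" "e = {hd p, p ! 1}" "q \<in> set Ls" "e' = {hd q, q ! 1}" "r \<in> set Ls" "w = r ! 1"
        using e by (auto simp: P1_def)
      then show ?thesis using e(4,5) hd1[OF L(1)] eq11 by (metis insertE singletonD)
    qed
    show "distinct ?E1"
      using Ls(1) unfolding distinct_map
    proof (intro conjI inj_onI)
      fix p q assume pq: "p \<in> set Ls" "q \<in> set Ls" "{hd p, p ! 1} = {hd q, q ! 1}"
      then have "p ! 1 = q ! 1" using hd1[OF L(1)[OF pq(1)] pq(2)] hd1[OF L(1)[OF pq(2)] pq(1)]
        by (auto simp: doubleton_eq_iff)
      then show "p = q" using eq11 pq by blast
    qed
  qed auto

  \<comment> \<open>Calls along the long sails from the third vertex on\<close>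
  let ?S1 = "calls own ?E1"
  have S1K: "?S1 v = {v}" if "v \<notin> hd ` set Ls" "v \<notin> P1" for v
    using calls_untouched[of v ?E1 own] that by (auto simp: P1_def)
  have nd2: "nodup ?S1 ?E2"
  proof -
    have "nodup own (concat (map walk_edges (map (drop 2) Ls)))"
    proof (rule nodup_spider[where y = y])
      show "sorted_wrt (\<lambda>q q'. set q \<inter> set q' \<subseteq> {y}) (map (drop 2) Ls)"
        unfolding sorted_wrt_map
      proof (rule sorted_wrt_distinct[OF Ls(1)])
        fix p q assume pq: "p \<in> set Ls" "q \<in> set Ls" "p \<noteq> q"
        show "set (drop 2 p) \<inter> set (drop 2 q) \<subseteq> {y}"
          using dr[OF pq(1)] dr[OF pq(2)] interior_disjoint[OF L(1)[OF pq(1)] L(1)[OF pq(2)] pq(3)] by blast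
      qed
    qed (use drop_sail(7) L in auto)
    then have "nodup own ?E2" by (simp add: comp_def)
    moreover have "?S1 v = {v}" if "v \<in> K2" for v
      using S1K[of v] that hdK2[OF L(1)] P1K2 by (auto simp: P1_def)
    ultimately show ?thesis using nodup_cong[of ?E2 ?S1 own] E2K by blast
  qed

  \<comment> \<open>Calls along the second edges of the long sails\<close>
  let ?S2 = "calls ?S1 ?E2"
  have S2: "?S2 = calls own (?E1 @ ?E2)" by simp
  have S2K2: "?S2 v \<subseteq> K2" if "v \<in> K2" for v
    unfolding S2
  proof (rule calls_subset[where K = K2])
    fix e assume "e \<in> set (?E1 @ ?E2)"
    then show "e \<subseteq> K2 \<or> e \<inter> K2 = {}" using E2K hdK2[OF L(1)] P1K2 by auto
  qed (use that in auto)
  have S2o: "?S2 v = ?S1 v" if "v \<notin> K2" for v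
    using calls_untouched[of v ?E2 ?S1] E2K that by blast
  define H where "H = hd ` set Ls \<union> P1"
  have HK2: "H \<inter> K2 = {}" using hdK2[OF L(1)] P1K2 by (auto simp: H_def P1_def)
  have S1H: "?S1 v \<subseteq> H" if "v \<in> H" for v
    by (rule calls_subset[where K = H]) (use that in \<open>auto simp: H_def P1_def\<close>)
  have p2K2: "p ! 2 \<in> K2" if "p \<in> set Ls" for p
    using drop_sail(4)[OF L[OF that]] that by (auto simp: K2_def)
  have dis12: "?S2 (p ! 1) \<inter> ?S2 (q ! 2) = {}" if "p \<in> set Ls" "q \<in> set Ls" for p q
  proof -
    have "p ! 1 \<in> H" using that by (auto simp: H_def P1_def)
    then have "?S2 (p ! 1) \<subseteq> H" using S1H S2o P1K2[OF that(1)] by simp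
    then show ?thesis using S2K2[OF p2K2[OF that(2)]] HK2 by blast
  qed
  have nd3: "nodup ?S2 ?E3"
  proof (rule nodup_stars[where P = P1])
    show "\<exists>w h. e = {w, h} \<and> w \<noteq> h \<and> w \<in> P1" if e: "e \<in> set ?E3" for e
    proof -
      obtain p where p: "p \<in> set Ls" "e = {p ! 1, p ! 2}" using e by auto
      then have "p ! 1 \<noteq> p ! 2" "p ! 1 \<in> P1" using neq12[OF p(1) p(1)] by (simp_all add: P1_def)
      then show ?thesis using p(2) by blast
    qed
    show "e = e'" if e: "e \<in> set ?E3" "e' \<in> set ?E3" "w \<in> P1" "w \<in> e" "w \<in> e'" for e e' w
    proof -
      obtain p q r where "p \<in> set Ls" "e = {p ! 1, p ! 2}" "q \<in> set Ls" "e' = {q ! 1, q ! 2}" "r \<in> set Ls" "w = r ! 1"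
        using e by (auto simp: P1_def)
      then show ?thesis using e(4,5) neq12 eq11 by (metis insertE singletonD)
    qed
    show "?S2 u \<inter> ?S2 v = {}" if e: "{u, v} \<in> set ?E3" "u \<noteq> v" for u v
    proof -
      obtain p where "p \<in> set Ls" "{u, v} = {p ! 1, p ! 2}" using e by auto
      then show ?thesis using dis12[of p p] by (auto simp: doubleton_eq_iff)
    qed
    show "?S2 u \<inter> ?S2 v = {}"
      if e: "u \<noteq> v" "u \<in> P1" "v \<in> P1" "{u, h} \<in> set ?E3" "{v, h} \<in> set ?E3" for h u v
    proof -
      obtain p q where pq: "p \<in> set Ls" "{u, h} = {p ! 1, p ! 2}" "q \<in> set Ls" "{v, h} = {q ! 1, q ! 2}"
        using e by auto
      obtain p' q' where pq': "p' \<in> set Ls" "u = p' ! 1" "q' \<in> set Ls" "v = q' ! 1"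
        using e by (auto simp: P1_def)
      have "u \<noteq> p ! 2" "v \<noteq> q ! 2" using neq12 pq pq' by auto
      then have "u = p ! 1" "h = p ! 2" "v = q ! 1" "h = q ! 2" using pq by (auto simp: doubleton_eq_iff)
      then show ?thesis using eq22 pq e(1) by metis
    qed
    show "distinct ?E3"
      using Ls(1) unfolding distinct_map
    proof (intro conjI inj_onI)
      fix p q assume pq: "p \<in> set Ls" "q \<in> set Ls" "{p ! 1, p ! 2} = {q ! 1, q ! 2}"
      then have "p ! 1 = q ! 1" using neq12[OF pq(1,2)] by (auto simp: doubleton_eq_iff)
      then show "p = q" using eq11 pq by blast
    qed
  qed

  \<comment> \<open>Calls along the short sails\<close>
  let ?S3 = "calls ?S2 ?E3"
  have S3o: "?S3 v = ?S2 v" if "v \<notin> P1" "\<And>p. p \<in> set Ls \<Longrightarrow> v \<noteq> p ! 2" for v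
    using calls_untouched[of v ?E3 ?S2] that by (auto simp: P1_def)
  have S3y: "?S3 y \<subseteq> insert y K2"
  proof -
    have "?S3 y = ?S2 y" using S3o[of y] y12 by (auto simp: P1_def)
    moreover have "?S2 y \<subseteq> insert y K2"
    proof (cases "y \<in> K2")
      case False
      have "?S1 y = {y}" using S1K[of y] y12 hd_not_y[OF L(1)] by (auto simp: P1_def)
      then show ?thesis using S2o[OF False] by simp
    qed (use S2K2 in auto)
    ultimately show ?thesis by simp
  qed
  have S3hd: "?S3 (hd p) \<subseteq> insert (hd p) {q ! 1 |q. q \<in> set Ls \<and> hd q = hd p}" if "p \<in> S" for p
  proof -
    have "?S3 (hd p) = ?S1 (hd p)"
      using S3o[of "hd p"] hd1[OF that] hd2[OF that] S2o[OF hdK2[OF that]] by (auto simp: P1_def)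
    moreover have "?S1 (hd p) \<subseteq> insert (hd p) {q ! 1 |q. q \<in> set Ls \<and> hd q = hd p}"
    proof (rule calls_subset[where K = "insert (hd p) {q ! 1 |q. q \<in> set Ls \<and> hd q = hd p}"])
      fix e assume "e \<in> set ?E1"
      then obtain q where q: "q \<in> set Ls" "e = {hd q, q ! 1}" by auto
      have "q ! 1 = r ! 1 \<Longrightarrow> r \<in> set Ls \<Longrightarrow> q = r" for r using eq11 q by blast
      moreover have "hd q \<noteq> r ! 1" if "r \<in> set Ls" for r using hd1[OF L(1)[OF q(1)] that] .
      moreover have "hd p \<noteq> q ! 1" using hd1[OF that q(1)] .
      ultimately show "e \<subseteq> insert (hd p) {q ! 1 |q. q \<in> set Ls \<and> hd q = hd p} \<or>
          e \<inter> insert (hd p) {q ! 1 |q. q \<in> set Ls \<and> hd q = hd p} = {}"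
        using q by (cases "hd q = hd p") auto
    qed auto
    ultimately show ?thesis by simp
  qed
  have S3inn: "?S3 v = {v}" if p: "p \<in> set Ss" "v \<in> set (interior p)" for p v
  proof -
    have "v \<noteq> q ! 1" "v \<noteq> q ! 2" if "q \<in> set Ls" for q
      using eq1[OF that Sh(1)[OF p(1)]] eq2[OF that Sh(1)[OF p(1)]] p(2) L(2)[OF that] Sh(2)[OF p(1)] by auto
    moreover have "v \<noteq> hd q" if "q \<in> S" for q using hd_not_inn[OF that Sh(1)[OF p(1)]] p(2) by auto
    ultimately have n: "v \<notin> hd ` set Ls" "v \<notin> P1" "\<And>q. q \<in> set Ls \<Longrightarrow> v \<noteq> q ! 2"
      using L(1) unfolding P1_def by blast+
    have "?S3 v = ?S2 v" by (rule S3o) (use n in blast)+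
    also have "\<dots> = ?S1 v" by (rule S2o[OF innK2[OF p]])
    also have "\<dots> = {v}" by (rule S1K[OF n(1,2)])
    finally show ?thesis .
  qed
  have nd4: "nodup ?S3 ?E4"
  proof (rule nodup_spider[where y = y])
    show "sorted_wrt (\<lambda>q q'. set q \<inter> set q' \<subseteq> {y}) Ss"
    proof (rule sorted_wrt_distinct[OF Ss(1)])
      fix p q assume pq: "p \<in> set Ss" "q \<in> set Ss" "p \<noteq> q"
      note p = Sh[OF pq(1)] and q = Sh[OF pq(2)]
      show "set p \<inter> set q \<subseteq> {y}"
        unfolding set_sail[OF p(1)] set_sail[OF q(1)]
        using interior_disjoint[OF p(1) q(1) pq(3)] short_hd[OF p(1) q(1) pq(3) p(2) q(2)]
          hd_not_inn[OF p(1) q(1)] hd_not_inn[OF q(1) p(1)] by blast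
    qed
    have *: "?S3 u \<inter> ?S3 v = {}" if m: "u \<noteq> v" "u = y \<or> (\<exists>p\<in>set Ss. u = hd p)" "v \<in> K4" "v \<noteq> y" for u v
    proof -
      have uu: "?S3 u \<subseteq> (if u = y then insert y K2 else insert u {q ! 1 |q. q \<in> set Ls \<and> hd q = u})"
        using m(2) S3y S3hd[OF Sh(1)] hd_not_y[OF Sh(1)] by auto
      obtain p where p: "p \<in> set Ss" "v = hd p \<or> v \<in> set (interior p)" using K4cases[OF m(3)] m(4) by auto
      show ?thesis
      proof (cases "v = hd p")
        case True
        let ?N = "\<lambda>v. {q ! 1 |q. q \<in> set Ls \<and> hd q = v}"
        have Sv: "?S3 v \<subseteq> insert v (?N v)" using S3hd[OF Sh(1)[OF p(1)]] True by simp
        have vK: "v \<notin> K2" using hdK2[OF Sh(1)[OF p(1)]] True by simp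
        have v1: "v \<noteq> q ! 1" if "q \<in> set Ls" for q using hd1[OF Sh(1)[OF p(1)] that] True by simp
        have "(if u = y then insert y K2 else insert u (?N u)) \<inter> insert v (?N v) = {}"
        proof (cases "u = y")
          case uy: True
          have "insert y K2 \<inter> insert v (?N v) = {}" using vK m(4) y12(1) P1K2 by blast
          then show ?thesis using uy by simp
        next
          case uy: False
          then have "u \<noteq> q ! 1" if "q \<in> set Ls" for q using m(2) hd1[OF Sh(1) that] by metis
          moreover have "?N u \<inter> ?N v = {}"
          proof (rule ccontr)
            assume "?N u \<inter> ?N v \<noteq> {}"
            then obtain q q' where "q \<in> set Ls" "q' \<in> set Ls" "q ! 1 = q' ! 1" "hd q = u" "hd q' = v" by blast
            then show False using eq11 m(1) by metis
          qed
          ultimately have "insert u (?N u) \<inter> insert v (?N v) = {}" using v1 m(1) by blast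
          then show ?thesis using uy by simp
        qed
        then show ?thesis using uu Sv by blast
      next
        case False
        then have v: "v \<in> set (interior p)" using p by simp
        have v1: "v \<noteq> q ! 1" if "q \<in> set Ls" for q
          using eq1[OF that Sh(1)[OF p(1)]] v L(2)[OF that] Sh(2)[OF p(1)] by auto
        have "v \<notin> (if u = y then insert y K2 else insert u {q ! 1 |q. q \<in> set Ls \<and> hd q = u})"
        proof (cases "u = y")
          case True
          then show ?thesis using innK2[OF p(1) v] m(4) by simp
        next
          case False
          then show ?thesis using v1 m(1) by simp
        qed
        then have "v \<notin> ?S3 u" by (rule contra_subsetD[OF uu])
        then show ?thesis using S3inn[OF p(1) v] by simp
      qed
    qed
    show "?S3 u \<inter> ?S3 v = {}" if uv: "u \<in> (\<Union>q\<in>set Ss. set q)" "v \<in> (\<Union>q\<in>set Ss. set q)" "u \<noteq> v" for u v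
    proof -
      have k: "u \<in> K4" "v \<in> K4" using uv by (simp_all add: K4_def)
      have c: "(w = y \<or> (\<exists>p\<in>set Ss. w = hd p)) \<or> (w \<noteq> y \<and> (\<exists>p\<in>set Ss. w \<in> set (interior p)))" if "w \<in> K4" for w
        using K4cases[OF that] by blast
      show ?thesis
      proof (cases "(u = y \<or> (\<exists>p\<in>set Ss. u = hd p)) \<or> (v = y \<or> (\<exists>p\<in>set Ss. v = hd p))")
        case True
        then show ?thesis
          using *[of u v] *[of v u] k uv(3) by (metis Int_commute)
      next
        case False
        then show ?thesis using c[OF k(1)] c[OF k(2)] S3inn uv(3) by auto
      qed
    qed
  qed (use distinct_sail Sh in auto)

  \<comment> \<open>Linked vertices share no information after all calls\<close>
  define es where "es = ?E1 @ ?E2 @ ?E3 @ ?E4"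
  have nd: "nodup own es"
    unfolding es_def nodup_append foldl_append using nd1 nd2 nd3 nd4 by simp
  have esT: "set es = T"
  proof -
    have "T = (\<Union>p\<in>set Ls. set (walk_edges p)) \<union> (\<Union>p\<in>set Ss. set (walk_edges p))"
      using SLS L Sh unfolding T_def by blast
    also have "(\<Union>p\<in>set Ls. set (walk_edges p)) = set ?E1 \<union> set ?E2 \<union> set ?E3"
    proof -
      have "set (walk_edges p) = {{hd p, p ! 1}, {p ! 1, p ! 2}} \<union> set (walk_edges (drop 2 p))" if "p \<in> set Ls" for p
        using drop_sail(5)[OF L[OF that]] by simp
      then show ?thesis by fastforce
    qed
    finally show ?thesis unfolding es_def by auto
  qed
  let ?A = "calls own es"
  \<comment> \<open>The start knows only itself and the second vertex, and these two names reach no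
    vertex beyond the third one, which is silent from then on. The second and third vertices are not
    linked to the start by girth 5.\<close>
  have long_apart: "?A (hd p) \<inter> ?A v = {}"
    if p: "p \<in> set Ls" and r: "rel (hd p) v" and v: "v \<noteq> hd p" for p v
  proof -
    let ?u = "hd p" and ?b = "p ! 1" and ?c = "p ! 2"
    have pS: "p \<in> S" using L[OF p] by simp
    have hq: "hd q \<noteq> ?u" if "q \<in> S" "q \<noteq> p" for q using unshared[OF pS r that(1)] that(2) by auto
    have "{?u, ?b} \<in> set (walk_edges p)" "{?b, ?c} \<in> set (walk_edges p)"
      using drop_sail(5)[OF L[OF p]] by simp_all
    then have "{?u, ?b} \<in> T" "{?b, ?c} \<in> T" using pS unfolding T_def by blast+
    moreover have "?u \<noteq> ?c" by (rule hd2[OF pS p])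
    ultimately have vb: "v \<noteq> ?b" "v \<noteq> ?c" using rel_T[of ?u ?b] rel_TT[of ?u ?b ?c] r by auto
    have ub: "?u \<notin> K2" "?b \<notin> K2" using hdK2[OF pS] P1K2[OF p] .
    have K4: "?u \<notin> K4" "?b \<notin> K4" "?c \<notin> K4"
    proof -
      show "?b \<notin> K4" "?c \<notin> K4" using innL[OF p] i1[OF p] i2[OF p] by auto
      show "?u \<notin> K4"
      proof
        assume "?u \<in> K4"
        then obtain q where q: "q \<in> set Ss" "?u = hd q \<or> ?u \<in> set (interior q)"
          using K4cases hd_not_y[OF pS] by auto
        then have "?u = hd q" using hd_not_inn[OF pS Sh(1)[OF q(1)]] by auto
        then have "q = p" using unshared[OF pS r Sh(1)[OF q(1)]] by simp
        then show False using L(2)[OF p] Sh(2)[OF q(1)] by simp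
      qed
    qed
    have E1: "e = {?u, ?b} \<or> e \<inter> {?u, ?b} = {}" if e: "e \<in> set ?E1" for e
    proof -
      obtain q where q: "q \<in> set Ls" "e = {hd q, q ! 1}" using e by auto
      show ?thesis
      proof (cases "q = p")
        case False
        then show ?thesis
          using q(2) hq[OF L(1)[OF q(1)]] hd1[OF pS q(1)] hd1[OF L(1)[OF q(1)] p] eq11[OF q(1) p] by auto
      qed (use q in simp)
    qed
    have E2: "e \<inter> {?u, ?b} = {}" if "e \<in> set ?E2" for e using E2K[OF that] ub by auto
    have E3: "e = {?b, ?c} \<or> e \<inter> {?u, ?b, ?c} = {}" if e: "e \<in> set ?E3" for e
    proof -
      obtain q where q: "q \<in> set Ls" "e = {q ! 1, q ! 2}" using e by auto
      show ?thesis
      proof (cases "q = p")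
        case False
        then have "q ! 1 \<noteq> ?b" "q ! 2 \<noteq> ?c" "q ! 1 \<noteq> ?c" "q ! 2 \<noteq> ?b" "q ! 1 \<noteq> ?u" "q ! 2 \<noteq> ?u"
          using eq11[OF q(1) p] eq22[OF q(1) p] neq12[OF q(1) p] neq12[OF p q(1)] hd1[OF pS q(1)] hd2[OF pS q(1)]
          by auto
        then show ?thesis using q(2) by auto
      qed (use q in simp)
    qed
    have E4: "e \<inter> {?u, ?b, ?c} = {}" if "e \<in> set ?E4" for e using E4K[OF that] K4 by auto
    have E12: "e = {?u, ?b} \<or> e \<inter> {?u, ?b} = {}" if "e \<in> set (?E1 @ ?E2)" for e
      using that E1 E2 by auto
    have E34: "e = {?b, ?c} \<or> e \<inter> {?u, ?b, ?c} = {}" if "e \<in> set (?E3 @ ?E4)" for e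
      using that E3 E4 by auto
    have A: "?A = calls (calls own (?E1 @ ?E2)) (?E3 @ ?E4)" by (simp add: es_def)
    have "?A ?u = calls own (?E1 @ ?E2) ?u"
      unfolding A
    proof (rule calls_untouched)
      have "?u \<notin> {?b, ?c}" using hd1[OF pS p] hd2[OF pS p] by simp
      then show "?u \<notin> \<Union> (set (?E3 @ ?E4))" using E34 by blast
    qed
    also have "\<dots> \<subseteq> {?u, ?b}"
      by (rule calls_subset[where K = "{?u, ?b}"]) (use E12 in blast)+
    finally have Au: "?A ?u \<subseteq> {?u, ?b}" .
    have 1: "calls own (?E1 @ ?E2) w \<subseteq> - {?u, ?b}" if "w \<in> - {?u, ?b}" for w
      by (rule calls_subset[where K = "- {?u, ?b}"]) (use E12 that in blast)+
    have "?A v \<subseteq> - {?u, ?b}"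
      unfolding A by (rule calls_subset[where K = "- {?u, ?b, ?c}"]) (use E34 1 v vb in blast)+
    then show ?thesis using Au by blast
  qed

  have unK: "w \<notin> \<Union> (set (?E1 @ ?E2 @ ?E3))" if p: "p \<in> set Ss" and un: "\<And>q. q \<in> S \<Longrightarrow> hd q = hd p \<Longrightarrow> q = p"
    and w: "w = hd p \<or> w \<in> set (interior p)" for p w
  proof -
    have pS: "p \<in> S" using Sh[OF p] by simp
    have "w \<notin> K2" using w hdK2[OF pS] innK2[OF p] by auto
    moreover have "w \<noteq> hd q \<and> w \<noteq> q ! 1 \<and> w \<noteq> q ! 2" if q: "q \<in> set Ls" for q
    proof -
      have "p \<noteq> q" using L(2)[OF q] Sh(2)[OF p] by auto
      then show ?thesis
        using w un[OF L(1)[OF q]] hd1[OF pS q] hd2[OF pS q] hd_not_inn[OF L(1)[OF q] pS]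
          eq1[OF q pS] eq2[OF q pS] by auto
    qed
    ultimately show ?thesis using E2K by auto
  qed
  have disS: "w \<notin> set q" if "p \<in> set Ss" "q \<in> set Ss" "p \<noteq> q" "w = hd p \<or> w \<in> set (interior p)" for p q w
  proof -
    note p = Sh[OF that(1)] and q = Sh[OF that(2)]
    have "w \<noteq> y" using that(4) hd_not_y[OF p(1)] y_not_inn[OF p(1)] by auto
    moreover have "w \<noteq> hd q"
      using that(4) short_hd[OF p(1) q(1) that(3) p(2) q(2)] hd_not_inn[OF q(1) p(1)] by auto
    moreover have "w \<notin> set (interior q)"
      using that(4) interior_disjoint[OF p(1) q(1) that(3)] hd_not_inn[OF p(1) q(1)] by auto
    ultimately show ?thesis using set_sail[OF q(1)] by simp
  qed
  have walks: "w \<notin> \<Union> (set (concat (map walk_edges qs)))" if "\<And>q. q \<in> set qs \<Longrightarrow> w \<notin> set q" for qs :: "'a list list" and w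
    using that walk_edges_subset by fastforce
  \<comment> \<open>An unshared start and its neighbour are untouched until the turn of
    \<open>p\<close>, and the start makes no call after its first one.\<close>
  have three: "?A (hd p) \<subseteq> {hd p, anchor p}"
    if p: "p \<in> set Ss" "length p = 3" and un: "\<And>q. q \<in> S \<Longrightarrow> hd q = hd p \<Longrightarrow> q = p" for p
  proof -
    have pS: "p \<in> S" using Sh[OF p(1)] by simp
    obtain a where a: "interior p = [a]" using length_inn[OF pS] p(2) by (cases "interior p") auto
    have pe: "p = [hd p, a, y]" using sail_form(1)[OF pS] a by simp
    have we: "walk_edges p = [{hd p, a}, {a, y}]" by (subst pe) simp
    have anchor: "anchor p = a" using anchor_eq[OF pS] a by simp
    obtain us vs where sp: "Ss = us @ p # vs" using p(1) by (auto dest: split_list)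
    have nin: "p \<notin> set us" "p \<notin> set vs" using Ss(1) sp by auto
    let ?F = "?E1 @ ?E2 @ ?E3 @ concat (map walk_edges us)"
    have esF: "es = ?F @ [{hd p, a}] @ ([{a, y}] @ concat (map walk_edges vs))"
      by (simp add: es_def sp we)
    have F: "calls own ?F w = {w}" if w: "w = hd p \<or> w = a" for w
    proof (rule calls_untouched)
      have "w \<notin> \<Union> (set (?E1 @ ?E2 @ ?E3))" using unK[OF p(1) un] w a by auto
      moreover have "w \<notin> \<Union> (set (concat (map walk_edges us)))"
      proof (rule walks)
        fix q assume "q \<in> set us"
        then show "w \<notin> set q" using disS[OF p(1), of q w] sp nin w a by auto
      qed
      ultimately show "w \<notin> \<Union> (set ?F)" by auto
    qed
    have rest: "hd p \<notin> \<Union> (set ([{a, y}] @ concat (map walk_edges vs)))"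
    proof -
      have "hd p \<notin> \<Union> (set (concat (map walk_edges vs)))"
      proof (rule walks)
        fix q assume "q \<in> set vs"
        then show "hd p \<notin> set q" using disS[OF p(1), of q "hd p"] sp nin by auto
      qed
      moreover have "hd p \<noteq> a" "hd p \<noteq> y" using hd_not_y[OF pS] hd_not_inn[OF pS pS] a by auto
      ultimately show ?thesis by auto
    qed
    have "?A (hd p) = call (calls own ?F) {hd p, a} (hd p)"
      unfolding esF foldl_append[of call own] using calls_untouched[OF rest] by simp
    also have "\<dots> = {hd p, a}" using F by (auto simp: call_def)
    finally show ?thesis using anchor by simp
  qed

  \<comment> \<open>The names of the two vertices known to \<open>hd p\<close> get around only from
    the calls along \<open>p\<close> on. By then \<open>anchor q\<close> has made its last call:
    before all short sails if \<open>q\<close> is long, and by \<open>ord\<close> if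
    \<open>q\<close> is short.\<close>
  have apartD: "?A (hd p) \<inter> ?A (anchor q) = {}"
    if p: "p \<in> S" and q: "q \<in> S" and must_precede: "must_precede q p" and un: "\<And>q. q \<in> S \<Longrightarrow> hd q = hd p \<Longrightarrow> q = p" for p q
  proof -
    have lp: "length p = 3" and qp: "q \<noteq> p" using must_precede by (auto simp: must_precede_def)
    have pSs: "p \<in> set Ss" using Ss(2) p lp by simp
    obtain a where a: "interior p = [a]" using length_inn[OF p] lp by (cases "interior p") auto
    have anchor: "anchor p = a" using anchor_eq[OF p] a by simp
    have Ap: "?A (hd p) \<subseteq> {hd p, a}" using three[OF pSs lp un] anchor by simp
    have aq: "anchor q \<in> - {hd p, a}"
      using anchor_cases[OF q] hd_not_inn[OF p q] un[OF q] qp interior_eq[OF p q, of a] hd_not_inn[OF q p] a by auto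
    have E: "e \<subseteq> - {hd p, a}" if "e \<in> set (?E1 @ ?E2 @ ?E3)" for e
      using unK[OF pSs un, of "hd p"] unK[OF pSs un, of a] that a by auto
    have "?A (anchor q) \<subseteq> - {hd p, a}"
    proof (cases "q \<in> set Ls")
      case True
      then have "interior q \<noteq> []" using i1 by force
      then have "anchor q \<in> set (interior q)" using anchor_cases[OF q] by simp
      then have "anchor q \<notin> \<Union> (set ?E4)" using innL[OF True] E4K by blast
      then have "?A (anchor q) = calls own (?E1 @ ?E2 @ ?E3) (anchor q)"
        using calls_untouched[of "anchor q" ?E4 "calls own (?E1 @ ?E2 @ ?E3)"] by (simp add: es_def)
      also have "\<dots> \<subseteq> - {hd p, a}"
        by (rule calls_subset[where K = "- {hd p, a}"]) (use E aq in blast)+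
      finally show ?thesis .
    next
      case False
      then have qS: "q \<in> set Ss" using SLS[OF q] by simp
      obtain us vs where sp: "Ss = us @ q # vs" using qS by (auto dest: split_list)
      have "p \<notin> set us" using ord[OF sp] must_precede by blast
      then have pu: "p \<notin> set (us @ [q])" using qp by simp
      have qv: "q \<notin> set vs" using Ss(1) sp by auto
      let ?F = "?E1 @ ?E2 @ ?E3 @ concat (map walk_edges (us @ [q]))"
      have es: "es = ?F @ concat (map walk_edges vs)" by (simp add: es_def sp)
      have "anchor q \<notin> \<Union> (set (concat (map walk_edges vs)))"
      proof (rule walks)
        fix r assume r: "r \<in> set vs"
        then have "r \<in> set Ss" "q \<noteq> r" using sp qv by auto
        then show "anchor q \<notin> set r" using disS[OF qS, of r "anchor q"] anchor_cases[OF q] by auto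
      qed
      then have "?A (anchor q) = calls own ?F (anchor q)"
        unfolding es foldl_append[of call own ?F] by (rule calls_untouched)
      also have "\<dots> \<subseteq> - {hd p, a}"
      proof (rule calls_subset[where K = "- {hd p, a}"])
        fix e assume "e \<in> set ?F"
        then consider "e \<in> set (?E1 @ ?E2 @ ?E3)" | r where "r \<in> set (us @ [q])" "e \<in> set (walk_edges r)"
          by auto
        then show "e \<subseteq> - {hd p, a} \<or> e \<inter> - {hd p, a} = {}"
        proof cases
          case 2
          then have "r \<in> set Ss" "p \<noteq> r" using sp pu by auto
          then have "hd p \<notin> set r" "a \<notin> set r" using disS[OF pSs, of r] a by auto
          then show ?thesis using walk_edges_subset[OF 2(2)] by blast
        qed (use E in blast)
      qed (use aq in auto)
      finally show ?thesis .
    qed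
    then show ?thesis using Ap by blast
  qed

  have apart1: "?A (hd p) \<inter> ?A v = {}" if p: "p \<in> S" and v: "v \<in> X" "v \<noteq> hd p" and r: "rel (hd p) v" for p v
  proof (cases "4 \<le> length p")
    case True
    then show ?thesis using long_apart[OF _ r v(2)] p Ls(2) by simp
  next
    case False
    have un: "q = p" if "q \<in> S" "hd q = hd p" for q using unshared[OF p r that] .
    obtain q where q: "q \<in> S" "q \<noteq> p" and c: "v = hd q \<and> 4 \<le> length q \<or> v = hd q \<and> length q = 3 \<and> length p = 3 \<or>
      v = anchor q \<and> must_precede q p \<or> v = hd q \<and> hd p = anchor p \<and> must_precede p q"
      using rel_short[OF p _ v r] False by auto
    have unq: "q' = q" if "v = hd q" "q' \<in> S" "hd q' = hd q" for q'
      using unshared[OF q(1), of "hd p" q'] r rel_sym that by simp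
    from c show ?thesis
    proof (elim disjE conjE)
      assume a: "v = hd q" "4 \<le> length q"
      then have "?A (hd q) \<inter> ?A (hd p) = {}"
        using long_apart[of q "hd p"] q(1) Ls(2) r v(2) rel_sym by auto
      then show ?thesis using a by auto
    next
      assume a: "v = hd q" "length q = 3" "length p = 3"
      then have m: "p \<in> set Ss" "q \<in> set Ss" using p q Ss(2) by auto
      have ai: "anchor p \<in> set (interior p)" "anchor q \<in> set (interior q)"
        using anchor_cases[OF p] anchor_cases[OF q(1)] length_inn[OF p] length_inn[OF q(1)] a by auto
      have "anchor p \<noteq> hd q" "anchor q \<noteq> hd p" using ai hd_not_inn[OF p q(1)] hd_not_inn[OF q(1) p] by auto
      moreover have "anchor p \<noteq> anchor q" using anchor_inj[OF p q(1)] q(2) by auto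
      ultimately have "{hd p, anchor p} \<inter> {hd q, anchor q} = {}" using a(1) v(2) by auto
      then show ?thesis
        using three[OF m(1) a(3) un] three[OF m(2) a(2) unq[OF a(1)]] a(1) by blast
    next
      assume a: "v = anchor q" "must_precede q p"
      then show ?thesis using apartD[OF p q(1) a(2) un] by simp
    next
      assume a: "v = hd q" "hd p = anchor p" "must_precede p q"
      have "?A (hd q) \<inter> ?A (anchor p) = {}" by (rule apartD[OF q(1) p a(3) unq[OF a(1)]])
      then show ?thesis using a by auto
    qed
  qed
  have apart: "?A u \<inter> ?A v = {}" if uv: "u \<in> X" "v \<in> X" "u \<noteq> v" "rel u v" for u v
    using rel_hd[OF uv] apart1[of _ v] apart1[of _ u] uv rel_sym[of u v] by blast
  show False
  proof (rule extension[of X es])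
    show "\<Union> (set es) \<subseteq> X" unfolding esT using T_X by blast
    show "?A u \<inter> ?A v = {}" if "u \<in> X" "v \<in> X" "adj u v" "{u, v} \<notin> set es" for u v
    proof (rule apart)
      show "u \<noteq> v" using adjD[OF that(3)] by simp
      show "rel u v" using that esT by (simp add: rel_def)
    qed (use that in simp_all)
    show "?A u \<inter> ?A v = {}" if "u \<in> X" "v \<in> X" "u \<noteq> v" "w \<notin> X" "adj u w" "adj v w" for u v w
      using apart[of u v] that by (auto simp: rel_def)
    show "c = d" if "v \<in> X" "adj v c" "adj v d" "{v, c} \<notin> set es" "{v, d} \<notin> set es" for v c d
      using T_deg that esT by blast
  qed (use XV in_X(3) nd esT T_edges in auto)
qed

end

section \<open>Anchored cycles\<close>

lemma walk_edges_nth: "set (walk_edges l) = {{l ! i, l ! Suc i} |i. Suc i < length l}"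
proof (induction l rule: walk_edges.induct)
  case (1 x y xs)
  have "{{(x # y # xs) ! i, (x # y # xs) ! Suc i} |i. Suc i < length (x # y # xs)} =
    insert {x, y} {{(y # xs) ! i, (y # xs) ! Suc i} |i. Suc i < length (y # xs)}" (is "?L = ?R")
  proof (intro equalityI subsetI)
    fix e assume "e \<in> ?L"
    then obtain i where i: "e = {(x # y # xs) ! i, (x # y # xs) ! Suc i}" "Suc i < length (x # y # xs)" by blast
    show "e \<in> ?R"
    proof (cases i)
      case (Suc j)
      then have "e = {(y # xs) ! j, (y # xs) ! Suc j}" "Suc j < length (y # xs)" using i by simp_all
      then show ?thesis by blast
    qed (use i in simp)
  next
    fix e assume "e \<in> ?R"
    then consider "e = {x, y}" | i where "e = {(y # xs) ! i, (y # xs) ! Suc i}" "Suc i < length (y # xs)" by blast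
    then show "e \<in> ?L"
    proof cases
      case 1
      then have "e = {(x # y # xs) ! 0, (x # y # xs) ! Suc 0}" "Suc 0 < length (x # y # xs)" by simp_all
      then show ?thesis by blast
    next
      case (2 i)
      then have "e = {(x # y # xs) ! Suc i, (x # y # xs) ! Suc (Suc i)}" "Suc (Suc i) < length (x # y # xs)" by simp_all
      then show ?thesis by blast
    qed
  qed
  then show ?case using 1 by simp
qed auto

lemma cycle_edges_map:
  assumes "0 < m"
  shows "cycle_edges (map g [0..<m]) = {{g i, g (Suc i mod m)} |i. i < m}"
proof -
  let ?c = "map g [0..<m]"
  have h: "hd ?c = g 0" using assms by (simp add: hd_map)
  have conv: "{F i |i. i < m} = F ` {..<m}" for F :: "nat \<Rightarrow> 'a set" by auto
  have *: "(?c @ [hd ?c]) ! i = g i" "(?c @ [hd ?c]) ! Suc i = g (Suc i mod m)" if "i < m" for i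
  proof -
    show "(?c @ [hd ?c]) ! i = g i" using that by (simp add: nth_append)
    show "(?c @ [hd ?c]) ! Suc i = g (Suc i mod m)"
    proof (cases "Suc i = m")
      case False
      then have "Suc i < m" using that by simp
      then show ?thesis by (simp add: nth_append)
    qed (use h in \<open>simp add: nth_append\<close>)
  qed
  have "cycle_edges ?c = {{(?c @ [hd ?c]) ! i, (?c @ [hd ?c]) ! Suc i} |i. i < m}"
    unfolding cycle_edges_def walk_edges_nth by simp
  also have "\<dots> = (\<lambda>i. {(?c @ [hd ?c]) ! i, (?c @ [hd ?c]) ! Suc i}) ` {..<m}" by (rule conv)
  also have "\<dots> = (\<lambda>i. {g i, g (Suc i mod m)}) ` {..<m}"
    by (rule image_cong) (simp_all only: * lessThan_iff)
  finally show ?thesis unfolding conv .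
qed

text \<open>The cycle is indexed by a function whose anchors sit at the multiples of 3. As its
  length is a multiple of 3, divisibility of an index by 3 survives reduction modulo the
  length.\<close>

lemma anchored_cycle_map:
  assumes n: "2 \<le> n" and inj: "inj_on g {..<3 * n}" and z: "z \<notin> g ` {..<3 * n}"
  shows "anchored_cycle n \<lparr>vertices = insert z (g ` {..<3 * n}),
    edges = {{g i, g (Suc i mod (3 * n))} |i. i < 3 * n} \<union> {{z, g (3 * t)} |t. t < n}\<rparr>"
proof -
  let ?c = "map g [0..<3 * n]" and ?A = "(\<lambda>t. g (3 * t)) ` {..<n}"
  have mem: "3 dvd i" if i: "i < 3 * n" "g i \<in> ?A" for i
  proof -
    obtain t where "t < n" "g i = g (3 * t)" using i(2) by auto
    then have "i = 3 * t" using inj_onD[OF inj, of i "3 * t"] i(1) by auto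
    then show ?thesis by simp
  qed
  have mem': "g i \<in> ?A" if "i < 3 * n" "3 dvd i" for i
    using that by (auto elim!: dvdE)
  have d3: "d = 3" if "next_anchor ?c ?A i d" for i d
  proof -
    have len: "length ?c = 3 * n" by simp
    have i: "i < 3 * n" "0 < d" "?c ! i \<in> ?A" "?c ! ((i + d) mod (3 * n)) \<in> ?A"
      and lst: "\<And>j. 0 < j \<Longrightarrow> j < d \<Longrightarrow> ?c ! ((i + j) mod (3 * n)) \<notin> ?A"
      using that unfolding next_anchor_def len by blast+
    have lt: "k mod (3 * n) < 3 * n" for k using n by simp
    have nth: "?c ! (k mod (3 * n)) = g (k mod (3 * n))" for k using lt[of k] by simp
    have dm: "3 dvd k mod (3 * n) \<longleftrightarrow> 3 dvd k" for k by (simp add: dvd_mod_iff)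
    have "3 dvd i" using mem[of i] i by simp
    moreover have "3 dvd i + d" using mem[OF lt] i(4) dm unfolding nth by blast
    ultimately have "3 dvd d" by (simp add: dvd_add_right_iff)
    have "\<not> 3 < d"
    proof
      assume "3 < d"
      then have "g ((i + 3) mod (3 * n)) \<notin> ?A" using lst[of 3] nth[of "i + 3"] by simp
      moreover have "3 dvd (i + 3) mod (3 * n)" using dm \<open>3 dvd i\<close> by simp
      ultimately show False using mem'[OF lt] by blast
    qed
    then show ?thesis using \<open>3 dvd d\<close> i(2) by (auto elim!: dvdE)
  qed
  have "inj_on (\<lambda>t. g (3 * t)) {..<n}"
  proof (rule inj_onI)
    fix x y assume xy: "x \<in> {..<n}" "y \<in> {..<n}" "g (3 * x) = g (3 * y)"
    have "3 * x = 3 * y" by (rule inj_onD[OF inj xy(3)]) (use xy in auto)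
    then show "x = y" by simp
  qed
  then have "card ?A = n" by (simp add: card_image)
  moreover have "?A \<subseteq> set ?c" by auto
  moreover have "cycle_edges ?c = {{g i, g (Suc i mod (3 * n))} |i. i < 3 * n}"
    using cycle_edges_map[of "3 * n" g] n by simp
  moreover have "{{z, a} |a. a \<in> ?A} = {{z, g (3 * t)} |t. t < n}" by auto
  moreover have "distinct ?c" using inj by (simp add: distinct_map atLeast0LessThan)
  moreover have "set ?c = g ` {..<3 * n}" by (simp add: atLeast0LessThan)
  ultimately show ?thesis
    unfolding anchored_cycle_def using z d3
    by (intro exI[of _ ?c] exI[of _ z] exI[of _ ?A]) simp
qed

text \<open>Iterates of a map on a finite set recur; the least period of a recurrent point gives
  injectivity. The sequence is defined for all indices, so that successors need no reduction modulo
  \<open>n\<close>.\<close>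

lemma periodic_point:
  assumes "finite B" "B \<noteq> {}" and pr: "\<And>b. b \<in> B \<Longrightarrow> h b \<in> B"
  obtains s :: "nat \<Rightarrow> 'a" and n where "0 < n" "\<And>t. s t \<in> B" "\<And>t. s (Suc t) = h (s t)" "s n = s 0" "inj_on s {..<n}"
proof -
  obtain b where b: "b \<in> B" using assms by blast
  have B: "(h ^^ t) c \<in> B" if "c \<in> B" for t c using that pr by (induction t) auto
  have "\<not> inj (\<lambda>t. (h ^^ t) b)"
  proof
    assume "inj (\<lambda>t. (h ^^ t) b)"
    then have "infinite (range (\<lambda>t. (h ^^ t) b))" using finite_imageD by fastforce
    moreover have "range (\<lambda>t. (h ^^ t) b) \<subseteq> B" using B[OF b] by auto
    ultimately show False using assms(1) finite_subset by blast
  qed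
  then obtain i j where ij: "(h ^^ i) b = (h ^^ j) b" "i < j"
    unfolding inj_def by (metis linorder_neqE_nat)
  define z where "z = (h ^^ i) b"
  have zB: "z \<in> B" unfolding z_def by (rule B[OF b])
  have "(h ^^ (j - i)) z = (h ^^ (j - i + i)) b" unfolding z_def funpow_add by simp
  then have ex: "0 < j - i \<and> (h ^^ (j - i)) z = z" using ij z_def by simp
  define n where "n = (LEAST n. 0 < n \<and> (h ^^ n) z = z)"
  have n: "0 < n" "(h ^^ n) z = z" using LeastI[of "\<lambda>n. 0 < n \<and> (h ^^ n) z = z", OF ex] by (auto simp: n_def)
  have least: "\<not> (0 < k \<and> (h ^^ k) z = z)" if "k < n" for k
    using not_less_Least[of k "\<lambda>n. 0 < n \<and> (h ^^ n) z = z"] that by (simp add: n_def)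
  have neq: "(h ^^ s) z \<noteq> (h ^^ t) z" if "s < t" "t < n" for s t
  proof
    assume "(h ^^ s) z = (h ^^ t) z"
    then have "(h ^^ (n - t)) ((h ^^ s) z) = (h ^^ (n - t + t)) z" unfolding funpow_add by simp
    moreover have "(h ^^ (n - t + s)) z = (h ^^ (n - t)) ((h ^^ s) z)" by (simp only: funpow_add comp_apply)
    ultimately have "(h ^^ (n - t + s)) z = z" using n that by simp
    moreover have "n - t + s < n" "0 < n - t + s" using that by linarith+
    ultimately show False using least by blast
  qed
  show thesis
  proof (rule that[of n "\<lambda>t. (h ^^ t) z"])
    show "inj_on (\<lambda>t. (h ^^ t) z) {..<n}"
      by (rule inj_onI) (metis neq lessThan_iff linorder_neqE_nat)
  qed (use n B[OF zB] in auto)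
qed

context sails begin

text \<open>Flags are given here by two witnessing neighbours instead of a cardinality.\<close>

definition closure_set :: "'a set" where
  "closure_set = X \<union> {w. \<exists>u v. u \<in> X \<and> v \<in> X \<and> u \<noteq> v \<and> adj u w \<and> adj v w}"

definition has_anchored_cycle :: bool where
  "has_anchored_cycle \<longleftrightarrow> (\<exists>k H. 2 \<le> k \<and> anchored_cycle k H \<and> induced_subgraph H (windmill_closure G (induce G X)))"

lemma closure_set_closure: "closure_set \<subseteq> vertices (windmill_closure G (induce G X))"
proof
  fix w assume w: "w \<in> closure_set"
  have vX: "vertices (induce G X) = X" using XV by (auto simp: induce_def)
  show "w \<in> vertices (windmill_closure G (induce G X))"
  proof (cases "w \<in> X")
    case True
    then show ?thesis using XV vX by (auto simp: windmill_closure_def induce_def)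
  next
    case False
    then obtain u v where uv: "u \<in> X" "v \<in> X" "u \<noteq> v" "adj u w" "adj v w" using w by (auto simp: closure_set_def)
    have "{u, v} \<subseteq> neighbors G w \<inter> X" using uv adjD by (auto simp: neighbors_def)
    moreover have "finite (neighbors G w \<inter> X)"
      using finite_subset[OF XV finite_vertices] by simp
    ultimately have "card {u, v} \<le> card (neighbors G w \<inter> X)" by (rule card_mono[rotated])
    then have "flag G (induce G X) w"
      using uv False adjD[OF uv(4)] by (simp add: flag_def vX)
    moreover have "w \<in> vertices G" using adjD[OF uv(4)] by simp
    ultimately show ?thesis by (simp add: windmill_closure_def induce_def)
  qed
qed

text \<open>The closure is induced in \<open>G\<close>, so the edges of an induced subgraph of it
  can be compared with those of \<open>G\<close> itself.\<close>

lemma has_anchored_cycleI: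
  assumes n: "2 \<le> n" and inj: "inj_on g {..<3 * n}" and z: "z \<notin> g ` {..<3 * n}"
    and sub: "insert z (g ` {..<3 * n}) \<subseteq> closure_set"
    and E: "\<And>i. i < 3 * n \<Longrightarrow> adj (g i) (g (Suc i mod (3 * n)))" "\<And>t. t < n \<Longrightarrow> adj z (g (3 * t))"
    and I: "\<And>u v. u \<in> insert z (g ` {..<3 * n}) \<Longrightarrow> v \<in> insert z (g ` {..<3 * n}) \<Longrightarrow> adj u v \<Longrightarrow>
      {u, v} \<in> {{g i, g (Suc i mod (3 * n))} |i. i < 3 * n} \<union> {{z, g (3 * t)} |t. t < n}"
  shows has_anchored_cycle
proof -
  let ?V = "insert z (g ` {..<3 * n})"
  let ?F = "{{g i, g (Suc i mod (3 * n))} |i. i < 3 * n} \<union> {{z, g (3 * t)} |t. t < n}"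
  let ?K = "windmill_closure G (induce G X)"
  have VK: "?V \<subseteq> vertices ?K" using sub closure_set_closure by blast
  have FV: "e \<subseteq> ?V" if "e \<in> ?F" for e
    using that n by fastforce
  have FE: "e \<in> ?F" if e: "e \<in> edges G" "e \<subseteq> ?V" for e
  proof -
    obtain u v where uv: "e = {u, v}" "adj u v" using e(1) by (rule edgeE)
    show ?thesis unfolding uv(1) by (rule I) (use uv e(2) in \<open>simp_all only: insert_subset\<close>)
  qed
  have EF: "e \<in> edges G" if "e \<in> ?F" for e
    using that
  proof
    assume "e \<in> {{g i, g (Suc i mod (3 * n))} |i. i < 3 * n}"
    then show ?thesis using E(1) by (elim CollectE exE conjE) simp
  next
    assume "e \<in> {{z, g (3 * t)} |t. t < n}"
    then show ?thesis using E(2) by (elim CollectE exE conjE) simp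
  qed
  have "edges (induce ?K ?V) = {e \<in> edges G. e \<subseteq> ?V}"
  proof -
    obtain Y where Y: "?K = induce G Y" unfolding windmill_closure_def by blast
    then have "?V \<subseteq> Y" using VK by (simp add: induce_def)
    then have "e \<subseteq> Y" if "e \<subseteq> ?V" for e using that by (rule order_trans[rotated])
    then show ?thesis by (subst Y) (auto simp: induce_def)
  qed
  also have "\<dots> = ?F"
  proof (rule set_eqI)
    fix e
    show "e \<in> {e \<in> edges G. e \<subseteq> ?V} \<longleftrightarrow> e \<in> ?F"
      using FE[of e] EF[of e] FV[of e] unfolding mem_Collect_eq[of e "\<lambda>e. e \<in> edges G \<and> e \<subseteq> ?V"] by iprover
  qed
  finally have "edges (induce ?K ?V) = ?F" .
  moreover have "vertices (induce ?K ?V) = ?V" using VK by (auto simp: induce_def)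
  ultimately have "induce ?K ?V = \<lparr>vertices = ?V, edges = ?F\<rparr>" by simp
  then have "induced_subgraph \<lparr>vertices = ?V, edges = ?F\<rparr> ?K"
    unfolding induced_subgraph_def using VK by metis
  moreover have "anchored_cycle n \<lparr>vertices = ?V, edges = ?F\<rparr>"
    by (rule anchored_cycle_map[OF n inj z])
  ultimately show ?thesis unfolding has_anchored_cycle_def using n by blast
qed

text \<open>Two 5-cycles sharing a path of length 2; girth 5 excludes all further edges.\<close>

lemma theta_found:
  assumes a: "adj c0 c1" "adj c1 c2" "adj c2 c3" "adj c3 c4" "adj c4 c5" "adj c5 c0" "adj z c0" "adj z c3"
    and d: "distinct [c0, c1, c2, c3, c4, c5, z]" and sub: "set [c0, c1, c2, c3, c4, c5, z] \<subseteq> closure_set"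
  shows has_anchored_cycle
proof -
  let ?l = "[c0, c1, c2, c3, c4, c5]"
  have six: "{..<6::nat} = {0, 1, 2, 3, 4, 5}" by auto
  have img: "(!) ?l ` {..<3 * 2} = {c0, c1, c2, c3, c4, c5}" by (simp add: six)
  have n: "\<not> adj c0 c2" "\<not> adj c0 c3" "\<not> adj c0 c4" "\<not> adj c1 c3" "\<not> adj c1 c4" "\<not> adj c1 c5"
    "\<not> adj c2 c4" "\<not> adj c2 c5" "\<not> adj c3 c5" "\<not> adj z c1" "\<not> adj z c2" "\<not> adj z c4" "\<not> adj z c5"
    using a d no_triangle[of c0 c1 c2] no_triangle[of c0 z c3] no_triangle[of c0 c5 c4] no_triangle[of c1 c2 c3]
      no_square[of c1 c2 c3 c4] no_triangle[of c1 c0 c5] no_triangle[of c2 c3 c4] no_square[of c2 c1 c0 c5]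
      no_triangle[of c3 c4 c5] no_triangle[of z c0 c1] no_triangle[of z c3 c2] no_triangle[of z c3 c4]
      no_triangle[of z c0 c5]
    by (simp_all add: insert_commute) metis+
  have F: "{{?l ! i, ?l ! (Suc i mod (3 * 2))} |i. i < 3 * 2} \<union> {{z, ?l ! (3 * t)} |t. t < (2::nat)} =
    {{z, c0}, {z, c3}, {c0, c1}, {c1, c2}, {c2, c3}, {c3, c4}, {c4, c5}, {c5, c0}}"
  proof -
    have conv: "{f i |i. i < m} = f ` {..<m}" for f :: "nat \<Rightarrow> 'a set" and m by auto
    have "{..<2::nat} = {0, 1}" by auto
    then show ?thesis unfolding conv by (simp add: six)
  qed
  show ?thesis
  proof (rule has_anchored_cycleI[of 2 "(!) ?l" z])
    show "inj_on ((!) ?l) {..<3 * 2}" by (rule inj_on_nth) (use d in auto)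
    show "z \<notin> (!) ?l ` {..<3 * 2}" unfolding img using d by auto
    show "insert z ((!) ?l ` {..<3 * 2}) \<subseteq> closure_set" unfolding img using sub by simp
    have all: "{{?l ! i, ?l ! (Suc i mod (3 * 2))} |i. i < 3 * 2} \<union> {{z, ?l ! (3 * t)} |t. t < (2::nat)} \<subseteq> edges G"
      unfolding F using a by simp
    then show "adj (?l ! i) (?l ! (Suc i mod (3 * 2)))" if "i < 3 * 2" for i using that by blast
    show "adj z (?l ! (3 * t))" if "t < 2" for t using that all by blast
    fix u v assume uv: "u \<in> insert z ((!) ?l ` {..<3 * 2})" "v \<in> insert z ((!) ?l ` {..<3 * 2})" "adj u v"
    have "u \<noteq> v" using adjD uv by blast
    then show "{u, v} \<in> {{?l ! i, ?l ! (Suc i mod (3 * 2))} |i. i < 3 * 2} \<union> {{z, ?l ! (3 * t)} |t. t < (2::nat)}"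
      unfolding F using uv(3) n uv(1,2)[unfolded img]
      by (elim insertE emptyE; simp add: insert_commute)
  qed simp
qed

text \<open>Following \<open>must_precede\<close> backwards inside \<open>B\<close> eventually
  cycles. Each step contributes a flag \<open>f t\<close> between the start \<open>x t\<close> and
  the anchor \<open>a (Suc t)\<close> of the next sail.\<close>

lemma ring_found:
  assumes B: "B \<subseteq> {p \<in> S. length p < 4}" "B \<noteq> {}" and pred: "\<And>p. p \<in> B \<Longrightarrow> \<exists>q\<in>B. must_precede q p"
  shows has_anchored_cycle
proof -
  define h where "h p = (SOME q. q \<in> B \<and> must_precede q p)" for p
  have h: "h p \<in> B \<and> must_precede (h p) p" if "p \<in> B" for p
    unfolding h_def by (rule someI_ex) (use pred[OF that] in blast)
  have "finite B" by (rule finite_subset[OF B(1)]) (simp add: finS)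
  then obtain s n where n: "0 < n" and sB: "\<And>t. s t \<in> B" and sS: "\<And>t. s (Suc t) = h (s t)"
    and sn: "s n = s 0" and inj: "inj_on s {..<n}"
    using periodic_point[of B h] B(2) h by metis
  have Ds: "must_precede (s (Suc t)) (s t)" for t using h[OF sB] sS by simp
  have S: "s t \<in> S" for t using sB B(1) by blast
  have len: "length (s t) = 3" and neq: "s (Suc t) \<noteq> s t" for t using Ds[of t] by (simp_all add: must_precede_def)
  have n2: "2 \<le> n"
  proof (rule ccontr)
    assume "\<not> 2 \<le> n"
    then have "n = 1" using n by simp
    then show False using neq[of 0] sn by simp
  qed
  have smod: "s (Suc t mod n) = s (Suc t)" if "t < n" for t
    using that sn by (cases "Suc t = n") auto
  define a where "a t = anchor (s t)" for t
  define x where "x t = hd (s t)" for t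
  obtain f where f: "\<And>t. f t \<notin> X" "\<And>t. adj (x t) (f t)" "\<And>t. adj (a (Suc t)) (f t)"
    using Ds unfolding must_precede_def a_def x_def by metis
  have interior: "interior (s t) = [a t]" for t
  proof -
    obtain b where "interior (s t) = [b]" using length_inn[OF S, of t] len[of t] by (cases "interior (s t)") auto
    then show ?thesis using anchor_eq[OF S, of t] by (simp add: a_def)
  qed
  have xa: "adj (x t) (a t)" and xaT: "{x t, a t} \<in> T" for t
    using tip_edge[OF S, of t] interior[of t] by (simp_all add: nxt_def x_def)
  have ay: "adj (a t) y" for t using anchor_y(1)[OF S] by (simp add: a_def)
  have dx: "degree G (x t) = 2" for t using degs(1)[OF S] by (simp add: x_def)
  have da: "degree G (a t) = 3" for t using degs(2)[OF S, of "a t" t] interior[of t] by simp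
  have aX: "a t \<in> X" "x t \<in> X" for t
    using in_X(2)[OF S, of "a t" t] in_X(1)[OF S, of t] interior[of t] by (simp_all add: x_def)
  have xy: "x t \<noteq> y" "a t \<noteq> y" "x t \<noteq> a u" for t u using dx[of t] da[of t] da[of u] deg_y4 by auto
  have fX: "f t \<noteq> v" if "v \<in> X" for t v using f(1) that by blast
  have xinj: "s t = s u" if "x t = x u" for t u
    using short_hd[OF S S, of t u] that len unfolding x_def by auto
  have ainj: "s t = s u" if "a t = a u" for t u
    using anchor_inj[OF S S] that unfolding a_def by blast
  have sinj: "t = u" if "s t = s u" "t < n" "u < n" for t u using inj_onD[OF inj that(1)] that by simp
  have ssuc: "t = u" if e: "s (Suc t) = s (Suc u)" and lt: "t < n" "u < n" for t u
  proof -
    have "s (Suc t mod n) = s (Suc u mod n)" using e smod lt by simp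
    then have "Suc t mod n = Suc u mod n" by (rule sinj) (use n in simp_all)
    then show ?thesis using lt by (cases "Suc t = n"; cases "Suc u = n") auto
  qed
  \<comment> \<open>One flag adjacent to two different anchors would close a square through
    \<open>y\<close>; this makes the flags of the ring distinct.\<close>
  have sq: "a (Suc t) = a (Suc u)" if "f t = f u" for t u
    using no_square[of "a (Suc t)" "f t" "a (Suc u)" y] f(3)[of t] f(3)[of u] ay[of "Suc t"] ay[of "Suc u"]
      that fX[OF in_X(3)] by (auto simp: insert_commute)
  have finj: "t = u" if "f t = f u" "t < n" "u < n" for t u
    using ssuc[OF ainj[OF sq[OF that(1)]] that(2,3)] .
  have fcl: "f t \<in> closure_set" for t
    unfolding closure_set_def using f(2,3)[of t] aX xy(3) by blast
  have Xcl: "X \<subseteq> closure_set" by (auto simp: closure_set_def)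
  show has_anchored_cycle
  proof (cases "\<exists>t u. t < n \<and> u < n \<and> adj (f t) (f u)")
    case True
    then obtain t u where tu: "t < n" "u < n" "adj (f t) (f u)" by blast
    have ft: "f t \<noteq> f u" using adjD[OF tu(3)] by simp
    have 1: "a (Suc u) \<noteq> a (Suc t)"
      using no_triangle[of "a (Suc t)" "f t" "f u"] f(3)[of t] f(3)[of u] tu(3) by (auto simp: insert_commute)
    have 2: "a (Suc u) \<noteq> a t"
      using no_square[of "a t" "x t" "f t" "f u"] f(2)[of t] f(3)[of u] tu(3) xa[of t] fX[OF aX(1), of t t] fX[OF aX(2), of u t]
      by (auto simp: insert_commute)
    have 3: "a t \<noteq> a (Suc t)" using ainj[of t "Suc t"] neq[of t] by auto
    show ?thesis
    \<comment> \<open>The two 5-cycles are \<open>y, a t, x t, f t, a (Suc t)\<close> and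
      \<open>y, a (Suc u), f u, f t, a (Suc t)\<close>; they share the path from \<open>y\<close> to
      \<open>f t\<close> through \<open>a (Suc t)\<close>.\<close>
    proof (rule theta_found[of y "a t" "x t" "f t" "f u" "a (Suc u)" "a (Suc t)"])
      show "distinct [y, a t, x t, f t, f u, a (Suc u), a (Suc t)]"
        using 1 2 3 ft xy(1)[of t] xy(2)[of t] xy(2)[of "Suc u"] xy(2)[of "Suc t"]
          xy(3)[of t t] xy(3)[of t "Suc u"] xy(3)[of t "Suc t"]
          fX[OF in_X(3), of t] fX[OF in_X(3), of u] fX[OF aX(2), of t t] fX[OF aX(2), of u t]
          fX[OF aX(1), of t t] fX[OF aX(1), of u t] fX[OF aX(1), of t "Suc t"] fX[OF aX(1), of u "Suc t"]
          fX[OF aX(1), of t "Suc u"] fX[OF aX(1), of u "Suc u"]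
        by (auto dest: sym)
      show "set [y, a t, x t, f t, f u, a (Suc u), a (Suc t)] \<subseteq> closure_set"
        using fcl aX in_X(3) Xcl by auto
    qed (use tu f ay xa in \<open>simp_all add: insert_commute\<close>)
  next
    case no: False
    \<comment> \<open>The cycle runs \<open>a t, x t, f t, a (Suc t)\<close>, so that the neighbours
      of \<open>y\<close> come at the multiples of 3.\<close>
    define g where "g i = (if i mod 3 = 0 then a (i div 3) else if i mod 3 = 1 then x (i div 3) else f (i div 3))" for i
    have g: "g (3 * t) = a t" "g (3 * t + 1) = x t" "g (3 * t + 2) = f t" for t
    proof -
      have m: "(3 * t) mod 3 = 0" "(3 * t + 1) mod 3 = 1" "(3 * t + 2) mod 3 = 2"
        "(3 * t) div 3 = t" "(3 * t + 1) div 3 = t" "(3 * t + 2) div 3 = t" by presburger+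
      show "g (3 * t) = a t" "g (3 * t + 1) = x t" "g (3 * t + 2) = f t"
        unfolding g_def m by simp_all
    qed
    have rep: "\<exists>t<n. i = 3 * t \<or> i = 3 * t + 1 \<or> i = 3 * t + 2" if "i < 3 * n" for i
    proof -
      have "i div 3 < n" using that by simp
      moreover have "i = 3 * (i div 3) \<or> i = 3 * (i div 3) + 1 \<or> i = 3 * (i div 3) + 2" by presburger
      ultimately show ?thesis by blast
    qed
    have img: "\<exists>t<n. v = a t \<or> v = x t \<or> v = f t" if v: "v \<in> g ` {..<3 * n}" for v
    proof -
      obtain i where "i < 3 * n" "v = g i" using v by auto
      then show ?thesis using rep[of i] g by metis
    qed
    define Es where "Es = {{g i, g (Suc i mod (3 * n))} |i. i < 3 * n} \<union> {{y, g (3 * t)} |t. t < n}"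
    have amod: "a (Suc t mod n) = a (Suc t)" if "t < n" for t using smod[OF that] by (simp add: a_def)
    have FI: "{g i, g (Suc i mod (3 * n))} \<in> Es" if "i < 3 * n" for i unfolding Es_def using that by blast
    have step: "Suc (3 * t) mod (3 * n) = 3 * t + 1" "Suc (3 * t + 1) mod (3 * n) = 3 * t + 2"
      "Suc (3 * t + 2) mod (3 * n) = 3 * (Suc t mod n)" if "t < n" for t
    proof -
      have "Suc (3 * t + 2) = 3 * Suc t" by simp
      then show "Suc (3 * t + 2) mod (3 * n) = 3 * (Suc t mod n)" by (simp only: mult_mod_right)
    qed (use that in simp_all)
    have F: "{a t, x t} \<in> Es" "{x t, f t} \<in> Es" "{f t, a (Suc t)} \<in> Es" "{y, a t} \<in> Es" if t: "t < n" for t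
    proof -
      have l: "3 * t < 3 * n" "3 * t + 1 < 3 * n" "3 * t + 2 < 3 * n" using t by linarith+
      show "{a t, x t} \<in> Es" "{x t, f t} \<in> Es" "{f t, a (Suc t)} \<in> Es"
        using FI[OF l(1)] FI[OF l(2)] FI[OF l(3)] unfolding step[OF t] g amod[OF t] .
      have "{y, g (3 * t)} \<in> Es" unfolding Es_def using t by blast
      then show "{y, a t} \<in> Es" unfolding g .
    qed
    \<comment> \<open>The flag before \<open>a t\<close> has index \<open>t - 1\<close>, or
      \<open>n - 1\<close> for \<open>t = 0\<close> because of \<open>s n = s 0\<close>.\<close>
    have pre: "\<exists>u<n. a (Suc u) = a t" if "t < n" for t
    proof (cases t)
      case 0
      have "a (Suc (n - 1)) = a 0" using n sn by (simp add: a_def)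
      then show ?thesis using 0 n by (intro exI[of _ "n - 1"]) simp
    next
      case (Suc u)
      then show ?thesis using that by (intro exI[of _ u]) simp
    qed
    \<comment> \<open>The ring and the spokes already use up the degree 2 of \<open>x t\<close> and
      the degree 3 of \<open>a t\<close>, so extra edges could only join \<open>y\<close> to a flag,
      which closes a triangle, or two flags, which is excluded in this case.\<close>
    have xnb: "v = a t \<or> v = f t" if "adj (x t) v" for t v
      using deg2_unique[OF dx xa f(2), of t v] that fX[OF aX(1), of t t] by auto
    have anb: "v = y \<or> v = x t \<or> v = f u" if v: "adj (a t) v" and u: "a (Suc u) = a t" for t u v
    proof (rule ccontr)
      assume n: "\<not> ?thesis"
      have "adj (a t) (f u)" using f(3)[of u] u by simp
      then have "v = f u"
        using deg3_unique[OF da ay adj_sym[OF xa] xy(1)[symmetric] v, of "f u"] n fX[OF in_X(3)] fX[OF aX(2)] by auto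
      then show False using n by simp
    qed
    have one: "{u, v} \<in> Es" if uv: "u = y \<or> (\<exists>t<n. u = a t) \<or> (\<exists>t<n. u = x t)"
        "v = y \<or> (\<exists>t<n. v = a t \<or> v = x t \<or> v = f t)" "adj u v" for u v
    proof -
      consider "u = y" | t where "t < n" "u = a t" | t where "t < n" "u = x t" using uv(1) by blast
      then show ?thesis
      proof cases
        case 1
        have "v \<noteq> y" using adjD uv(3) 1 by blast
        moreover have "v \<noteq> x t" if "t < n" for t
        proof
          assume "v = x t"
          then have "adj (x t) y" using uv(3) 1 by (simp add: insert_commute)
          then show False using xnb[of t y] xy(2) fX[OF in_X(3)] by metis
        qed
        moreover have "v \<noteq> f t" if "t < n" for t
          using no_triangle[of y "f t" "a (Suc t)"] uv(3) 1 f(3)[of t] ay[of "Suc t"] by (auto simp: insert_commute)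
        ultimately obtain t where "t < n" "v = a t" using uv(2) by blast
        then show ?thesis using F(4) 1 by simp
      next
        case (2 t)
        obtain w where w: "w < n" "a (Suc w) = a t" using pre[OF 2(1)] by blast
        have "v = y \<or> v = x t \<or> v = f w" by (rule anb) (use uv(3) 2 w in simp_all)
        then show ?thesis
          using F(1,4)[OF 2(1)] F(3)[OF w(1)] 2(2) w(2) by (auto simp only: insert_commute)
      next
        case (3 t)
        have "v = a t \<or> v = f t" by (rule xnb) (use uv(3) 3 in simp)
        then show ?thesis using F(1,2)[OF 3(1)] 3(2) by (auto simp only: insert_commute)
      qed
    qed
    show ?thesis
    proof (rule has_anchored_cycleI[OF n2])
      show "inj_on g {..<3 * n}"
      proof (rule inj_onI)
        fix i j assume ij: "i \<in> {..<3 * n}" "j \<in> {..<3 * n}" "g i = g j"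
        obtain t where t: "t < n" "i = 3 * t \<or> i = 3 * t + 1 \<or> i = 3 * t + 2" using rep ij(1) by auto
        obtain u where u: "u < n" "j = 3 * u \<or> j = 3 * u + 1 \<or> j = 3 * u + 2" using rep ij(2) by auto
        have A: "t = u" if "a t = a u" using sinj[OF ainj[OF that] t(1) u(1)] .
        have B: "t = u" if "x t = x u" using sinj[OF xinj[OF that] t(1) u(1)] .
        have C: "t = u" if "f t = f u" using finj[OF that t(1) u(1)] .
        have "a t \<noteq> x u" "a t \<noteq> f u" "x t \<noteq> f u" "x t \<noteq> a u" "f t \<noteq> a u" "f t \<noteq> x u"
          using xy(3) fX[OF aX(1)] fX[OF aX(2)] by metis+
        then show "i = j" using t(2) u(2) ij(3) A B C by (elim disjE; simp only: g)
      qed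
      show "y \<notin> g ` {..<3 * n}"
        using img[of y] xy fX[OF in_X(3)] by metis
      show "insert y (g ` {..<3 * n}) \<subseteq> closure_set"
      proof (rule insert_subsetI)
        show "g ` {..<3 * n} \<subseteq> closure_set"
        proof
          fix v assume "v \<in> g ` {..<3 * n}"
          then obtain t where "v = a t \<or> v = x t \<or> v = f t" using img by blast
          then show "v \<in> closure_set" using fcl[of t] subsetD[OF Xcl aX(1), of t] subsetD[OF Xcl aX(2), of t] by metis
        qed
      qed (rule subsetD[OF Xcl in_X(3)])
      show "adj (g i) (g (Suc i mod (3 * n)))" if i: "i < 3 * n" for i
      proof -
        obtain t where t: "t < n" "i = 3 * t \<or> i = 3 * t + 1 \<or> i = 3 * t + 2" using rep[OF i] by auto
        from t(2) show ?thesis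
          using g xa[of t] f(2)[of t] f(3)[of t] amod[OF t(1)] step[OF t(1)]
          by (elim disjE) (simp_all only: insert_commute)
      qed
      show "adj y (g (3 * t))" if "t < n" for t using ay[of t] g(1) by (simp add: insert_commute)
      fix u v assume uv: "u \<in> insert y (g ` {..<3 * n})" "v \<in> insert y (g ` {..<3 * n})" "adj u v"
      have c: "w = y \<or> (\<exists>t<n. w = a t \<or> w = x t \<or> w = f t)" if "w \<in> insert y (g ` {..<3 * n})" for w
        using img that by blast
      have "{u, v} \<in> Es"
      proof (cases "(\<exists>t<n. u = f t) \<and> (\<exists>t<n. v = f t)")
        case True
        then show ?thesis using no uv(3) by blast
      next
        case False
        then have "(u = y \<or> (\<exists>t<n. u = a t) \<or> (\<exists>t<n. u = x t)) \<or> (v = y \<or> (\<exists>t<n. v = a t) \<or> (\<exists>t<n. v = x t))"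
          using c[OF uv(1)] c[OF uv(2)] by blast
        then show ?thesis
        proof
          assume "u = y \<or> (\<exists>t<n. u = a t) \<or> (\<exists>t<n. u = x t)"
          from one[OF this c[OF uv(2)] uv(3)] show ?thesis .
        next
          assume "v = y \<or> (\<exists>t<n. v = a t) \<or> (\<exists>t<n. v = x t)"
          from one[OF this c[OF uv(1)] adj_sym[OF uv(3)]] show ?thesis by (simp only: insert_commute)
        qed
      qed
      then show "{u, v} \<in> {{g i, g (Suc i mod (3 * n))} |i. i < 3 * n} \<union> {{y, g (3 * t)} |t. t < n}"
        unfolding Es_def .
    qed
  qed
qed

lemma windmill_has_anchored_cycle: has_anchored_cycle
proof -
  have "finite {p \<in> S. length p < 4}" using finS by simp
  from list_order[OF this, of must_precede] show ?thesis
  proof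
    assume "\<exists>xs. distinct xs \<and> set xs = {p \<in> S. length p < 4} \<and>
      (\<forall>us q vs. xs = us @ q # vs \<longrightarrow> (\<forall>p\<in>set us. \<not> must_precede q p))"
    then show ?thesis using no_good_order by blast
  next
    assume "\<exists>B\<subseteq>{p \<in> S. length p < 4}. B \<noteq> {} \<and> (\<forall>p\<in>B. \<exists>q\<in>B. must_precede q p)"
    then show ?thesis using ring_found by blast
  qed
qed

end

theorem theorem5p2:
  fixes G W :: "'a sgraph"
  assumes "simple_graph G"
    and "critical G"
    and "girth G \<ge> 5"
    and "complete_windmill G W"
  shows "\<exists>k H. k \<ge> 2 \<and> anchored_cycle k H \<and> induced_subgraph H (windmill_closure G W)"
proof -
  obtain k y where "k_windmill G k y W"
    using assms(4) by (auto simp: complete_windmill_def windmill_def)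
  then obtain S where k: "3 \<le> k" "degree G y = max 4 k \<or> degree G y = k + 1"
    and S: "finite S" "card S = k" "inj_on tip S" "\<forall>p\<in>S. sail G p \<and> last p = y"
    and W: "W = induce G (\<Union>p\<in>S. set p)"
    by (auto simp: k_windmill_def)
  interpret sails G y S
    by unfold_locales (use assms S k in auto)
  show ?thesis using windmill_has_anchored_cycle unfolding has_anchored_cycle_def X_def W .
qed

end
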